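(* Let $R$ be a commutative Noetherian local ring and let $M$ be an $R$-module. Assume: (i) $[M^{\ast}]=0$ in $\overline{G}(R)_{\mathbb{Q}}$. (ii) $M$ is generically free. (iii) $M$ is $2$-periodic and rigid. Then $M$ is free.
   Context: All modules are finitely generated. $M^{\ast}=\operatorname{Hom}_R(M,R)$. $M$ is rigid if $\operatorname{Ext}^1_R(M,M)=0$. $M$ is generically free if $M_{\mathfrak{p}}$ is a free $R_{\mathfrak{p}}$-module for all $\mathfrak{p}\in\operatorname{Ass}(R)$. $\Omega^n_R M$ denotes the $n$th syzygy in a minimal free resolution of $M$. $M$ is $n$-periodic if $M\oplus F\cong\Omega^n_R M\oplus G$ for some (finitely generated) free $R$-modules $F$ and $G$. $G(R)$ is the Grothendieck group of the category of (finitely generated) $R$-modules: the free abelian group on isomorphism classes $[X]$ of $R$-modules modulo the relations $[X]-[X']-[X'']$ for all short exact sequences $0\to X'\to X\to X''\to 0$. $\overline{G}(R)_{\mathbb{Q}}=(G(R)/\mathbb{Z}\cdot[R])\otimes_{\mathbb{Z}}\mathbb{Q}$, and $[X]$ also denotes the class of $X$ in it. *)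

theory Defs
  imports "HOL-Algebra.Module" "HOL-Algebra.Ring_Divisibility" "HOL-Algebra.Free_Abelian_Groups"
begin

text \<open>
  In all module records built below the fields \<open>mult\<close> and \<open>one\<close>, which the record type
  inherits from \<open>ring\<close> and which the locale \<open>module\<close> ignores, are \<open>undefined\<close>.
\<close>

section \<open>Modules\<close>

definition module_span :: "('a, 'r) ring_scheme \<Rightarrow> ('a, 'm, 'c) module_scheme \<Rightarrow> 'm set \<Rightarrow> 'm set"
  where "module_span R M A = \<Inter>{H. submodule H R M \<and> A \<subseteq> H}"

definition fg_module :: "('a, 'r) ring_scheme \<Rightarrow> ('a, 'm, 'c) module_scheme \<Rightarrow> bool"
  where "fg_module R M \<longleftrightarrow>
    module R M \<and> (\<exists>A \<subseteq> carrier M. finite A \<and> carrier M = module_span R M A)"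

definition mod_hom ::
  "('a, 'r) ring_scheme \<Rightarrow> ('a, 'm, 'c) module_scheme \<Rightarrow> ('a, 'n, 'd) module_scheme \<Rightarrow> ('m \<Rightarrow> 'n) set"
  where "mod_hom R M N =
    {f \<in> hom (add_monoid M) (add_monoid N).
      \<forall>a \<in> carrier R. \<forall>x \<in> carrier M. f (a \<odot>\<^bsub>M\<^esub> x) = a \<odot>\<^bsub>N\<^esub> f x}"

definition mod_iso ::
  "('a, 'r) ring_scheme \<Rightarrow> ('a, 'm, 'c) module_scheme \<Rightarrow> ('a, 'n, 'd) module_scheme \<Rightarrow> bool"
  where "mod_iso R M N \<longleftrightarrow> (\<exists>f \<in> mod_hom R M N. bij_betw f (carrier M) (carrier N))"

text \<open>Homomorphisms are represented by extensional functions, so that equality in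
  \<open>Hom\<^sub>R(M, N)\<close> is equality on the carrier of \<open>M\<close>.\<close>

definition hom_module ::
  "('a, 'r) ring_scheme \<Rightarrow> ('a, 'm, 'c) module_scheme \<Rightarrow> ('a, 'n, 'd) module_scheme
    \<Rightarrow> ('a, 'm \<Rightarrow> 'n) module"
  where "hom_module R M N =
    \<lparr>carrier = mod_hom R M N \<inter> extensional (carrier M),
     monoid.mult = undefined, one = undefined,
     ring.zero = (\<lambda>x \<in> carrier M. \<zero>\<^bsub>N\<^esub>),
     add = (\<lambda>f g. \<lambda>x \<in> carrier M. f x \<oplus>\<^bsub>N\<^esub> g x),
     smult = (\<lambda>a f. \<lambda>x \<in> carrier M. a \<odot>\<^bsub>N\<^esub> f x)\<rparr>"

definition regular_module :: "('a, 'r) ring_scheme \<Rightarrow> ('a, 'a) module"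
  where "regular_module R =
    \<lparr>carrier = carrier R, monoid.mult = undefined, one = undefined,
     ring.zero = \<zero>\<^bsub>R\<^esub>, add = add R, smult = monoid.mult R\<rparr>"

definition dual_module ::
  "('a, 'r) ring_scheme \<Rightarrow> ('a, 'm, 'c) module_scheme \<Rightarrow> ('a, 'm \<Rightarrow> 'a) module"
  where "dual_module R M = hom_module R M (regular_module R)"

definition quotient_module ::
  "('a, 'm, 'c) module_scheme \<Rightarrow> 'm set \<Rightarrow> ('a, 'm set) module"
  where "quotient_module M H =
    \<lparr>carrier = a_rcosets\<^bsub>M\<^esub> H, monoid.mult = undefined, one = undefined,
     ring.zero = H, add = set_add M,
     smult = (\<lambda>a X. \<Union>x \<in> X. H +>\<^bsub>M\<^esub> (a \<odot>\<^bsub>M\<^esub> x))\<rparr>"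

definition direct_sum ::
  "('a, 'm, 'c) module_scheme \<Rightarrow> ('a, 'n, 'd) module_scheme \<Rightarrow> ('a, 'm \<times> 'n) module"
  where "direct_sum M N =
    \<lparr>carrier = carrier M \<times> carrier N, monoid.mult = undefined, one = undefined,
     ring.zero = (\<zero>\<^bsub>M\<^esub>, \<zero>\<^bsub>N\<^esub>),
     add = (\<lambda>(x, y) (x', y'). (x \<oplus>\<^bsub>M\<^esub> x', y \<oplus>\<^bsub>N\<^esub> y')),
     smult = (\<lambda>a (x, y). (a \<odot>\<^bsub>M\<^esub> x, a \<odot>\<^bsub>N\<^esub> y))\<rparr>"

text \<open>The standard free module \<open>R\<^sup>n\<close>.\<close>

definition free_mod :: "('a, 'r) ring_scheme \<Rightarrow> nat \<Rightarrow> ('a, nat \<Rightarrow> 'a) module"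
  where "free_mod R n =
    \<lparr>carrier = {..<n} \<rightarrow>\<^sub>E carrier R, monoid.mult = undefined, one = undefined,
     ring.zero = (\<lambda>i \<in> {..<n}. \<zero>\<^bsub>R\<^esub>),
     add = (\<lambda>x y. \<lambda>i \<in> {..<n}. x i \<oplus>\<^bsub>R\<^esub> y i),
     smult = (\<lambda>a x. \<lambda>i \<in> {..<n}. a \<otimes>\<^bsub>R\<^esub> x i)\<rparr>"

text \<open>Only used for finitely generated modules, which can only be free of finite rank.\<close>

definition is_free :: "('a, 'r) ring_scheme \<Rightarrow> ('a, 'm, 'c) module_scheme \<Rightarrow> bool"
  where "is_free R M \<longleftrightarrow> (\<exists>n. mod_iso R M (free_mod R n))"


section \<open>Local rings, localization and associated primes\<close>

locale local_ring = cring +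
  assumes unique_maximal: "\<exists>!m. maximalideal m R"

definition max_ideal :: "('a, 'r) ring_scheme \<Rightarrow> 'a set"
  where "max_ideal R = (THE m. maximalideal m R)"

text \<open>The fraction \<open>x/s\<close> is the class of \<open>(x, s)\<close> under
  \<open>(x, s) \<sim> (y, t) \<longleftrightarrow> (\<exists>u \<in> S. u t x = u s y)\<close>.
  Operations on fractions are unions over all choices of representatives, which are
  unions of copies of one and the same class.\<close>

definition fraction :: "('a, 'm, 'c) module_scheme \<Rightarrow> 'a set \<Rightarrow> 'm \<Rightarrow> 'a \<Rightarrow> ('m \<times> 'a) set"
  where "fraction M S x s =
    {(y, t). y \<in> carrier M \<and> t \<in> S \<and>
      (\<exists>u \<in> S. u \<odot>\<^bsub>M\<^esub> (t \<odot>\<^bsub>M\<^esub> x) = u \<odot>\<^bsub>M\<^esub> (s \<odot>\<^bsub>M\<^esub> y))}"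

definition loc_module ::
  "('a, 'r) ring_scheme \<Rightarrow> 'a set \<Rightarrow> ('a, 'm, 'c) module_scheme
    \<Rightarrow> (('a \<times> 'a) set, ('m \<times> 'a) set) module"
  where "loc_module R S M =
    \<lparr>carrier = {fraction M S x s | x s. x \<in> carrier M \<and> s \<in> S},
     monoid.mult = undefined, one = undefined,
     ring.zero = fraction M S \<zero>\<^bsub>M\<^esub> \<one>\<^bsub>R\<^esub>,
     add = (\<lambda>X Y. \<Union>(x, s) \<in> X. \<Union>(y, t) \<in> Y.
       fraction M S ((t \<odot>\<^bsub>M\<^esub> x) \<oplus>\<^bsub>M\<^esub> (s \<odot>\<^bsub>M\<^esub> y)) (s \<otimes>\<^bsub>R\<^esub> t)),
     smult = (\<lambda>A X. \<Union>(a, s) \<in> A. \<Union>(x, t) \<in> X. fraction M S (a \<odot>\<^bsub>M\<^esub> x) (s \<otimes>\<^bsub>R\<^esub> t))\<rparr>"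

definition loc_ring :: "('a, 'r) ring_scheme \<Rightarrow> 'a set \<Rightarrow> ('a \<times> 'a) set ring"
  where "loc_ring R S = (let L = loc_module R S (regular_module R) in
    \<lparr>carrier = carrier L, monoid.mult = smult L, one = fraction (regular_module R) S \<one>\<^bsub>R\<^esub> \<one>\<^bsub>R\<^esub>,
     ring.zero = ring.zero L, add = add L\<rparr>)"

definition Ass :: "('a, 'r) ring_scheme \<Rightarrow> 'a set set"
  where "Ass R = {p. primeideal p R \<and> (\<exists>x \<in> carrier R. p = {a \<in> carrier R. a \<otimes>\<^bsub>R\<^esub> x = \<zero>\<^bsub>R\<^esub>})}"

definition generically_free :: "('a, 'r) ring_scheme \<Rightarrow> ('a, 'm, 'c) module_scheme \<Rightarrow> bool"
  where "generically_free R M \<longleftrightarrow>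
    (\<forall>p \<in> Ass R. is_free (loc_ring R (carrier R - p)) (loc_module R (carrier R - p) M))"


section \<open>Free resolutions, syzygies and Ext\<close>

text \<open>A resolution \<open>\<dots> \<rightarrow> F\<^sub>2 \<rightarrow> F\<^sub>1 \<rightarrow> F\<^sub>0 \<rightarrow> M \<rightarrow> 0\<close> by finitely generated free modules
  \<open>F\<^sub>n = R\<^sup>r\<close> with \<open>r = res_rank F n\<close>. The map \<open>res_diff F n\<close> goes from \<open>F\<^sub>n\<close> to
  \<open>F\<^sub>n\<^sub>-\<^sub>1\<close>; its value at \<open>n = 0\<close> is irrelevant.\<close>

record ('a, 'm) resolution =
  res_rank :: "nat \<Rightarrow> nat"
  res_diff :: "nat \<Rightarrow> (nat \<Rightarrow> 'a) \<Rightarrow> nat \<Rightarrow> 'a"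
  res_aug :: "(nat \<Rightarrow> 'a) \<Rightarrow> 'm"

definition res_mod :: "('a, 'r) ring_scheme \<Rightarrow> ('a, 'm) resolution \<Rightarrow> nat \<Rightarrow> ('a, nat \<Rightarrow> 'a) module"
  where "res_mod R F n = free_mod R (res_rank F n)"

definition free_resolution ::
  "('a, 'r) ring_scheme \<Rightarrow> ('a, 'm, 'c) module_scheme \<Rightarrow> ('a, 'm) resolution \<Rightarrow> bool"
  where "free_resolution R M F \<longleftrightarrow>
    res_aug F \<in> mod_hom R (res_mod R F 0) M \<and>
    res_aug F ` carrier (res_mod R F 0) = carrier M \<and>
    (\<forall>n. res_diff F (Suc n) \<in> mod_hom R (res_mod R F (Suc n)) (res_mod R F n)) \<and>
    res_diff F 1 ` carrier (res_mod R F 1) = a_kernel (res_mod R F 0) M (res_aug F) \<and>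
    (\<forall>n. res_diff F (Suc (Suc n)) ` carrier (res_mod R F (Suc (Suc n))) =
      a_kernel (res_mod R F (Suc n)) (res_mod R F n) (res_diff F (Suc n)))"

text \<open>Minimality over a local ring with maximal ideal \<open>m\<close>: each differential maps \<open>F\<^sub>n\<^sub>+\<^sub>1\<close>
  into \<open>m F\<^sub>n\<close>, the vectors with all entries in \<open>m\<close>.\<close>

definition minimal_free_resolution ::
  "('a, 'r) ring_scheme \<Rightarrow> ('a, 'm, 'c) module_scheme \<Rightarrow> ('a, 'm) resolution \<Rightarrow> bool"
  where "minimal_free_resolution R M F \<longleftrightarrow>
    free_resolution R M F \<and>
    (\<forall>n. \<forall>x \<in> carrier (res_mod R F (Suc n)). \<forall>i < res_rank F n.
      res_diff F (Suc n) x i \<in> max_ideal R)"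

text \<open>The image of \<open>F\<^sub>n \<rightarrow> F\<^sub>n\<^sub>-\<^sub>1\<close>, for \<open>n \<ge> 1\<close>.\<close>

definition syzygy :: "('a, 'r) ring_scheme \<Rightarrow> ('a, 'm) resolution \<Rightarrow> nat \<Rightarrow> ('a, nat \<Rightarrow> 'a) module"
  where "syzygy R F n =
    (res_mod R F (n - 1)) \<lparr>carrier := res_diff F n ` carrier (res_mod R F n)\<rparr>"

text \<open>A minimal free resolution of a finitely generated module over a Noetherian local ring
  exists and is unique up to isomorphism, so quantifying over it existentially
  or universally amounts to the same. Meant for \<open>n \<ge> 1\<close>.\<close>

definition periodic :: "nat \<Rightarrow> ('a, 'r) ring_scheme \<Rightarrow> ('a, 'm, 'c) module_scheme \<Rightarrow> bool"
  where "periodic n R M \<longleftrightarrow>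
    (\<exists>F. minimal_free_resolution R M F \<and>
      (\<exists>k l. mod_iso R (direct_sum M (free_mod R k)) (direct_sum (syzygy R F n) (free_mod R l))))"

text \<open>For a free resolution \<open>F\<close> of \<open>M\<close>, \<open>ext_module R F N n\<close> is
  \<open>Ext\<^sup>n\<^sub>R(M, N) = H\<^sup>n(Hom\<^sub>R(F, N))\<close>.\<close>

definition cochains ::
  "('a, 'r) ring_scheme \<Rightarrow> ('a, 'm) resolution \<Rightarrow> ('a, 'n, 'd) module_scheme \<Rightarrow> nat
    \<Rightarrow> ('a, (nat \<Rightarrow> 'a) \<Rightarrow> 'n) module"
  where "cochains R F N n = hom_module R (res_mod R F n) N"

definition codiff ::
  "('a, 'r) ring_scheme \<Rightarrow> ('a, 'm) resolution \<Rightarrow> nat \<Rightarrow> ((nat \<Rightarrow> 'a) \<Rightarrow> 'n) \<Rightarrow> (nat \<Rightarrow> 'a) \<Rightarrow> 'n"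
  where "codiff R F n f = restrict (f \<circ> res_diff F (Suc n)) (carrier (res_mod R F (Suc n)))"

fun coboundaries ::
  "('a, 'r) ring_scheme \<Rightarrow> ('a, 'm) resolution \<Rightarrow> ('a, 'n, 'd) module_scheme \<Rightarrow> nat
    \<Rightarrow> ((nat \<Rightarrow> 'a) \<Rightarrow> 'n) set"
  where
    "coboundaries R F N 0 = {\<zero>\<^bsub>cochains R F N 0\<^esub>}"
  | "coboundaries R F N (Suc n) = codiff R F n ` carrier (cochains R F N n)"

definition ext_module ::
  "('a, 'r) ring_scheme \<Rightarrow> ('a, 'm) resolution \<Rightarrow> ('a, 'n, 'd) module_scheme \<Rightarrow> nat
    \<Rightarrow> ('a, ((nat \<Rightarrow> 'a) \<Rightarrow> 'n) set) module"
  where "ext_module R F N n =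
    quotient_module
      ((cochains R F N n)
        \<lparr>carrier := a_kernel (cochains R F N n) (cochains R F N (Suc n)) (codiff R F n)\<rparr>)
      (coboundaries R F N n)"

text \<open>As Ext does not depend on the free resolution up to isomorphism, it again does not
  matter whether the resolution is quantified existentially or universally.\<close>

definition rigid :: "('a, 'r) ring_scheme \<Rightarrow> ('a, 'm, 'c) module_scheme \<Rightarrow> bool"
  where "rigid R M \<longleftrightarrow>
    (\<exists>F. free_resolution R M F \<and> carrier (ext_module R F M 1) = {\<zero>\<^bsub>ext_module R F M 1\<^esub>})"


section \<open>The reduced Grothendieck group with rational coefficients\<close>

text \<open>Every finitely generated \<open>R\<close>-module is isomorphic to a quotient of some \<open>R\<^sup>n\<close>, whose elements
  have type \<^typ>\<open>(nat \<Rightarrow> 'a) set\<close>. Hence the modules over this type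
  represent all isomorphism classes of finitely generated modules, and a module \<open>M\<close> over
  any type has a class.\<close>

type_synonym 'a fg_rep = "('a, (nat \<Rightarrow> 'a) set) module"

definition iso_class :: "('a, 'r) ring_scheme \<Rightarrow> ('a, 'm, 'c) module_scheme \<Rightarrow> 'a fg_rep set"
  where "iso_class R M = {X. fg_module R X \<and> mod_iso R M X}"

definition iso_classes :: "('a, 'r) ring_scheme \<Rightarrow> 'a fg_rep set set"
  where "iso_classes R = {iso_class R X | X :: 'a fg_rep. fg_module R X}"

definition short_exact ::
  "('a, 'r) ring_scheme \<Rightarrow> ('a, 'l, 'b) module_scheme \<Rightarrow> ('l \<Rightarrow> 'm) \<Rightarrow> ('a, 'm, 'c) module_scheme
    \<Rightarrow> ('m \<Rightarrow> 'n) \<Rightarrow> ('a, 'n, 'd) module_scheme \<Rightarrow> bool"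
  where "short_exact R X' f X g X'' \<longleftrightarrow>
    f \<in> mod_hom R X' X \<and> g \<in> mod_hom R X X'' \<and>
    inj_on f (carrier X') \<and> f ` carrier X' = a_kernel X X'' g \<and> g ` carrier X = carrier X''"

definition exact_relations :: "('a, 'r) ring_scheme \<Rightarrow> ('a fg_rep set \<Rightarrow>\<^sub>0 int) set"
  where "exact_relations R =
    {frag_of (iso_class R X) - frag_of (iso_class R X') - frag_of (iso_class R X'') |
      (X' :: 'a fg_rep) (X :: 'a fg_rep) (X'' :: 'a fg_rep) f g.
      fg_module R X' \<and> fg_module R X \<and> fg_module R X'' \<and> short_exact R X' f X g X''}"

text \<open>The abelian group on the generators \<open>S\<close> subject to the relators \<open>Q\<close>.\<close>

definition presented_group :: "'x set \<Rightarrow> ('x \<Rightarrow>\<^sub>0 int) set \<Rightarrow> ('x \<Rightarrow>\<^sub>0 int) set monoid"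
  where "presented_group S Q = free_Abelian_group S Mod generate (free_Abelian_group S) Q"

definition presented_gen :: "'x set \<Rightarrow> ('x \<Rightarrow>\<^sub>0 int) set \<Rightarrow> 'x \<Rightarrow> ('x \<Rightarrow>\<^sub>0 int) set"
  where "presented_gen S Q x =
    generate (free_Abelian_group S) Q #>\<^bsub>free_Abelian_group S\<^esub> frag_of x"

definition groth_group :: "('a, 'r) ring_scheme \<Rightarrow> ('a fg_rep set \<Rightarrow>\<^sub>0 int) set monoid"
  where "groth_group R = presented_group (iso_classes R) (exact_relations R)"

definition groth_class ::
  "('a, 'r) ring_scheme \<Rightarrow> ('a, 'm, 'c) module_scheme \<Rightarrow> ('a fg_rep set \<Rightarrow>\<^sub>0 int) set"
  where "groth_class R M = presented_gen (iso_classes R) (exact_relations R) (iso_class R M)"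

definition groth_free_subgroup ::
  "('a, 'r) ring_scheme \<Rightarrow> ('a fg_rep set \<Rightarrow>\<^sub>0 int) set set"
  where "groth_free_subgroup R = generate (groth_group R) {groth_class R (regular_module R)}"

definition reduced_groth_group ::
  "('a, 'r) ring_scheme \<Rightarrow> ('a fg_rep set \<Rightarrow>\<^sub>0 int) set set monoid"
  where "reduced_groth_group R = groth_group R Mod groth_free_subgroup R"

definition reduced_groth_class ::
  "('a, 'r) ring_scheme \<Rightarrow> ('a, 'm, 'c) module_scheme \<Rightarrow> ('a fg_rep set \<Rightarrow>\<^sub>0 int) set set"
  where "reduced_groth_class R M = groth_free_subgroup R #>\<^bsub>groth_group R\<^esub> groth_class R M"

text \<open>The tensor product over the integers of two abelian groups.\<close>

definition tensor_relations :: "('x, 'b) monoid_scheme \<Rightarrow> ('y, 'c) monoid_scheme \<Rightarrow> ('x \<times> 'y \<Rightarrow>\<^sub>0 int) set"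
  where "tensor_relations A B =
    {frag_of (a \<otimes>\<^bsub>A\<^esub> a', b) - frag_of (a, b) - frag_of (a', b) | a a' b.
      a \<in> carrier A \<and> a' \<in> carrier A \<and> b \<in> carrier B} \<union>
    {frag_of (a, b \<otimes>\<^bsub>B\<^esub> b') - frag_of (a, b) - frag_of (a, b') | a b b'.
      a \<in> carrier A \<and> b \<in> carrier B \<and> b' \<in> carrier B}"

definition tensor_group ::
  "('x, 'b) monoid_scheme \<Rightarrow> ('y, 'c) monoid_scheme \<Rightarrow> ('x \<times> 'y \<Rightarrow>\<^sub>0 int) set monoid"
  where "tensor_group A B = presented_group (carrier A \<times> carrier B) (tensor_relations A B)"

definition pure_tensor ::
  "('x, 'b) monoid_scheme \<Rightarrow> ('y, 'c) monoid_scheme \<Rightarrow> 'x \<Rightarrow> 'y \<Rightarrow> ('x \<times> 'y \<Rightarrow>\<^sub>0 int) set"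
  where "pure_tensor A B a b = presented_gen (carrier A \<times> carrier B) (tensor_relations A B) (a, b)"

definition rat_group :: "rat monoid"
  where "rat_group = \<lparr>carrier = UNIV, monoid.mult = (+), one = 0\<rparr>"

definition rational_reduced_groth_group ::
  "('a, 'r) ring_scheme \<Rightarrow> (('a fg_rep set \<Rightarrow>\<^sub>0 int) set set \<times> rat \<Rightarrow>\<^sub>0 int) set monoid"
  where "rational_reduced_groth_group R = tensor_group (reduced_groth_group R) rat_group"

definition rational_reduced_groth_class ::
  "('a, 'r) ring_scheme \<Rightarrow> ('a, 'm, 'c) module_scheme
    \<Rightarrow> (('a fg_rep set \<Rightarrow>\<^sub>0 int) set set \<times> rat \<Rightarrow>\<^sub>0 int) set"
  where "rational_reduced_groth_class R M =
    pure_tensor (reduced_groth_group R) rat_group (reduced_groth_class R M) 1"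


end

theory Submission
  imports Defs "HOL-Library.Extended_Nat"
begin

text \<open>
  Let \<open>\<dots> \<rightarrow> F\<^sub>1 \<rightarrow> F\<^sub>0 \<rightarrow> M\<close> be a minimal free resolution. An isomorphism of \<open>M \<oplus> R\<^sup>k\<close> with
  \<open>\<Omega>\<^sup>2 M \<oplus> R\<^sup>l\<close> splices its first two terms into a two-periodic exact complex
  \<open>\<dots> \<rightarrow> R\<^sup>n \<rightarrow> R\<^sup>n \<rightarrow> R\<^sup>n \<rightarrow> \<dots>\<close> with alternating square matrices \<open>A\<close> and \<open>B\<close>, where
  \<open>coker A = M \<oplus> R\<^sup>k\<close> and \<open>im A = \<Omega> M\<close>. The two ranks agree by additivity of length at a minimal prime of \<open>R\<close>
  (\<open>periodic_rank_eq\<close>). With coefficients in a module \<open>X\<close>, that is, on \<open>X\<^sup>n\<close>, the two homology modules of this complex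
  are the even and the odd \<open>Tor(X, M)\<close> in positive degrees.

  Let \<open>I\<close> be the ideal of all \<open>a\<close> for which multiplication by \<open>a\<close> is null-homotopic, \<open>a = YB + AZ\<close>. It kills all these
  homology modules. If \<open>1 \<in> I\<close>, then \<open>A = AZA\<close>; the entries of \<open>A\<close> lie in the maximal ideal by minimality, so
  \<open>A = 0\<close> by Nakayama's lemma and \<open>M = F\<^sub>0\<close> is free (\<open>free_if_one_in_I\<close>).

  Suppose \<open>1 \<notin> I\<close> and let \<open>S\<close> be the complement of a minimal prime over \<open>I\<close>. The homology with
  coefficients in a finitely generated \<open>X\<close> has finite length after localization at \<open>S\<close>. The difference \<open>h(X)\<close> of the
  two lengths is a Herbrand quotient: it is additive on short exact sequences by the exact hexagon (\<open>herbrand_add\<close>),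
  it vanishes on modules killed by \<open>I\<close>, since kernels and images of two square matrices of the same size are being
  counted (\<open>herbrand_finite_length\<close>), and it vanishes on \<open>R\<close> by exactness. Hence it factors through the reduced
  Grothendieck group, and \<open>h(M\<^sup>*) = 0\<close> by hypothesis (\<open>additive_function_vanishes\<close>, \<open>herbrand_U\<close>).

  Let \<open>N\<close> be the cokernel of the transpose of \<open>B\<close>. Dualizing the complex yields a sequence
  \<open>0 \<rightarrow> M\<^sup>* \<oplus> R\<^sup>k \<rightarrow> R\<^sup>n \<rightarrow> R\<^sup>n \<rightarrow> R\<^sup>n \<rightarrow> N \<rightarrow> 0\<close> whose only homology is \<open>Ext\<^sup>1(M, R)\<close>, which \<open>I\<close> kills. So
  \<open>h(N) = 0\<close> (\<open>herbrand_cokernel\<close>). With coefficients in \<open>N\<close>, one homology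
  module consists of the homomorphisms from \<open>\<Omega> M\<close> to \<open>coker A\<close> modulo those that factor through a free module,
  and rigidity makes it zero, since every homomorphism from \<open>\<Omega> M\<close> to \<open>M\<close> extends to \<open>F\<^sub>0\<close> (\<open>lift_matrices\<close>). As
  \<open>h(N) = 0\<close>, the other one has length zero at \<open>S\<close>. It contains the class of the identity matrix, so some \<open>s \<in> S\<close>
  satisfies \<open>s = YB + AZ\<close> (\<open>null_homotopic_unit\<close>). Then \<open>s \<in> S \<inter> I\<close>, which is a contradiction.
\<close>


section \<open>Submodules and homomorphisms\<close>

lemma set_add_mono:
  "U \<subseteq> U' \<Longrightarrow> W \<subseteq> W' \<Longrightarrow> U <+>\<^bsub>M\<^esub> W \<subseteq> U' <+>\<^bsub>M\<^esub> W'"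
  unfolding set_add_def' by blast

lemma (in abelian_group) add_minus_cancel:
  assumes "x \<in> carrier G" "y \<in> carrier G"
  shows "(x \<oplus> y) \<ominus> x = y" "(x \<oplus> y) \<ominus> y = x" "(x \<ominus> y) \<oplus> y = x"
proof -
  show *: "(x \<oplus> y) \<ominus> y = x" using assms by (simp add: a_minus_def a_assoc r_neg)
  show "(x \<ominus> y) \<oplus> y = x" using assms by (simp add: a_minus_def a_assoc l_neg)
  show "(x \<oplus> y) \<ominus> x = y" using assms by (simp add: a_minus_def a_comm[of x y] a_assoc r_neg)
qed

context module
begin

lemma submodule_iff:
  "submodule H R M \<longleftrightarrow> H \<subseteq> carrier M \<and> \<zero>\<^bsub>M\<^esub> \<in> H \<and> (\<forall>x\<in>H. \<forall>y\<in>H. x \<oplus>\<^bsub>M\<^esub> y \<in> H) \<and>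
     (\<forall>a\<in>carrier R. \<forall>x\<in>H. a \<odot>\<^bsub>M\<^esub> x \<in> H)"
proof
  assume H: "submodule H R M"
  then obtain h where "h \<in> H" "h \<in> carrier M" using submoduleE(1,2) by blast
  then have "\<zero>\<^bsub>M\<^esub> \<in> H"
    using submoduleE(4)[OF H, of "\<zero>" h] by simp
  then show "H \<subseteq> carrier M \<and> \<zero>\<^bsub>M\<^esub> \<in> H \<and> (\<forall>x\<in>H. \<forall>y\<in>H. x \<oplus>\<^bsub>M\<^esub> y \<in> H) \<and>
     (\<forall>a\<in>carrier R. \<forall>x\<in>H. a \<odot>\<^bsub>M\<^esub> x \<in> H)"
    using submoduleE[OF H] by blast
next
  assume H: "H \<subseteq> carrier M \<and> \<zero>\<^bsub>M\<^esub> \<in> H \<and> (\<forall>x\<in>H. \<forall>y\<in>H. x \<oplus>\<^bsub>M\<^esub> y \<in> H) \<and>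
     (\<forall>a\<in>carrier R. \<forall>x\<in>H. a \<odot>\<^bsub>M\<^esub> x \<in> H)"
  have "\<ominus>\<^bsub>M\<^esub> x \<in> H" if "x \<in> H" for x
  proof -
    have "x \<in> carrier M" using H that by blast
    then have "\<ominus>\<^bsub>M\<^esub> x = (\<ominus> \<one>) \<odot>\<^bsub>M\<^esub> x" by (simp add: smult_l_minus)
    moreover have "(\<ominus> \<one>) \<odot>\<^bsub>M\<^esub> x \<in> H" using H that by simp
    ultimately show ?thesis by simp
  qed
  then show "submodule H R M" using H by (intro submoduleI) auto
qed

lemma submoduleD:
  assumes "submodule H R M"
  shows "H \<subseteq> carrier M" "\<And>x. x \<in> H \<Longrightarrow> x \<in> carrier M" "\<zero>\<^bsub>M\<^esub> \<in> H"
    "\<And>x y. x \<in> H \<Longrightarrow> y \<in> H \<Longrightarrow> x \<oplus>\<^bsub>M\<^esub> y \<in> H" "\<And>x y. x \<in> H \<Longrightarrow> y \<in> H \<Longrightarrow> x \<ominus>\<^bsub>M\<^esub> y \<in> H"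
    "\<And>a x. a \<in> carrier R \<Longrightarrow> x \<in> H \<Longrightarrow> a \<odot>\<^bsub>M\<^esub> x \<in> H"
proof -
  note H = assms[unfolded submodule_iff]
  show sub: "H \<subseteq> carrier M" and "\<zero>\<^bsub>M\<^esub> \<in> H" using H by blast+
  show "x \<in> carrier M" if "x \<in> H" for x using sub that by blast
  show "x \<oplus>\<^bsub>M\<^esub> y \<in> H" if "x \<in> H" "y \<in> H" for x y using H that by blast
  show "a \<odot>\<^bsub>M\<^esub> x \<in> H" if "a \<in> carrier R" "x \<in> H" for a x using H that by blast
  show "x \<ominus>\<^bsub>M\<^esub> y \<in> H" if "x \<in> H" "y \<in> H" for x y
    unfolding a_minus_def using submoduleE(3)[OF assms] submoduleE(5)[OF assms] that by blast
qed

lemma submodule_Int: "submodule U R M \<Longrightarrow> submodule W R M \<Longrightarrow> submodule (U \<inter> W) R M"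
  by (auto simp: submodule_iff)

lemma submodule_zero: "submodule {\<zero>\<^bsub>M\<^esub>} R M"
  by (auto simp: submodule_iff)

lemma mem_set_add: "x \<in> U <+>\<^bsub>M\<^esub> W \<longleftrightarrow> (\<exists>u\<in>U. \<exists>w\<in>W. x = u \<oplus>\<^bsub>M\<^esub> w)"
  by (auto simp: set_add_def')

lemma submodule_set_add:
  assumes "submodule U R M" "submodule W R M"
  shows "submodule (U <+>\<^bsub>M\<^esub> W) R M"
proof -
  note U = submoduleD[OF assms(1)] and W = submoduleD[OF assms(2)]
  show ?thesis
    unfolding submodule_iff
  proof (intro conjI ballI subsetI)
    show "x \<in> carrier M" if "x \<in> U <+>\<^bsub>M\<^esub> W" for x
      using that U(2) W(2) by (auto simp: mem_set_add)
    show "\<zero>\<^bsub>M\<^esub> \<in> U <+>\<^bsub>M\<^esub> W"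
      using U(3) W(3) by (auto simp: mem_set_add intro!: bexI[of _ "\<zero>\<^bsub>M\<^esub>"])
    show "x \<oplus>\<^bsub>M\<^esub> y \<in> U <+>\<^bsub>M\<^esub> W" if xy: "x \<in> U <+>\<^bsub>M\<^esub> W" "y \<in> U <+>\<^bsub>M\<^esub> W" for x y
    proof -
      from xy obtain u w u' w' where *: "u \<in> U" "w \<in> W" "u' \<in> U" "w' \<in> W"
        "x = u \<oplus>\<^bsub>M\<^esub> w" "y = u' \<oplus>\<^bsub>M\<^esub> w'" by (auto simp: mem_set_add)
      then have "x \<oplus>\<^bsub>M\<^esub> y = (u \<oplus>\<^bsub>M\<^esub> u') \<oplus>\<^bsub>M\<^esub> (w \<oplus>\<^bsub>M\<^esub> w')"
        using U(2) W(2) by (simp add: M.a_ac)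
      then show ?thesis using *(1-4) U(4) W(4) unfolding mem_set_add by blast
    qed
    show "a \<odot>\<^bsub>M\<^esub> x \<in> U <+>\<^bsub>M\<^esub> W" if a: "a \<in> carrier R" and x: "x \<in> U <+>\<^bsub>M\<^esub> W" for a x
    proof -
      from x obtain u w where *: "u \<in> U" "w \<in> W" "x = u \<oplus>\<^bsub>M\<^esub> w" by (auto simp: mem_set_add)
      then have "a \<odot>\<^bsub>M\<^esub> x = a \<odot>\<^bsub>M\<^esub> u \<oplus>\<^bsub>M\<^esub> a \<odot>\<^bsub>M\<^esub> w"
        using U(2) W(2) a by (simp add: smult_r_distr)
      then show ?thesis using *(1,2) U(6)[OF a] W(6)[OF a] unfolding mem_set_add by blast
    qed
  qed
qed

lemma set_add_upper:
  assumes "submodule U R M" "submodule W R M"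
  shows "U \<subseteq> U <+>\<^bsub>M\<^esub> W" "W \<subseteq> U <+>\<^bsub>M\<^esub> W"
proof -
  note U = submoduleD[OF assms(1)] and W = submoduleD[OF assms(2)]
  show "U \<subseteq> U <+>\<^bsub>M\<^esub> W" using U(2) W(3) by (force simp: mem_set_add)
  show "W \<subseteq> U <+>\<^bsub>M\<^esub> W" using W(2) U(3) by (force simp: mem_set_add)
qed

lemma set_add_least:
  assumes "submodule H R M" "U \<subseteq> H" "W \<subseteq> H"
  shows "U <+>\<^bsub>M\<^esub> W \<subseteq> H"
  using assms(2,3) submoduleD(4)[OF assms(1)] by (fastforce simp: mem_set_add)

lemma set_add_absorb:
  assumes "submodule U R M" "submodule W R M" "W \<subseteq> U"
  shows "U <+>\<^bsub>M\<^esub> W = U"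
  using set_add_upper[OF assms(1,2)] set_add_least[OF assms(1) _ assms(3)] by blast

lemma set_add_zero: "submodule U R M \<Longrightarrow> U <+>\<^bsub>M\<^esub> {\<zero>\<^bsub>M\<^esub>} = U"
  using set_add_absorb[of U "{\<zero>\<^bsub>M\<^esub>}"] submodule_zero submoduleD(3) by blast

end

lemma mod_hom_iff:
  "f \<in> mod_hom R M N \<longleftrightarrow> (\<forall>x\<in>carrier M. f x \<in> carrier N) \<and>
    (\<forall>x\<in>carrier M. \<forall>y\<in>carrier M. f (x \<oplus>\<^bsub>M\<^esub> y) = f x \<oplus>\<^bsub>N\<^esub> f y) \<and>
    (\<forall>a\<in>carrier R. \<forall>x\<in>carrier M. f (a \<odot>\<^bsub>M\<^esub> x) = a \<odot>\<^bsub>N\<^esub> f x)"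
  by (auto simp: mod_hom_def hom_def)

lemma mod_homD:
  assumes "f \<in> mod_hom R M N"
  shows "\<And>x. x \<in> carrier M \<Longrightarrow> f x \<in> carrier N"
    "\<And>x y. x \<in> carrier M \<Longrightarrow> y \<in> carrier M \<Longrightarrow> f (x \<oplus>\<^bsub>M\<^esub> y) = f x \<oplus>\<^bsub>N\<^esub> f y"
    "\<And>a x. a \<in> carrier R \<Longrightarrow> x \<in> carrier M \<Longrightarrow> f (a \<odot>\<^bsub>M\<^esub> x) = a \<odot>\<^bsub>N\<^esub> f x"
  using assms by (auto simp: mod_hom_iff)

lemma mod_hom_zero:
  assumes "f \<in> mod_hom R M N" "module R M" "module R N"
  shows "f \<zero>\<^bsub>M\<^esub> = \<zero>\<^bsub>N\<^esub>"
proof -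
  interpret M: module R M by fact
  interpret N: module R N by fact
  have "f (\<zero>\<^bsub>R\<^esub> \<odot>\<^bsub>M\<^esub> \<zero>\<^bsub>M\<^esub>) = \<zero>\<^bsub>R\<^esub> \<odot>\<^bsub>N\<^esub> f \<zero>\<^bsub>M\<^esub>"
    by (rule mod_homD(3)[OF assms(1)]) auto
  then show ?thesis using mod_homD(1)[OF assms(1)] by simp
qed

lemma mod_hom_minus:
  assumes "f \<in> mod_hom R M N" "module R M" "module R N" "x \<in> carrier M" "y \<in> carrier M"
  shows "f (x \<ominus>\<^bsub>M\<^esub> y) = f x \<ominus>\<^bsub>N\<^esub> f y"
proof -
  interpret M: module R M by fact
  interpret N: module R N by fact
  have "f (\<ominus>\<^bsub>M\<^esub> y) = f ((\<ominus>\<^bsub>R\<^esub> \<one>\<^bsub>R\<^esub>) \<odot>\<^bsub>M\<^esub> y)"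
    using assms by (simp add: M.smult_l_minus)
  also have "\<dots> = (\<ominus>\<^bsub>R\<^esub> \<one>\<^bsub>R\<^esub>) \<odot>\<^bsub>N\<^esub> f y" using assms by (intro mod_homD(3)[OF assms(1)]) auto
  also have "\<dots> = \<ominus>\<^bsub>N\<^esub> f y" using mod_homD(1)[OF assms(1)] assms by (simp add: N.smult_l_minus)
  finally show ?thesis using assms mod_homD[OF assms(1)] by (simp add: a_minus_def)
qed

lemma mod_hom_comp:
  "f \<in> mod_hom R L M \<Longrightarrow> g \<in> mod_hom R M N \<Longrightarrow> (\<lambda>x. g (f x)) \<in> mod_hom R L N"
  by (simp add: mod_hom_iff)

lemma mod_hom_id: "(\<lambda>x. x) \<in> mod_hom R M M"
  by (simp add: mod_hom_iff)

lemma mod_hom_diff: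
  assumes f: "f \<in> mod_hom R M N" and g: "g \<in> mod_hom R M N" and "module R N"
  shows "(\<lambda>x. f x \<ominus>\<^bsub>N\<^esub> g x) \<in> mod_hom R M N"
proof -
  interpret N: module R N by fact
  show ?thesis
    unfolding mod_hom_iff
  proof (intro conjI ballI)
    fix x y assume xy: "x \<in> carrier M" "y \<in> carrier M"
    note c = xy[THEN mod_homD(1)[OF f]] xy[THEN mod_homD(1)[OF g]]
    show "f y \<ominus>\<^bsub>N\<^esub> g y \<in> carrier N" using c by simp
    show "f (x \<oplus>\<^bsub>M\<^esub> y) \<ominus>\<^bsub>N\<^esub> g (x \<oplus>\<^bsub>M\<^esub> y) = (f x \<ominus>\<^bsub>N\<^esub> g x) \<oplus>\<^bsub>N\<^esub> (f y \<ominus>\<^bsub>N\<^esub> g y)"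
      unfolding mod_homD(2)[OF f xy] mod_homD(2)[OF g xy] a_minus_def
      using c by (simp add: N.M.minus_add N.M.a_ac)
  next
    fix a x assume a: "a \<in> carrier R" and x: "x \<in> carrier M"
    show "f (a \<odot>\<^bsub>M\<^esub> x) \<ominus>\<^bsub>N\<^esub> g (a \<odot>\<^bsub>M\<^esub> x) = a \<odot>\<^bsub>N\<^esub> (f x \<ominus>\<^bsub>N\<^esub> g x)"
      unfolding mod_homD(3)[OF f a x] mod_homD(3)[OF g a x] a_minus_def
      using mod_homD(1)[OF f x] mod_homD(1)[OF g x] a by (simp add: N.smult_r_distr N.smult_r_minus)
  qed
qed

lemma submodule_image:
  assumes f: "f \<in> mod_hom R M N" and "module R M" "module R N" "submodule U R M"
  shows "submodule (f ` U) R N"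
proof -
  interpret M: module R M by fact
  interpret N: module R N by fact
  note U = M.submoduleD[OF assms(4)] and f' = mod_homD[OF f] 
  show ?thesis
    unfolding N.submodule_iff
  proof (intro conjI ballI subsetI)
    show "\<zero>\<^bsub>N\<^esub> \<in> f ` U" using mod_hom_zero[OF assms(1-3)] U(3) by force
  next
    fix x y assume "x \<in> f ` U" "y \<in> f ` U"
    then show "x \<oplus>\<^bsub>N\<^esub> y \<in> f ` U" using f'(2)[symmetric] U(2,4) by auto
  next
    fix a x assume "a \<in> carrier R" "x \<in> f ` U"
    then show "a \<odot>\<^bsub>N\<^esub> x \<in> f ` U" using f'(3)[symmetric] U(2,6) by auto
  qed (use U f' in auto)
qed

lemma submodule_vimage:
  assumes f: "f \<in> mod_hom R M N" and "module R M" "module R N" "submodule U R M" "submodule V R N"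
  shows "submodule {u \<in> U. f u \<in> V} R M"
proof -
  interpret M: module R M by fact
  interpret N: module R N by fact
  note U = M.submoduleD[OF assms(4)] and V = N.submoduleD[OF assms(5)] and f' = mod_homD[OF f] 
  show ?thesis
    unfolding M.submodule_iff
    using U V f' mod_hom_zero[OF assms(1-3)] by auto
qed

lemma mod_hom_submodule_dom:
  assumes "f \<in> mod_hom R M N" "U \<subseteq> carrier M"
  shows "f \<in> mod_hom R (M\<lparr>carrier := U\<rparr>) N"
  using assms by (fastforce simp: mod_hom_iff subset_iff)

lemma mod_hom_submodule_cod:
  assumes "f \<in> mod_hom R M N" "f ` carrier M \<subseteq> U" shows "f \<in> mod_hom R M (N\<lparr>carrier := U\<rparr>)"
  using assms by (auto simp: mod_hom_iff)

lemma submodule_of_submodule: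
  assumes "module R M" "submodule U R M"
  shows "submodule W R (M\<lparr>carrier := U\<rparr>) \<longleftrightarrow> submodule W R M \<and> W \<subseteq> U"
proof -
  interpret M: module R M by fact
  interpret U: module R "M\<lparr>carrier := U\<rparr>" using submodule.submodule_is_module[OF assms(2,1)] .
  show ?thesis using M.submoduleD(1)[OF assms(2)] by (auto simp: U.submodule_iff M.submodule_iff)
qed


section \<open>Finite generation\<close>

context module
begin

lemma submodule_span: "A \<subseteq> carrier M \<Longrightarrow> submodule (module_span R M A) R M"
  unfolding module_span_def using carrier_is_submodule 
  by (auto simp: submodule_iff)

lemma span_superset: "A \<subseteq> module_span R M A"
  by (auto simp: module_span_def)

lemma span_least: "submodule H R M \<Longrightarrow> A \<subseteq> H \<Longrightarrow> module_span R M A \<subseteq> H"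
  by (auto simp: module_span_def)

lemma span_mono: "A \<subseteq> B \<Longrightarrow> B \<subseteq> carrier M \<Longrightarrow> module_span R M A \<subseteq> module_span R M B"
  by (meson span_least submodule_span span_superset subset_trans)

lemma span_empty: "module_span R M {} = {\<zero>\<^bsub>M\<^esub>}"
  using span_least[OF submodule_zero, of "{}"] submoduleD(3)[OF submodule_span[of "{}"]] by auto

lemma submodule_cyclic: "x \<in> carrier M \<Longrightarrow> submodule ((\<lambda>a. a \<odot>\<^bsub>M\<^esub> x) ` carrier R) R M"
  unfolding submodule_iff
proof (intro conjI ballI subsetI)
  assume x: "x \<in> carrier M"
  show "\<zero>\<^bsub>M\<^esub> \<in> (\<lambda>a. a \<odot>\<^bsub>M\<^esub> x) ` carrier R" using x by (auto intro!: image_eqI[of _ _ "\<zero>"])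
  fix y z assume "y \<in> (\<lambda>a. a \<odot>\<^bsub>M\<^esub> x) ` carrier R" "z \<in> (\<lambda>a. a \<odot>\<^bsub>M\<^esub> x) ` carrier R"
  then show "y \<oplus>\<^bsub>M\<^esub> z \<in> (\<lambda>a. a \<odot>\<^bsub>M\<^esub> x) ` carrier R" using x by (auto simp: smult_l_distr[symmetric])
next
  assume x: "x \<in> carrier M"
  fix a y assume "a \<in> carrier R" "y \<in> (\<lambda>a. a \<odot>\<^bsub>M\<^esub> x) ` carrier R"
  then show "a \<odot>\<^bsub>M\<^esub> y \<in> (\<lambda>a. a \<odot>\<^bsub>M\<^esub> x) ` carrier R" using x by (auto simp: smult_assoc1[symmetric])
qed auto

lemma span_insert:
  assumes "x \<in> carrier M" "A \<subseteq> carrier M"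
  shows "module_span R M (insert x A) = (\<lambda>a. a \<odot>\<^bsub>M\<^esub> x) ` carrier R <+>\<^bsub>M\<^esub> module_span R M A"
proof
  note s = submodule_cyclic[OF assms(1)] submodule_span[OF assms(2)]
  have "x \<in> (\<lambda>a. a \<odot>\<^bsub>M\<^esub> x) ` carrier R" using assms by (auto intro!: image_eqI[of _ _ "\<one>"])
  then show "module_span R M (insert x A) \<subseteq> (\<lambda>a. a \<odot>\<^bsub>M\<^esub> x) ` carrier R <+>\<^bsub>M\<^esub> module_span R M A"
    using set_add_upper[OF s] span_superset[of A] by (intro span_least submodule_set_add s) auto
  have i: "submodule (module_span R M (insert x A)) R M" using assms by (intro submodule_span) auto
  show "(\<lambda>a. a \<odot>\<^bsub>M\<^esub> x) ` carrier R <+>\<^bsub>M\<^esub> module_span R M A \<subseteq> module_span R M (insert x A)"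
    using submoduleD(6)[OF i] span_superset[of "insert x A"] span_mono[of A "insert x A"] assms
    by (intro set_add_least i) auto
qed

end

lemma span_image:
  assumes f: "f \<in> mod_hom R M N" and "module R M" "module R N" "A \<subseteq> carrier M"
  shows "f ` module_span R M A = module_span R N (f ` A)"
proof
  interpret M: module R M by fact
  interpret N: module R N by fact
  have sub: "f ` A \<subseteq> carrier N" using assms(4) mod_homD(1)[OF f] by auto
  have "module_span R M A \<subseteq> {u \<in> carrier M. f u \<in> module_span R N (f ` A)}"
    using assms(4) N.span_superset[of "f ` A"]
    by (intro M.span_least submodule_vimage[OF assms(1-3)] M.carrier_is_submodule N.submodule_span sub) auto
  then show "f ` module_span R M A \<subseteq> module_span R N (f ` A)" by auto
  show "module_span R N (f ` A) \<subseteq> f ` module_span R M A"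
    using M.span_superset[of A] by (intro N.span_least submodule_image[OF assms(1-3)] M.submodule_span assms(4)) auto
qed

lemma span_submodule:
  assumes "module R M" "submodule U R M" "A \<subseteq> U"
  shows "module_span R (M\<lparr>carrier := U\<rparr>) A = module_span R M A"
proof -
  interpret M: module R M by fact
  have "A \<subseteq> carrier M" using assms(3) M.submoduleD(1)[OF assms(2)] by auto
  then have "module_span R M A \<subseteq> U" "submodule (module_span R M A) R M"
    using M.span_least[OF assms(2,3)] M.submodule_span by auto
  then show ?thesis
    unfolding module_span_def submodule_of_submodule[OF assms(1,2)] by auto
qed

lemma fg_module_image:
  assumes f: "f \<in> mod_hom R M N" and "fg_module R M" "module R N" "f ` carrier M = carrier N"
  shows "fg_module R N"
proof -
  obtain A where A: "A \<subseteq> carrier M" "finite A" "carrier M = module_span R M A" "module R M"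
    using assms(2) by (auto simp: fg_module_def)
  then have "carrier N = module_span R N (f ` A)" using span_image[OF f A(4) assms(3) A(1)] assms(4) by simp
  then show ?thesis
    using A assms mod_homD(1)[OF f] by (auto simp: fg_module_def intro!: exI[of _ "f ` A"])
qed

text \<open>The Hilbert basis argument for modules, by induction on the number of generators of the
  ambient module: the coefficients at one generator that occur in \<open>H\<close> form an ideal, and lifts of
  finitely many generators of this ideal reduce the question to the remaining generators.\<close>

lemma noetherian_submodule_span:
  assumes "module R M" "noetherian_ring R"
    and "finite A" "A \<subseteq> carrier M" "submodule H R M" "H \<subseteq> module_span R M A"
  shows "\<exists>B\<subseteq>H. finite B \<and> H = module_span R M B"
proof -
  interpret M: module R M by fact
  interpret N: noetherian_ring R by fact
  show ?thesis
    using assms(3-6)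
  proof (induction A arbitrary: H rule: finite_induct)
    case empty
    then have "H = {\<zero>\<^bsub>M\<^esub>}" using M.span_empty M.submoduleD(3) by blast
    then show ?case using M.span_empty by (intro exI[of _ "{}"]) auto
  next
    case (insert x A H)
    let ?S = "module_span R M A"
    have x: "x \<in> carrier M" and A: "A \<subseteq> carrier M" using insert by auto
    note S = M.submodule_span[OF A]
    note H = M.submoduleD[OF insert.prems(2)] and S' = M.submoduleD[OF S]
    define coef where "coef H = {r \<in> carrier R. \<exists>y\<in>?S. r \<odot>\<^bsub>M\<^esub> x \<oplus>\<^bsub>M\<^esub> y \<in> H}" for H
    have ideal: "ideal (coef H) R" if "submodule H R M" for H
    proof -
      note H = M.submoduleD[OF that]
      show ?thesis
      proof (rule idealI)
        show "ring R" ..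
        show "subgroup (coef H) (add_monoid R)"
        proof (rule M.R.add.subgroupI)
          show "coef H \<subseteq> carrier R" by (auto simp: coef_def)
          have "\<zero>\<^bsub>R\<^esub> \<in> coef H"
            unfolding coef_def using x H(3) S'(3) by (auto intro!: bexI[of _ "\<zero>\<^bsub>M\<^esub>"])
          then show "coef H \<noteq> {}" by auto
        next
          fix a b assume "a \<in> coef H" "b \<in> coef H"
          then obtain y z where *: "a \<in> carrier R" "b \<in> carrier R" "y \<in> ?S" "z \<in> ?S"
            "a \<odot>\<^bsub>M\<^esub> x \<oplus>\<^bsub>M\<^esub> y \<in> H" "b \<odot>\<^bsub>M\<^esub> x \<oplus>\<^bsub>M\<^esub> z \<in> H" by (auto simp: coef_def)
          have "(a \<oplus>\<^bsub>R\<^esub> b) \<odot>\<^bsub>M\<^esub> x \<oplus>\<^bsub>M\<^esub> (y \<oplus>\<^bsub>M\<^esub> z) = (a \<odot>\<^bsub>M\<^esub> x \<oplus>\<^bsub>M\<^esub> y) \<oplus>\<^bsub>M\<^esub> (b \<odot>\<^bsub>M\<^esub> x \<oplus>\<^bsub>M\<^esub> z)"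
            using * x S'(2) by (simp add: M.smult_l_distr M.M.a_ac)
          also have "\<dots> \<in> H" using * H(4) by blast
          finally show "a \<oplus>\<^bsub>R\<^esub> b \<in> coef H" using * S'(4) by (auto simp: coef_def)
        next
          fix a assume "a \<in> coef H"
          then obtain y where *: "a \<in> carrier R" "y \<in> ?S" "a \<odot>\<^bsub>M\<^esub> x \<oplus>\<^bsub>M\<^esub> y \<in> H" by (auto simp: coef_def)
          have "(\<ominus>\<^bsub>R\<^esub> a) \<odot>\<^bsub>M\<^esub> x \<oplus>\<^bsub>M\<^esub> (\<ominus>\<^bsub>R\<^esub> \<one>\<^bsub>R\<^esub>) \<odot>\<^bsub>M\<^esub> y = (\<ominus>\<^bsub>R\<^esub> \<one>\<^bsub>R\<^esub>) \<odot>\<^bsub>M\<^esub> (a \<odot>\<^bsub>M\<^esub> x \<oplus>\<^bsub>M\<^esub> y)"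
            using * x S'(2) by (simp add: M.smult_l_minus M.M.minus_add)
          also have "\<dots> \<in> H" using * by (intro H(6)) auto
          finally show "\<ominus>\<^bsub>R\<^esub> a \<in> coef H"
            using * S'(6)[of "\<ominus>\<^bsub>R\<^esub> \<one>\<^bsub>R\<^esub>" y] by (auto simp: coef_def)
        qed
        have *: "r \<otimes>\<^bsub>R\<^esub> a \<in> coef H" if a: "a \<in> coef H" and r: "r \<in> carrier R" for a r
        proof -
          from a obtain y where *: "a \<in> carrier R" "y \<in> ?S" "a \<odot>\<^bsub>M\<^esub> x \<oplus>\<^bsub>M\<^esub> y \<in> H" by (auto simp: coef_def)
          have "(r \<otimes>\<^bsub>R\<^esub> a) \<odot>\<^bsub>M\<^esub> x \<oplus>\<^bsub>M\<^esub> r \<odot>\<^bsub>M\<^esub> y = r \<odot>\<^bsub>M\<^esub> (a \<odot>\<^bsub>M\<^esub> x \<oplus>\<^bsub>M\<^esub> y)"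
            using * x S'(2) r by (simp add: M.smult_assoc1 M.smult_r_distr)
          also have "\<dots> \<in> H" using * r H(6) by blast
          finally show ?thesis using * S'(6) r by (auto simp: coef_def)
        qed
        then show "\<And>a r. a \<in> coef H \<Longrightarrow> r \<in> carrier R \<Longrightarrow> r \<otimes>\<^bsub>R\<^esub> a \<in> coef H" .
        show "a \<otimes>\<^bsub>R\<^esub> r \<in> coef H" if "a \<in> coef H" "r \<in> carrier R" for a r
          using *[OF that] that by (auto simp: coef_def M.R.m_comm)
      qed
    qed
    obtain G where G: "G \<subseteq> carrier R" "finite G" "coef H = Idl\<^bsub>R\<^esub> G"
      using N.finetely_gen[OF ideal[OF insert.prems(2)]] by blast
    have "\<forall>r\<in>G. \<exists>y\<in>?S. r \<odot>\<^bsub>M\<^esub> x \<oplus>\<^bsub>M\<^esub> y \<in> H"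
      using M.R.genideal_self[OF G(1)] G(3) by (auto simp: coef_def)
    then obtain y where y: "\<And>r. r \<in> G \<Longrightarrow> y r \<in> ?S" "\<And>r. r \<in> G \<Longrightarrow> r \<odot>\<^bsub>M\<^esub> x \<oplus>\<^bsub>M\<^esub> y r \<in> H" by metis
    obtain B where B: "B \<subseteq> H \<inter> ?S" "finite B" "H \<inter> ?S = module_span R M B"
      using insert.IH[OF A M.submodule_Int[OF insert.prems(2) S]] by auto
    define C where "C = (\<lambda>r. r \<odot>\<^bsub>M\<^esub> x \<oplus>\<^bsub>M\<^esub> y r) ` G"
    have C: "C \<subseteq> H" "finite C" using y G by (auto simp: C_def)
    let ?T = "module_span R M (C \<union> B)"
    have CB: "C \<union> B \<subseteq> carrier M" using C B H(1) by blast
    note T = M.submodule_span[OF CB] 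
    note T' = M.submoduleD[OF T]
    have sub: "?T \<subseteq> H" using C B by (intro M.span_least insert.prems) auto
    have "Idl\<^bsub>R\<^esub> G \<subseteq> coef ?T"
    proof (intro M.R.genideal_minimal ideal T subsetI)
      fix r assume r: "r \<in> G"
      then have "r \<odot>\<^bsub>M\<^esub> x \<oplus>\<^bsub>M\<^esub> y r \<in> ?T" using M.span_superset[of "C \<union> B"] by (auto simp: C_def)
      then show "r \<in> coef ?T" using r y(1) G(1) by (auto simp: coef_def)
    qed
    then have coefT: "coef H \<subseteq> coef ?T" using G by simp
    have "h \<in> ?T" if h: "h \<in> H" for h
    proof -
      have "h \<in> (\<lambda>a. a \<odot>\<^bsub>M\<^esub> x) ` carrier R <+>\<^bsub>M\<^esub> ?S"
        using h insert.prems(3) M.span_insert[OF x A] by blast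
      then obtain r z where rz: "r \<in> carrier R" "z \<in> ?S" "h = r \<odot>\<^bsub>M\<^esub> x \<oplus>\<^bsub>M\<^esub> z"
        unfolding M.mem_set_add by blast
      then have "r \<in> coef ?T" using h coefT by (auto simp: coef_def)
      then obtain w where w: "w \<in> ?S" "r \<odot>\<^bsub>M\<^esub> x \<oplus>\<^bsub>M\<^esub> w \<in> ?T" by (auto simp: coef_def)
      define t where "t = r \<odot>\<^bsub>M\<^esub> x \<oplus>\<^bsub>M\<^esub> w"
      have t: "t \<in> ?T" using w by (simp add: t_def)
      have "h \<ominus>\<^bsub>M\<^esub> t = z \<ominus>\<^bsub>M\<^esub> w"
        unfolding t_def rz(3) a_minus_def using rz(1,2) x S'(2)[OF w(1)] S'(2)[OF rz(2)]
        by (simp add: M.M.minus_add M.M.a_ac M.M.r_neg M.M.r_neg1 M.M.r_neg2)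
      moreover have "z \<ominus>\<^bsub>M\<^esub> w \<in> ?S" using rz(2) w(1) by (rule S'(5))
      moreover have "h \<ominus>\<^bsub>M\<^esub> t \<in> H" using h t sub H(5) by blast
      ultimately have "h \<ominus>\<^bsub>M\<^esub> t \<in> H \<inter> ?S" by simp
      then have ht: "h \<ominus>\<^bsub>M\<^esub> t \<in> ?T" using B(3) M.span_mono[of B "C \<union> B"] CB by auto
      have "h = (h \<ominus>\<^bsub>M\<^esub> t) \<oplus>\<^bsub>M\<^esub> t"
        using h t H(2) sub by (simp add: a_minus_def M.M.a_assoc M.M.l_neg subset_iff)
      then show ?thesis using T'(4)[OF ht t] by simp
    qed
    then have "H = ?T" using sub by blast
    then show ?case using C B by (intro exI[of _ "C \<union> B"]) auto
  qed
qed

lemma noetherian_submodule_fg: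
  assumes "noetherian_ring R" "fg_module R M" "submodule U R M"
  obtains B where "B \<subseteq> U" "finite B" "U = module_span R M B"
proof -
  obtain A where A: "A \<subseteq> carrier M" "finite A" "carrier M = module_span R M A" "module R M"
    using assms(2) by (auto simp: fg_module_def)
  interpret M: module R M by (rule A)
  show thesis
    using noetherian_submodule_span[OF A(4) assms(1) A(2,1) assms(3)] M.submoduleD(1)[OF assms(3)] A(3) that by auto
qed

lemma fg_submodule:
  assumes "noetherian_ring R" "fg_module R M" "submodule U R M"
  shows "fg_module R (M\<lparr>carrier := U\<rparr>)"
proof -
  have M: "module R M" using assms by (simp add: fg_module_def)
  obtain B where "B \<subseteq> U" "finite B" "U = module_span R M B" using noetherian_submodule_fg[OF assms] .
  then show ?thesis
    using span_submodule[OF M assms(3)] submodule.submodule_is_module[OF assms(3) M]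
    by (auto simp: fg_module_def)
qed


section \<open>Lengths relative to a multiplicative set\<close>

text \<open>This says that the localization of \<open>U/W\<close> at \<open>S\<close> vanishes. Below, only chains of submodules whose
  successive quotients survive localization at \<open>S\<close> are counted. Their maximal number of steps is the
  length of the localization of \<open>U/W\<close>, and no localized modules have to be formed.\<close>

definition negligible :: "'a set \<Rightarrow> ('a, 'm, 'c) module_scheme \<Rightarrow> 'm set \<Rightarrow> 'm set \<Rightarrow> bool"
  where "negligible S M U W \<longleftrightarrow> (\<forall>u\<in>U. \<exists>s\<in>S. s \<odot>\<^bsub>M\<^esub> u \<in> W)"

inductive chain_between ::
  "('a, 'r) ring_scheme \<Rightarrow> 'a set \<Rightarrow> ('a, 'm, 'c) module_scheme \<Rightarrow> 'm set \<Rightarrow> 'm set \<Rightarrow> nat \<Rightarrow> bool"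
  for R S M W where
  chain_0: "submodule W R M \<Longrightarrow> submodule U R M \<Longrightarrow> W \<subseteq> U \<Longrightarrow> chain_between R S M W U 0"
| chain_Suc: "chain_between R S M W V n \<Longrightarrow> submodule U R M \<Longrightarrow> V \<subseteq> U \<Longrightarrow> \<not> negligible S M U V
    \<Longrightarrow> chain_between R S M W U (Suc n)"

definition index ::
  "('a, 'r) ring_scheme \<Rightarrow> 'a set \<Rightarrow> ('a, 'm, 'c) module_scheme \<Rightarrow> 'm set \<Rightarrow> 'm set \<Rightarrow> enat"
  where "index R S M U W = Sup (enat ` {n. chain_between R S M W U n})"

lemma negligible_antimono:
  "negligible S M U W \<Longrightarrow> U' \<subseteq> U \<Longrightarrow> W \<subseteq> W' \<Longrightarrow> negligible S M U' W'"
  unfolding negligible_def by blast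

lemma chain_betweenD:
  "chain_between R S M W U n \<Longrightarrow> submodule W R M \<and> submodule U R M \<and> W \<subseteq> U"
  by (induction rule: chain_between.induct) auto

lemma chain_enlarge:
  assumes "chain_between R S M W V n" "submodule U R M" "V \<subseteq> U"
  shows "chain_between R S M W U n"
  using assms(1)
proof cases
  case chain_0
  then show ?thesis using assms by (auto intro: chain_between.chain_0)
next
  case (chain_Suc V' n')
  then have "\<not> negligible S M U V'" using negligible_antimono[of S M U V' V V'] assms(3) by blast
  then show ?thesis using chain_Suc assms by (auto intro!: chain_between.chain_Suc)
qed

lemma chain_trans:
  assumes "chain_between R S M V U n" "chain_between R S M W V m"
  shows "chain_between R S M W U (m + n)"
  using assms
proof (induction rule: chain_between.induct)
  case (chain_0 U)
  then show ?case using chain_enlarge by simp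
next
  case (chain_Suc V' n U)
  then show ?case by (auto intro: chain_between.chain_Suc)
qed

text \<open>The common source of all inequalities between lengths: a pair of monotone maps on submodules sends a
  chain to two chains, and if no step becomes negligible on both sides, the two together are at least as
  long.\<close>

lemma chain_map2:
  assumes "chain_between R S M W U n"
    and "\<And>V. submodule V R M \<Longrightarrow> W \<subseteq> V \<Longrightarrow> V \<subseteq> U \<Longrightarrow> submodule (a V) R N \<and> submodule (b V) R P"
    and "\<And>V V'. submodule V R M \<Longrightarrow> submodule V' R M \<Longrightarrow> W \<subseteq> V \<Longrightarrow> V \<subseteq> V' \<Longrightarrow> V' \<subseteq> U \<Longrightarrow>
      a V \<subseteq> a V' \<and> b V \<subseteq> b V'"
    and "\<And>V V'. submodule V R M \<Longrightarrow> submodule V' R M \<Longrightarrow> W \<subseteq> V \<Longrightarrow> V \<subseteq> V' \<Longrightarrow> V' \<subseteq> U \<Longrightarrow>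
      negligible S N (a V') (a V) \<Longrightarrow> negligible S P (b V') (b V) \<Longrightarrow> negligible S M V' V"
  shows "\<exists>i j. n \<le> i + j \<and> chain_between R S N (a W) (a U) i \<and> chain_between R S P (b W) (b U) j"
  using assms
proof (induction rule: chain_between.induct)
  case (chain_0 U)
  have "submodule (a W) R N \<and> submodule (b W) R P" by (rule chain_0(4)) (use chain_0(1-3) in auto)
  moreover have "submodule (a U) R N \<and> submodule (b U) R P" by (rule chain_0(4)) (use chain_0(1-3) in auto)
  moreover have "a W \<subseteq> a U \<and> b W \<subseteq> b U" by (rule chain_0(5)) (use chain_0(1-3) in auto)
  ultimately show ?case by (intro exI[of _ 0]) (simp add: chain_between.chain_0)
next
  case (chain_Suc V n U)
  note V = chain_betweenD[OF chain_Suc(1)]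
  have "\<exists>i j. n \<le> i + j \<and> chain_between R S N (a W) (a V) i \<and> chain_between R S P (b W) (b V) j"
  proof (rule chain_Suc.IH)
    fix V' assume "submodule V' R M" "W \<subseteq> V'" "V' \<subseteq> V"
    then show "submodule (a V') R N \<and> submodule (b V') R P" using chain_Suc by auto
  next
    fix V' V'' assume "submodule V' R M" "submodule V'' R M" "W \<subseteq> V'" "V' \<subseteq> V''" "V'' \<subseteq> V"
    then show "a V' \<subseteq> a V'' \<and> b V' \<subseteq> b V''" using chain_Suc(3) chain_Suc.prems(2) by (meson order_trans)
  next
    fix V' V'' assume "submodule V' R M" "submodule V'' R M" "W \<subseteq> V'" "V' \<subseteq> V''" "V'' \<subseteq> V"
      "negligible S N (a V'') (a V')" "negligible S P (b V'') (b V')"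
    then show "negligible S M V'' V'" using chain_Suc(3) chain_Suc.prems(3) by (meson order_trans)
  qed
  then obtain i j where ij: "n \<le> i + j" "chain_between R S N (a W) (a V) i" "chain_between R S P (b W) (b V) j"
    by blast
  have U: "submodule (a U) R N \<and> submodule (b U) R P"
    using V chain_Suc(2,3) by (intro chain_Suc.prems(1)) auto
  have mono: "a V \<subseteq> a U \<and> b V \<subseteq> b U"
    using V chain_Suc(2,3) by (intro chain_Suc.prems(2)) auto
  have "\<not> (negligible S N (a U) (a V) \<and> negligible S P (b U) (b V))"
    using V chain_Suc(2-4) chain_Suc.prems(3)[of V U] by auto
  then consider "\<not> negligible S N (a U) (a V)" | "\<not> negligible S P (b U) (b V)" by blast
  then show ?case
  proof cases
    case 1
    then have "chain_between R S N (a W) (a U) (Suc i)" using ij U mono by (auto intro: chain_between.chain_Suc)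
    moreover have "chain_between R S P (b W) (b U) j" using chain_enlarge[OF ij(3)] U mono by auto
    ultimately show ?thesis using ij(1) by (intro exI[of _ "Suc i"] exI[of _ j]) auto
  next
    case 2
    then have "chain_between R S P (b W) (b U) (Suc j)" using ij U mono by (auto intro: chain_between.chain_Suc)
    moreover have "chain_between R S N (a W) (a U) i" using chain_enlarge[OF ij(2)] U mono by auto
    ultimately show ?thesis using ij(1) by (intro exI[of _ i] exI[of _ "Suc j"]) auto
  qed
qed

lemma chain_map:
  assumes "chain_between R S M W U n"
    and "\<And>V. submodule V R M \<Longrightarrow> W \<subseteq> V \<Longrightarrow> V \<subseteq> U \<Longrightarrow> submodule (a V) R N"
    and "\<And>V V'. submodule V R M \<Longrightarrow> submodule V' R M \<Longrightarrow> W \<subseteq> V \<Longrightarrow> V \<subseteq> V' \<Longrightarrow> V' \<subseteq> U \<Longrightarrow>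
      a V \<subseteq> a V'"
    and "\<And>V V'. submodule V R M \<Longrightarrow> submodule V' R M \<Longrightarrow> W \<subseteq> V \<Longrightarrow> V \<subseteq> V' \<Longrightarrow> V' \<subseteq> U \<Longrightarrow>
      negligible S N (a V') (a V) \<Longrightarrow> negligible S M V' V"
  shows "chain_between R S N (a W) (a U) n"
  using assms
proof (induction rule: chain_between.induct)
  case (chain_0 U)
  then show ?case by (simp add: chain_between.chain_0)
next
  case (chain_Suc V n U)
  note V = chain_betweenD[OF chain_Suc(1)]
  have "chain_between R S N (a W) (a V) n"
  proof (rule chain_Suc.IH)
    fix V' assume "submodule V' R M" "W \<subseteq> V'" "V' \<subseteq> V"
    then show "submodule (a V') R N" using chain_Suc by auto
  next
    fix V' V'' assume "submodule V' R M" "submodule V'' R M" "W \<subseteq> V'" "V' \<subseteq> V''" "V'' \<subseteq> V"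
    then show "a V' \<subseteq> a V''" using chain_Suc(3) chain_Suc.prems(2) by (meson order_trans)
  next
    fix V' V'' assume "submodule V' R M" "submodule V'' R M" "W \<subseteq> V'" "V' \<subseteq> V''" "V'' \<subseteq> V"
      "negligible S N (a V'') (a V')"
    then show "negligible S M V'' V'" using chain_Suc(3) chain_Suc.prems(3) by (meson order_trans)
  qed
  moreover have "submodule (a U) R N" "a V \<subseteq> a U"
    using V chain_Suc(2,3) chain_Suc.prems(1)[of U] chain_Suc.prems(2)[of V U] by auto
  moreover have "\<not> negligible S N (a U) (a V)"
    using V chain_Suc(2-4) chain_Suc.prems(3)[of V U] by auto
  ultimately show ?case by (auto intro: chain_between.chain_Suc)
qed

lemma index_ge: "chain_between R S M W U n \<Longrightarrow> enat n \<le> index R S M U W"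
  unfolding index_def by (auto intro: Sup_upper)

lemma index_le: "(\<And>n. chain_between R S M W U n \<Longrightarrow> enat n \<le> k) \<Longrightarrow> index R S M U W \<le> k"
  unfolding index_def by (auto intro: Sup_least)

lemma index_eq_0_iff:
  assumes "submodule W R M" "submodule U R M" "W \<subseteq> U"
  shows "index R S M U W = 0 \<longleftrightarrow> negligible S M U W"
proof
  assume *: "index R S M U W = 0"
  show "negligible S M U W"
  proof (rule ccontr)
    assume "\<not> negligible S M U W"
    then have "chain_between R S M W U (Suc 0)"
      using assms by (intro chain_between.chain_Suc[OF chain_between.chain_0[OF assms(1) assms(1)]]) auto
    then show False using index_ge * by (metis enat_0_iff(1) le_zero_eq nat.distinct(1))
  qed
next
  assume *: "negligible S M U W"
  have "n = 0" if "chain_between R S M W U n" for n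
    using that
  proof cases
    case (chain_Suc V n')
    then show ?thesis using negligible_antimono[OF *, of U V] chain_betweenD by blast
  qed
  then have "index R S M U W \<le> 0" by (intro index_le) (simp add: zero_enat_def)
  then show "index R S M U W = 0" by simp
qed

context module
begin

text \<open>A chain in \<open>U\<close> induces chains in \<open>V\<close> and in \<open>U/V\<close> by intersecting with \<open>V\<close> and adding \<open>V\<close>,
  and each step survives in one of them by the modular law.\<close>

lemma index_add:
  assumes S: "submonoid S R" and "submodule W R M" "submodule V R M" "submodule U R M" "W \<subseteq> V" "V \<subseteq> U"
  shows "index R S M U W = index R S M U V + index R S M V W"
proof (rule antisym)
  show "index R S M U W \<le> index R S M U V + index R S M V W"
  proof (rule index_le)
    fix n assume n: "chain_between R S M W U n"
    have "\<exists>i j. n \<le> i + j \<and> chain_between R S M (W \<inter> V) (U \<inter> V) i \<and>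
        chain_between R S M (W <+>\<^bsub>M\<^esub> V) (U <+>\<^bsub>M\<^esub> V) j"
      using n
    proof (rule chain_map2)
      fix H assume "submodule H R M"
      then show "submodule (H \<inter> V) R M \<and> submodule (H <+>\<^bsub>M\<^esub> V) R M"
        using assms submodule_Int submodule_set_add by auto
    next
      fix H H' :: "'c set" assume "H \<subseteq> H'"
      then show "H \<inter> V \<subseteq> H' \<inter> V \<and> H <+>\<^bsub>M\<^esub> V \<subseteq> H' <+>\<^bsub>M\<^esub> V"
        using set_add_mono[of H H' V V M] by blast
    next
      fix H H' assume H: "submodule H R M" "submodule H' R M" "H \<subseteq> H'"
        and n: "negligible S M (H' \<inter> V) (H \<inter> V)" "negligible S M (H' <+>\<^bsub>M\<^esub> V) (H <+>\<^bsub>M\<^esub> V)"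
      show "negligible S M H' H"
        unfolding negligible_def
      proof
        fix h assume h: "h \<in> H'"
        note H1 = submoduleD[OF H(1)] and H2 = submoduleD[OF H(2)] and V' = submoduleD[OF assms(3)]
        \<comment> \<open>Divide first modulo \<open>V\<close>, then treat the error term \<open>v\<close>, which lies in \<open>H' \<inter> V\<close>.\<close>
        have "h \<in> H' <+>\<^bsub>M\<^esub> V" using h set_add_upper[OF H(2) assms(3)] by auto
        then obtain s where "s \<in> S" "s \<odot>\<^bsub>M\<^esub> h \<in> H <+>\<^bsub>M\<^esub> V"
          using n(2) unfolding negligible_def by blast
        then obtain k v where s: "s \<in> S" "k \<in> H" "v \<in> V" "s \<odot>\<^bsub>M\<^esub> h = k \<oplus>\<^bsub>M\<^esub> v"
          unfolding mem_set_add by blast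
        have sR: "s \<in> carrier R" using s(1) submonoid.subset[OF S] by auto
        have "v = s \<odot>\<^bsub>M\<^esub> h \<ominus>\<^bsub>M\<^esub> k"
          using s H1(2) V'(2) by (simp add: M.add_minus_cancel)
        also have "\<dots> \<in> H'" using s h H(3) sR H2(5,6) by blast
        finally obtain t where t: "t \<in> S" "t \<odot>\<^bsub>M\<^esub> v \<in> H" using n(1) s(3) by (auto simp: negligible_def)
        have tR: "t \<in> carrier R" using t(1) submonoid.subset[OF S] by auto
        have "(t \<otimes> s) \<odot>\<^bsub>M\<^esub> h = t \<odot>\<^bsub>M\<^esub> k \<oplus>\<^bsub>M\<^esub> t \<odot>\<^bsub>M\<^esub> v"
          using sR tR h H2(2) s H1(2) V'(2) by (simp add: smult_assoc1 smult_r_distr)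
        also have "\<dots> \<in> H" using t s tR H1(4,6) by blast
        finally show "\<exists>s\<in>S. s \<odot>\<^bsub>M\<^esub> h \<in> H" using submonoid.m_closed[OF S t(1) s(1)] by blast
      qed
    qed
    moreover have "W \<inter> V = W" "U \<inter> V = V" using assms by auto
    moreover have "W <+>\<^bsub>M\<^esub> V = V"
      using set_add_least[OF assms(3), of W V] set_add_upper[OF assms(2,3)] assms(5) by blast
    moreover have "U <+>\<^bsub>M\<^esub> V = U" using set_add_absorb[OF assms(4,3,6)] .
    ultimately obtain i j where ij: "n \<le> i + j" "chain_between R S M W V i" "chain_between R S M V U j" by auto
    have "enat n \<le> enat j + enat i" using ij(1) by simp
    also have "\<dots> \<le> index R S M U V + index R S M V W" by (intro add_mono index_ge ij)
    finally show "enat n \<le> index R S M U V + index R S M V W" .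
  qed
  show "index R S M U V + index R S M V W \<le> index R S M U W"
  proof (cases "index R S M U W")
    case (enat N)
    have le: "i + j \<le> N" if "chain_between R S M W V i" "chain_between R S M V U j" for i j
      using index_ge[OF chain_trans[OF that(2,1)]] enat by simp
    have c0: "chain_between R S M W V 0" "chain_between R S M V U 0"
      using assms by (auto intro: chain_between.chain_0)
    have "index R S M U V \<le> enat N" using le[OF c0(1)] by (intro index_le) auto
    then obtain k where k: "index R S M U V = enat k" "k \<le> N" using enat_ile by fastforce
    have "index R S M U V \<le> enat (N - i)" if "chain_between R S M W V i" for i
    proof (rule index_le)
      fix j assume "chain_between R S M V U j"
      then have "i + j \<le> N" by (rule le[OF that])
      then show "enat j \<le> enat (N - i)" by simp
    qed
    then have "i + k \<le> N" if "chain_between R S M W V i" for i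
      using that k le[OF that c0(2)] by (fastforce simp: le_diff_conv2)
    then have "index R S M V W \<le> enat (N - k)" by (intro index_le) (simp add: add_le_imp_le_diff)
    then obtain m where m: "index R S M V W = enat m" "m \<le> N - k" using enat_ile by fastforce
    then show ?thesis using k enat by simp
  qed simp
qed

end

text \<open>The homomorphism induces an isomorphism of \<open>U/W\<close> with \<open>(f U + P)/(f W + P)\<close>. Chains are carried along by
  taking images and preimages. The form with \<open>P\<close> covers both isomorphism theorems and maps into a quotient.\<close>

lemma index_hom:
  assumes f: "f \<in> mod_hom R M N" and M: "module R M" and N: "module R N" and S: "S \<subseteq> carrier R"
    and W: "submodule W R M" and U: "submodule U R M" and WU: "W \<subseteq> U" and P: "submodule P R N"
    and ker: "\<And>u. u \<in> U \<Longrightarrow> f u \<in> P \<Longrightarrow> u \<in> W"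
  shows "index R S N (f ` U <+>\<^bsub>N\<^esub> P) (f ` W <+>\<^bsub>N\<^esub> P) = index R S M U W"
proof -
  interpret M: module R M by fact
  interpret N: module R N by fact
  note f' = mod_homD[OF f] and P' = N.submoduleD[OF P] and U' = M.submoduleD[OF U] and W' = M.submoduleD[OF W]
  have fsub: "submodule (f ` V <+>\<^bsub>N\<^esub> P) R N" if "submodule V R M" for V
    using that by (intro N.submodule_set_add P submodule_image[OF f M N])
  show ?thesis
  proof (rule antisym)
    show "index R S M U W \<le> index R S N (f ` U <+>\<^bsub>N\<^esub> P) (f ` W <+>\<^bsub>N\<^esub> P)"
    proof (rule index_le, rule index_ge, erule chain_map)
      fix V V' assume V: "submodule V R M" "submodule V' R M" "W \<subseteq> V" "V \<subseteq> V'" "V' \<subseteq> U"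
      then show "f ` V <+>\<^bsub>N\<^esub> P \<subseteq> f ` V' <+>\<^bsub>N\<^esub> P" by (intro set_add_mono) auto
      assume n: "negligible S N (f ` V' <+>\<^bsub>N\<^esub> P) (f ` V <+>\<^bsub>N\<^esub> P)"
      note V1 = M.submoduleD[OF V(1)] and V2 = M.submoduleD[OF V(2)]
      show "negligible S M V' V"
        unfolding negligible_def
      proof
        fix v assume v: "v \<in> V'"
        then have "f v \<in> f ` V' <+>\<^bsub>N\<^esub> P" using N.set_add_upper[OF submodule_image[OF f M N V(2)] P] by auto
        then obtain s where "s \<in> S" "s \<odot>\<^bsub>N\<^esub> f v \<in> f ` V <+>\<^bsub>N\<^esub> P"
          using n unfolding negligible_def by blast
        then obtain w p where s: "s \<in> S" "w \<in> V" "p \<in> P" "s \<odot>\<^bsub>N\<^esub> f v = f w \<oplus>\<^bsub>N\<^esub> p"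
          unfolding N.mem_set_add by blast
        have sR: "s \<in> carrier R" using s S by auto
        define d where "d = s \<odot>\<^bsub>M\<^esub> v \<ominus>\<^bsub>M\<^esub> w"
        have d: "d \<in> V'" unfolding d_def using V(4) v s sR V2(5,6) by blast
        have c: "v \<in> carrier M" "w \<in> carrier M" "f v \<in> carrier N" "f w \<in> carrier N" "p \<in> carrier N"
          using v s V1 V2 f' P' by auto
        have "f d = s \<odot>\<^bsub>N\<^esub> f v \<ominus>\<^bsub>N\<^esub> f w"
          unfolding d_def using c sR f' by (simp add: mod_hom_minus[OF f M N])
        also have "\<dots> = p" using s(4) c by (simp add: N.M.add_minus_cancel)
        finally have "d \<in> W" using ker[of d] d V(5) s(3) by auto
        then have "d \<oplus>\<^bsub>M\<^esub> w \<in> V" using V(3) s(2) V1(4) by blast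
        moreover have "d \<oplus>\<^bsub>M\<^esub> w = s \<odot>\<^bsub>M\<^esub> v"
          unfolding d_def using c sR by (simp add: M.M.add_minus_cancel)
        ultimately show "\<exists>s\<in>S. s \<odot>\<^bsub>M\<^esub> v \<in> V" using s(1) by auto
      qed
    qed (rule fsub)
    show "index R S N (f ` U <+>\<^bsub>N\<^esub> P) (f ` W <+>\<^bsub>N\<^esub> P) \<le> index R S M U W"
    proof (rule index_le)
      fix n assume "chain_between R S N (f ` W <+>\<^bsub>N\<^esub> P) (f ` U <+>\<^bsub>N\<^esub> P) n"
      then have "chain_between R S M {u \<in> U. f u \<in> f ` W <+>\<^bsub>N\<^esub> P} {u \<in> U. f u \<in> f ` U <+>\<^bsub>N\<^esub> P} n"
      proof (rule chain_map)
        fix V V' assume V: "submodule V R N" "submodule V' R N" "f ` W <+>\<^bsub>N\<^esub> P \<subseteq> V" "V \<subseteq> V'" "V' \<subseteq> f ` U <+>\<^bsub>N\<^esub> P"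
        then show "{u \<in> U. f u \<in> V} \<subseteq> {u \<in> U. f u \<in> V'}" by auto
        assume n: "negligible S M {u \<in> U. f u \<in> V'} {u \<in> U. f u \<in> V}"
        note V1 = N.submoduleD[OF V(1)] and V2 = N.submoduleD[OF V(2)]
        have PV: "P \<subseteq> V" using V(3) N.set_add_upper[OF submodule_image[OF f M N W] P] by auto
        show "negligible S N V' V"
          unfolding negligible_def
        proof
          fix v assume v: "v \<in> V'"
          then have "v \<in> f ` U <+>\<^bsub>N\<^esub> P" using V(5) by blast
          then obtain u p where u: "u \<in> U" "p \<in> P" "v = f u \<oplus>\<^bsub>N\<^esub> p"
            unfolding N.mem_set_add by blast
          have c: "u \<in> carrier M" "f u \<in> carrier N" "p \<in> carrier N" using u U' f' P' by auto
          have "f u = v \<ominus>\<^bsub>N\<^esub> p" using u(3) c by (simp add: N.M.add_minus_cancel)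
          also have "\<dots> \<in> V'" using v u PV V(4) V2(5) by blast
          finally obtain s where s: "s \<in> S" "f (s \<odot>\<^bsub>M\<^esub> u) \<in> V" using n u(1) by (auto simp: negligible_def)
          have sR: "s \<in> carrier R" using s S by auto
          have "s \<odot>\<^bsub>N\<^esub> v = f (s \<odot>\<^bsub>M\<^esub> u) \<oplus>\<^bsub>N\<^esub> s \<odot>\<^bsub>N\<^esub> p"
            using u(3) c sR f'(3) by (simp add: N.smult_r_distr)
          also have "\<dots> \<in> V" using s(2) u(2) sR P'(6) PV V1(4) by blast
          finally show "\<exists>s\<in>S. s \<odot>\<^bsub>N\<^esub> v \<in> V" using s(1) by auto
        qed
      qed (use submodule_vimage[OF f M N U] in auto)
      moreover have "{u \<in> U. f u \<in> f ` U <+>\<^bsub>N\<^esub> P} = U"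
        using N.set_add_upper[OF submodule_image[OF f M N U] P] by auto
      moreover have "{u \<in> U. f u \<in> f ` W <+>\<^bsub>N\<^esub> P} = W"
      proof
        show "W \<subseteq> {u \<in> U. f u \<in> f ` W <+>\<^bsub>N\<^esub> P}"
          using N.set_add_upper[OF submodule_image[OF f M N W] P] WU by auto
        show "{u \<in> U. f u \<in> f ` W <+>\<^bsub>N\<^esub> P} \<subseteq> W"
        proof safe
          fix u assume u: "u \<in> U" "f u \<in> f ` W <+>\<^bsub>N\<^esub> P"
          then obtain w p where w: "w \<in> W" "p \<in> P" "f u = f w \<oplus>\<^bsub>N\<^esub> p" by (auto simp: N.mem_set_add)
          have c: "u \<in> carrier M" "w \<in> carrier M" "f u \<in> carrier N" "f w \<in> carrier N" "p \<in> carrier N"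
            using u w U' W' f' P' by auto
          have "f (u \<ominus>\<^bsub>M\<^esub> w) = p"
            using c w(3) by (simp add: mod_hom_minus[OF f M N] N.M.add_minus_cancel)
          then have "u \<ominus>\<^bsub>M\<^esub> w \<in> W" using w u WU U'(5) by (intro ker) auto
          then have "(u \<ominus>\<^bsub>M\<^esub> w) \<oplus>\<^bsub>M\<^esub> w \<in> W" using w W'(4) by blast
          then show "u \<in> W" using c by (simp add: M.M.add_minus_cancel)
        qed
      qed
      ultimately show "enat n \<le> index R S M U W" by (intro index_ge) simp
    qed
  qed
qed


section \<open>Finiteness of lengths\<close>

lemma regular_module_simps [simp]:
  "carrier (regular_module R) = carrier R" "ring.zero (regular_module R) = ring.zero R"
  "add (regular_module R) = add R" "smult (regular_module R) = monoid.mult R"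
  by (simp_all add: regular_module_def)

lemma module_regular:
  assumes "cring R"
  shows "module R (regular_module R)"
proof -
  interpret R: cring R by fact
  show ?thesis
  proof (rule moduleI)
    show "abelian_group (regular_module R)"
    proof (rule abelian_groupI)
      fix x assume "x \<in> carrier (regular_module R)"
      then show "\<exists>y\<in>carrier (regular_module R). y \<oplus>\<^bsub>regular_module R\<^esub> x = \<zero>\<^bsub>regular_module R\<^esub>"
        by (auto intro!: bexI[of _ "\<ominus>\<^bsub>R\<^esub> x"] simp: R.l_neg)
    qed (auto simp: R.a_ac)
  qed (auto simp: R.l_distr R.r_distr R.m_assoc intro: assms)
qed

lemma submodule_regular_iff:
  assumes "cring R"
  shows "submodule J R (regular_module R) \<longleftrightarrow> ideal J R"
proof
  interpret R: cring R by fact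
  interpret M: module R "regular_module R" by (rule module_regular[OF assms])
  show "ideal J R" if "submodule J R (regular_module R)"
  proof -
    note J = M.submoduleD[OF that]
    show ?thesis
    proof (rule idealI)
      show "subgroup J (add_monoid R)"
      proof (rule R.add.subgroupI)
        fix a assume a: "a \<in> J"
        then have "(\<ominus>\<^bsub>R\<^esub> \<one>\<^bsub>R\<^esub>) \<otimes>\<^bsub>R\<^esub> a \<in> J" using J(6)[of "\<ominus>\<^bsub>R\<^esub> \<one>\<^bsub>R\<^esub>" a] by simp
        then show "\<ominus>\<^bsub>R\<^esub> a \<in> J" using J(2)[OF a] by (simp add: R.l_minus)
      qed (use J in auto)
      show "ring R" ..
      show *: "x \<otimes>\<^bsub>R\<^esub> a \<in> J" if "a \<in> J" "x \<in> carrier R" for a x using J(6) that by simp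
      show "a \<otimes>\<^bsub>R\<^esub> x \<in> J" if "a \<in> J" "x \<in> carrier R" for a x
        using *[OF that] R.m_comm[of a x] that J(2) by simp
    qed
  qed
  show "submodule J R (regular_module R)" if "ideal J R"
  proof -
    interpret J: ideal J R by fact
    show ?thesis unfolding M.submodule_iff by (auto intro: J.I_l_closed)
  qed
qed

text \<open>These are the complements of the minimal primes over \<open>I\<close>; Zorn's lemma yields them directly.\<close>

definition maximal_mult_set :: "('a, 'r) ring_scheme \<Rightarrow> 'a set \<Rightarrow> 'a set \<Rightarrow> bool"
  where "maximal_mult_set R I S \<longleftrightarrow> submonoid S R \<and> S \<inter> I = {} \<and>
    (\<forall>T. submonoid T R \<and> T \<inter> I = {} \<and> S \<subseteq> T \<longrightarrow> T = S)"

lemma maximal_mult_setD: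
  assumes "maximal_mult_set R I S"
  shows "submonoid S R" "S \<subseteq> carrier R" "\<one>\<^bsub>R\<^esub> \<in> S" "S \<inter> I = {}"
  using assms submonoid.subset submonoid.one_closed by (auto simp: maximal_mult_set_def)

lemma ex_maximal_mult_set:
  assumes "cring R" "\<one>\<^bsub>R\<^esub> \<notin> I"
  shows "\<exists>S. maximal_mult_set R I S"
proof -
  interpret R: cring R by fact
  let ?A = "{S. submonoid S R \<and> S \<inter> I = {}}"
  have "submonoid {\<one>\<^bsub>R\<^esub>} R" by unfold_locales auto
  then have ne: "?A \<noteq> {}" using assms by auto
  have "\<exists>S\<in>?A. \<forall>T\<in>?A. S \<subseteq> T \<longrightarrow> T = S"
  proof (rule subset_Zorn_nonempty[OF ne])
    fix C assume C: "C \<noteq> {}" "subset.chain ?A C"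
    then have sub: "\<And>S. S \<in> C \<Longrightarrow> submonoid S R \<and> S \<inter> I = {}"
      and ch: "\<And>S T. S \<in> C \<Longrightarrow> T \<in> C \<Longrightarrow> S \<subseteq> T \<or> T \<subseteq> S"
      unfolding subset.chain_def by blast+
    have "submonoid (\<Union>C) R"
    proof
      show "\<Union>C \<subseteq> carrier R" using sub submonoid.subset by blast
      show "\<one>\<^bsub>R\<^esub> \<in> \<Union>C" using C(1) sub submonoid.one_closed by blast
      fix x y assume "x \<in> \<Union>C" "y \<in> \<Union>C"
      then obtain S T where ST: "S \<in> C" "x \<in> S" "T \<in> C" "y \<in> T" by auto
      then show "x \<otimes>\<^bsub>R\<^esub> y \<in> \<Union>C"
        using ch[OF ST(1,3)] sub[OF ST(1)] sub[OF ST(3)] submonoid.m_closed[of S R] submonoid.m_closed[of T R]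
        by blast
    qed
    then show "\<Union>C \<in> ?A" using sub by auto
  qed
  then show ?thesis by (auto simp: maximal_mult_set_def)
qed

lemma chain_between_self:
  assumes "\<one>\<^bsub>R\<^esub> \<in> S" "module R M" "chain_between R S M W W n"
  shows "n = 0"
  using assms(3)
proof cases
  case (chain_Suc V m)
  interpret M: module R M by fact
  have "W \<subseteq> V" "submodule V R M" using chain_betweenD[OF chain_Suc(2)] by auto
  then have "negligible S M W V"
    using assms(1) M.submoduleD(2)[of V] by (force simp: negligible_def)
  then show ?thesis using chain_Suc by simp
qed

text \<open>Noetherian induction: an ideal \<open>J\<close> that is maximal among the ideals containing \<open>I\<close> with
  \<open>R/J\<close> of infinite length is prime, because \<open>(J + aR)/J\<close> is isomorphic to \<open>R/(J : a)\<close>. By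
  maximality of \<open>S\<close> it is then the complement of \<open>S\<close>, and \<open>R/J\<close> has length at most one.\<close>

lemma index_ring_finite:
  assumes "cring R" "noetherian_ring R" and S: "maximal_mult_set R I S" and J: "ideal J R" "I \<subseteq> J"
  shows "index R S (regular_module R) (carrier R) J \<noteq> \<infinity>"
proof
  assume inf: "index R S (regular_module R) (carrier R) J = \<infinity>"
  interpret R: cring R by fact
  interpret N: noetherian_ring R by fact
  let ?M = "regular_module R"
  have M: "module R ?M" by (rule module_regular[OF assms(1)])
  interpret M: module R ?M by (rule M)
  note S' = maximal_mult_setD[OF S]
  note sm = submodule_regular_iff[OF assms(1)]
  have car: "submodule (carrier R) R ?M" using M.carrier_is_submodule by simp
  define A where "A = {J. ideal J R \<and> I \<subseteq> J \<and> index R S ?M (carrier R) J = \<infinity>}"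
  have ne: "A \<noteq> {}" using inf J by (auto simp: A_def)
  have "\<exists>J\<in>A. \<forall>K\<in>A. J \<subseteq> K \<longrightarrow> K = J"
  proof (rule subset_Zorn_nonempty[OF ne])
    fix C assume C: "C \<noteq> {}" "subset.chain A C"
    then have "subset.chain {J. ideal J R} C" by (auto simp: subset.chain_def A_def)
    then have "\<Union>C \<in> C" using N.ideal_chain_is_trivial C(1) by blast
    then show "\<Union>C \<in> A" using C(2) by (auto simp: subset.chain_def A_def)
  qed
  then obtain Q where QA: "Q \<in> A" and Qmax: "\<And>K. K \<in> A \<Longrightarrow> Q \<subseteq> K \<Longrightarrow> K = Q" by blast
  then have Q: "ideal Q R" "I \<subseteq> Q" "index R S ?M (carrier R) Q = \<infinity>" by (simp_all add: A_def)
  have max: "index R S ?M (carrier R) K \<noteq> \<infinity>" if "ideal K R" "Q \<subseteq> K" "K \<noteq> Q" for K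
    using Qmax[of K] that order_trans[OF Q(2) that(2)] by (auto simp: A_def)
  interpret Q: ideal Q R by fact
  have Qs: "submodule Q R ?M" using Q sm by simp
  have meet: "negligible S ?M (carrier R) K" if "ideal K R" "K \<inter> S \<noteq> {}" for K
  proof -
    interpret K: ideal K R by fact
    from that(2) obtain s where "s \<in> S" "s \<in> K" by auto
    then show ?thesis using K.I_r_closed by (auto simp: negligible_def)
  qed
  have disj: "Q \<inter> S = {}"
    using meet[OF Q(1)] index_eq_0_iff[OF Qs car, of S] Q(3) Q.a_subset by fastforce
  have prime: "a \<otimes>\<^bsub>R\<^esub> b \<notin> Q" if ab: "a \<in> carrier R" "b \<in> carrier R" "a \<notin> Q" "b \<notin> Q" for a b
  proof
    assume abQ: "a \<otimes>\<^bsub>R\<^esub> b \<in> Q"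
    let ?f = "\<lambda>r. r \<otimes>\<^bsub>R\<^esub> a"
    have f: "?f \<in> mod_hom R ?M ?M" using ab by (auto simp: mod_hom_iff R.l_distr R.m_assoc)
    define K where "K = {r \<in> carrier R. ?f r \<in> Q}"
    define L where "L = ?f ` carrier R <+>\<^bsub>?M\<^esub> Q"
    have Ks: "submodule K R ?M" using submodule_vimage[OF f M M car Qs] by (simp add: K_def)
    have Ls: "submodule L R ?M" unfolding L_def by (intro M.submodule_set_add submodule_image[OF f M M car] Qs)
    have "Q \<subseteq> K" using Q.I_r_closed[of _ a] ab(1) Q.a_subset by (auto simp: K_def)
    moreover have "b \<in> K" using ab abQ by (simp add: K_def R.m_comm)
    ultimately have 1: "index R S ?M (carrier R) K \<noteq> \<infinity>" using max[of K] Ks sm ab by blast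
    have "?f \<one>\<^bsub>R\<^esub> \<in> ?f ` carrier R" by blast
    then have "a \<in> L" using M.set_add_upper[OF submodule_image[OF f M M car] Qs] ab unfolding L_def by auto
    moreover have QL: "Q \<subseteq> L" unfolding L_def using M.set_add_upper[OF submodule_image[OF f M M car] Qs] by auto
    ultimately have 2: "index R S ?M (carrier R) L \<noteq> \<infinity>" using max[of L] Ls sm ab by blast
    have "?f ` K \<subseteq> Q" by (auto simp: K_def)
    then have "?f ` K <+>\<^bsub>?M\<^esub> Q = Q"
      using M.set_add_least[OF Qs, of "?f ` K" Q] M.set_add_upper[OF submodule_image[OF f M M Ks] Qs] by blast
    then have "index R S ?M L Q = index R S ?M (carrier R) K"
      using index_hom[OF f M M S'(2) Ks car _ Qs] unfolding L_def by (auto simp: K_def)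
    moreover have "index R S ?M (carrier R) Q = index R S ?M (carrier R) L + index R S ?M L Q"
      using QL M.submoduleD(1)[OF Ls] by (intro M.index_add S'(1) Qs Ls car) auto
    ultimately show False using Q(3) 1 2 by (metis plus_eq_infty_iff_enat)
  qed
  have "submonoid (carrier R - Q) R"
    using prime disj S'(3) by unfold_locales auto
  then have SQ: "carrier R - Q = S"
    using S Q(2) disj S'(2) by (auto simp: maximal_mult_set_def)
  have "enat n \<le> 1" if "chain_between R S ?M Q (carrier R) n" for n
    using that
  proof cases
    case (chain_Suc V m)
    have V: "submodule V R ?M" "Q \<subseteq> V" using chain_betweenD[OF chain_Suc(2)] by auto
    then have "V \<inter> S = {}" using meet[of V] chain_Suc(5) sm by blast
    then have "V = Q" using V(2) SQ M.submoduleD(1)[OF V(1)] by auto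
    then have "m = 0" using chain_between_self[OF S'(3) M] chain_Suc(2) by blast
    then show ?thesis using chain_Suc(1) by (simp add: one_enat_def)
  qed (simp add: zero_enat_def[symmetric])
  then have "index R S ?M (carrier R) Q \<le> 1" by (rule index_le)
  then show False using Q(3) by simp
qed

context module
begin

text \<open>Adding one generator \<open>x\<close> to a submodule \<open>V\<close> gives a quotient \<open>(Rx + V)/V\<close> isomorphic to \<open>R/(V : x)\<close>, and
  \<open>I\<close> is contained in \<open>(V : x)\<close>.\<close>

lemma index_span_finite:
  assumes "noetherian_ring R" and S: "maximal_mult_set R I S" and "ideal I R"
    and W: "submodule W R M" and A: "finite A" "A \<subseteq> carrier M" "\<And>a x. a \<in> I \<Longrightarrow> x \<in> A \<Longrightarrow> a \<odot>\<^bsub>M\<^esub> x \<in> W"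
  shows "index R S M (module_span R M A <+>\<^bsub>M\<^esub> W) W \<noteq> \<infinity>"
  using A
proof (induction A rule: finite_induct)
  case empty
  note W' = submoduleD[OF W]
  have "module_span R M {} <+>\<^bsub>M\<^esub> W = W"
    using set_add_least[OF W, of "{\<zero>\<^bsub>M\<^esub>}" W] set_add_upper(2)[OF submodule_zero W] W'(3) span_empty by auto
  moreover have "negligible S M W W"
    using W'(6) maximal_mult_setD(2,3)[OF S] by (auto simp: negligible_def)
  ultimately show ?case using index_eq_0_iff[OF W W, of S] by simp
next
  case (insert x A)
  have x: "x \<in> carrier M" and A: "A \<subseteq> carrier M" using insert by auto
  have R: "cring R" ..
  note S' = maximal_mult_setD[OF S]
  let ?V = "module_span R M A <+>\<^bsub>M\<^esub> W"
  let ?N = "regular_module R"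
  let ?f = "\<lambda>a. a \<odot>\<^bsub>M\<^esub> x"
  have N: "module R ?N" by (rule module_regular[OF R])
  interpret N: module R ?N by (rule N)
  have M: "module R M" ..
  have sp: "submodule (module_span R M A) R M" by (rule submodule_span[OF A])
  have V: "submodule ?V R M" by (intro submodule_set_add sp W)
  have WV: "W \<subseteq> ?V" using set_add_upper[OF sp W] by auto
  have f: "?f \<in> mod_hom R ?N M" using x by (auto simp: mod_hom_iff smult_l_distr smult_assoc1)
  have car: "submodule (carrier R) R ?N" using N.carrier_is_submodule by simp
  note cyc = submodule_cyclic[OF x]
  define K where "K = {r \<in> carrier R. ?f r \<in> ?V}"
  have K: "submodule K R ?N" using submodule_vimage[OF f N M car V] by (simp add: K_def)
  have "I \<subseteq> K" using insert.prems(2)[of _ x] WV ideal.Icarr[OF assms(3)] by (auto simp: K_def)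
  then have 1: "index R S ?N (carrier R) K \<noteq> \<infinity>"
    using index_ring_finite[OF R assms(1) S] K submodule_regular_iff[OF R] by blast
  have "?f ` K \<subseteq> ?V" by (auto simp: K_def)
  then have "?f ` K <+>\<^bsub>M\<^esub> ?V = ?V"
    using set_add_least[OF V, of "?f ` K" ?V] set_add_upper[OF submodule_image[OF f N M K] V] by blast
  then have 2: "index R S M (?f ` carrier R <+>\<^bsub>M\<^esub> ?V) ?V \<noteq> \<infinity>"
    using index_hom[OF f N M S'(2) K car _ V] 1 by (auto simp: K_def)
  have eq: "module_span R M (insert x A) <+>\<^bsub>M\<^esub> W = ?f ` carrier R <+>\<^bsub>M\<^esub> ?V"
    unfolding span_insert[OF x A]
    using submoduleD(1)[OF cyc] submoduleD(1)[OF sp] submoduleD(1)[OF W] unfolding set_add_def by (intro M.add.set_mult_assoc)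
  have "?V \<subseteq> ?f ` carrier R <+>\<^bsub>M\<^esub> ?V" using set_add_upper[OF cyc V] by auto
  then have "index R S M (?f ` carrier R <+>\<^bsub>M\<^esub> ?V) W =
      index R S M (?f ` carrier R <+>\<^bsub>M\<^esub> ?V) ?V + index R S M ?V W"
    by (intro index_add S'(1) W V submodule_set_add cyc WV)
  moreover have "index R S M ?V W \<noteq> \<infinity>" using insert.IH[OF A] insert.prems(2) by blast
  ultimately show ?case using 2 eq by (metis plus_eq_infty_iff_enat)
qed

end

lemma index_finite:
  assumes "noetherian_ring R" and S: "maximal_mult_set R I S" and "ideal I R"
    and "fg_module R M" and U: "submodule U R M" and W: "submodule W R M" and "W \<subseteq> U"
    and "\<And>a u. a \<in> I \<Longrightarrow> u \<in> U \<Longrightarrow> a \<odot>\<^bsub>M\<^esub> u \<in> W"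
  shows "index R S M U W \<noteq> \<infinity>"
proof -
  interpret M: module R M using assms(4) by (simp add: fg_module_def)
  obtain B where B: "B \<subseteq> U" "finite B" "U = module_span R M B"
    using noetherian_submodule_fg[OF assms(1,4) U] .
  then have "module_span R M B <+>\<^bsub>M\<^esub> W = U" using M.set_add_absorb[OF U W assms(7)] by simp
  then show ?thesis
    using M.index_span_finite[OF assms(1) S assms(3) W B(2)] B(1) M.submoduleD(1)[OF U] assms(8) by auto
qed


section \<open>Powers of a module\<close>

definition pow_mod :: "('a, 'm, 'c) module_scheme \<Rightarrow> nat \<Rightarrow> ('a, nat \<Rightarrow> 'm) module"
  where "pow_mod X n =
    \<lparr>carrier = {..<n} \<rightarrow>\<^sub>E carrier X, monoid.mult = undefined, one = undefined,
     ring.zero = (\<lambda>i \<in> {..<n}. \<zero>\<^bsub>X\<^esub>),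
     add = (\<lambda>x y. \<lambda>i \<in> {..<n}. x i \<oplus>\<^bsub>X\<^esub> y i),
     smult = (\<lambda>a x. \<lambda>i \<in> {..<n}. a \<odot>\<^bsub>X\<^esub> x i)\<rparr>"

lemma free_mod_eq_pow_mod: "free_mod R n = pow_mod (regular_module R) n"
  by (simp add: free_mod_def pow_mod_def)

lemma pow_mod_simps [simp]:
  "carrier (pow_mod X n) = {..<n} \<rightarrow>\<^sub>E carrier X" "ring.zero (pow_mod X n) = (\<lambda>i \<in> {..<n}. \<zero>\<^bsub>X\<^esub>)"
  "add (pow_mod X n) = (\<lambda>x y. \<lambda>i \<in> {..<n}. x i \<oplus>\<^bsub>X\<^esub> y i)"
  "smult (pow_mod X n) = (\<lambda>a x. \<lambda>i \<in> {..<n}. a \<odot>\<^bsub>X\<^esub> x i)"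
  by (simp_all add: pow_mod_def)

lemma pow_mod_eqI:
  "x \<in> carrier (pow_mod X n) \<Longrightarrow> y \<in> carrier (pow_mod X n) \<Longrightarrow> (\<And>i. i < n \<Longrightarrow> x i = y i) \<Longrightarrow> x = y"
  by (auto intro: PiE_ext)

lemma module_pow:
  assumes "module R X"
  shows "module R (pow_mod X n)"
proof -
  interpret X: module R X by fact
  show ?thesis
  proof (rule moduleI)
    show "cring R" ..
    show "abelian_group (pow_mod X n)"
    proof (rule abelian_groupI)
      fix x assume x: "x \<in> carrier (pow_mod X n)"
      show "\<exists>y\<in>carrier (pow_mod X n). y \<oplus>\<^bsub>pow_mod X n\<^esub> x = \<zero>\<^bsub>pow_mod X n\<^esub>"
        using x by (intro bexI[of _ "\<lambda>i\<in>{..<n}. \<ominus>\<^bsub>X\<^esub> x i"]) (auto simp: fun_eq_iff X.M.l_neg PiE_iff)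
      show "\<zero>\<^bsub>pow_mod X n\<^esub> \<oplus>\<^bsub>pow_mod X n\<^esub> x = x"
        using x by (intro pow_mod_eqI[of _ X n]) (auto simp: PiE_iff)
      fix y assume y: "y \<in> carrier (pow_mod X n)"
      show "x \<oplus>\<^bsub>pow_mod X n\<^esub> y = y \<oplus>\<^bsub>pow_mod X n\<^esub> x"
        using x y by (auto simp: fun_eq_iff PiE_iff X.M.a_comm)
      fix z assume z: "z \<in> carrier (pow_mod X n)"
      show "x \<oplus>\<^bsub>pow_mod X n\<^esub> y \<oplus>\<^bsub>pow_mod X n\<^esub> z = x \<oplus>\<^bsub>pow_mod X n\<^esub> (y \<oplus>\<^bsub>pow_mod X n\<^esub> z)"
        using x y z by (auto simp: fun_eq_iff PiE_iff X.M.a_assoc)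
    qed (auto simp: PiE_iff)
  next
    fix a b x y assume *: "a \<in> carrier R" "b \<in> carrier R" "x \<in> carrier (pow_mod X n)" "y \<in> carrier (pow_mod X n)"
    show "a \<odot>\<^bsub>pow_mod X n\<^esub> x \<in> carrier (pow_mod X n)" using * by (auto simp: PiE_iff)
    show "(a \<oplus>\<^bsub>R\<^esub> b) \<odot>\<^bsub>pow_mod X n\<^esub> x = a \<odot>\<^bsub>pow_mod X n\<^esub> x \<oplus>\<^bsub>pow_mod X n\<^esub> b \<odot>\<^bsub>pow_mod X n\<^esub> x"
      using * by (auto simp: fun_eq_iff PiE_iff X.smult_l_distr)
    show "a \<odot>\<^bsub>pow_mod X n\<^esub> (x \<oplus>\<^bsub>pow_mod X n\<^esub> y) = a \<odot>\<^bsub>pow_mod X n\<^esub> x \<oplus>\<^bsub>pow_mod X n\<^esub> a \<odot>\<^bsub>pow_mod X n\<^esub> y"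
      using * by (auto simp: fun_eq_iff PiE_iff X.smult_r_distr)
    show "(a \<otimes>\<^bsub>R\<^esub> b) \<odot>\<^bsub>pow_mod X n\<^esub> x = a \<odot>\<^bsub>pow_mod X n\<^esub> (b \<odot>\<^bsub>pow_mod X n\<^esub> x)"
      using * by (auto simp: fun_eq_iff PiE_iff X.smult_assoc1)
  next
    fix x assume x: "x \<in> carrier (pow_mod X n)"
    then show "\<one>\<^bsub>R\<^esub> \<odot>\<^bsub>pow_mod X n\<^esub> x = x" by (intro pow_mod_eqI[of _ X n]) (auto simp: PiE_iff)
  qed
qed

lemma module_free: "cring R \<Longrightarrow> module R (free_mod R n)"
  unfolding free_mod_eq_pow_mod by (intro module_pow module_regular)

lemma submodule_pow:
  assumes "module R X" "submodule U R X"
  shows "submodule ({..<n} \<rightarrow>\<^sub>E U) R (pow_mod X n)"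
proof -
  interpret X: module R X by fact
  interpret P: module R "pow_mod X n" by (rule module_pow[OF assms(1)])
  show ?thesis unfolding P.submodule_iff using X.submoduleD[OF assms(2)] by (auto simp: PiE_iff)
qed

definition single :: "('a, 'm, 'c) module_scheme \<Rightarrow> nat \<Rightarrow> nat \<Rightarrow> 'm \<Rightarrow> nat \<Rightarrow> 'm"
  where "single X n i x = (\<lambda>j\<in>{..<n}. if j = i then x else \<zero>\<^bsub>X\<^esub>)"

lemma single_hom:
  assumes "module R X"
  shows "single X n i \<in> mod_hom R X (pow_mod X n)"
proof -
  interpret X: module R X by fact
  show ?thesis by (auto simp: mod_hom_iff single_def fun_eq_iff)
qed

lemma fg_pow:
  assumes "fg_module R X"
  shows "fg_module R (pow_mod X n)"
proof -
  obtain A where A: "A \<subseteq> carrier X" "finite A" "carrier X = module_span R X A" "module R X"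
    using assms by (auto simp: fg_module_def)
  interpret X: module R X by (rule A(4))
  have P: "module R (pow_mod X n)" by (rule module_pow[OF A(4)])
  interpret P: module R "pow_mod X n" by (rule P)
  let ?B = "\<Union>i<n. single X n i ` A"
  have B: "?B \<subseteq> carrier (pow_mod X n)" using A(1) mod_homD(1)[OF single_hom[OF A(4)]] by blast
  note s = P.submodule_span[OF B]
  have sing: "single X n i x \<in> module_span R (pow_mod X n) ?B" if "i < n" "x \<in> carrier X" for i x
  proof -
    have "single X n i x \<in> single X n i ` module_span R X A" using that A(3) by auto
    also have "\<dots> = module_span R (pow_mod X n) (single X n i ` A)"
      by (rule span_image[OF single_hom[OF A(4)] A(4) P A(1)])
    also have "\<dots> \<subseteq> module_span R (pow_mod X n) ?B" using that B by (intro P.span_mono) auto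
    finally show ?thesis .
  qed
  have trunc: "(\<lambda>i\<in>{..<n}. if i < m then z i else \<zero>\<^bsub>X\<^esub>) \<in> module_span R (pow_mod X n) ?B"
    if z: "z \<in> carrier (pow_mod X n)" and "m \<le> n" for z m
    using that(2)
  proof (induction m)
    case 0
    then show ?case using P.submoduleD(3)[OF s] by (simp add: restrict_def)
  next
    case (Suc m)
    have "(\<lambda>i\<in>{..<n}. if i < Suc m then z i else \<zero>\<^bsub>X\<^esub>) =
        (\<lambda>i\<in>{..<n}. if i < m then z i else \<zero>\<^bsub>X\<^esub>) \<oplus>\<^bsub>pow_mod X n\<^esub> single X n m (z m)"
      using z Suc by (auto simp: fun_eq_iff single_def PiE_iff less_Suc_eq)
    moreover have "(\<lambda>i\<in>{..<n}. if i < m then z i else \<zero>\<^bsub>X\<^esub>) \<in> module_span R (pow_mod X n) ?B"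
      using Suc.IH Suc.prems by (simp only: Suc_leD)
    moreover have "single X n m (z m) \<in> module_span R (pow_mod X n) ?B"
      using Suc z by (intro sing) (auto simp: PiE_iff)
    ultimately show ?case using P.submoduleD(4)[OF s] by (simp del: pow_mod_simps)
  qed
  have "z \<in> module_span R (pow_mod X n) ?B" if z: "z \<in> carrier (pow_mod X n)" for z
  proof -
    have "(\<lambda>i\<in>{..<n}. if i < n then z i else \<zero>\<^bsub>X\<^esub>) = z" using z by (intro pow_mod_eqI[of _ X n]) (auto simp: PiE_iff)
    then show ?thesis using trunc[OF z, of n] by simp
  qed
  then have "carrier (pow_mod X n) = module_span R (pow_mod X n) ?B" using P.submoduleD(1)[OF s] by blast
  then show ?thesis using A(2) B P unfolding fg_module_def by (intro conjI exI[of _ ?B]) auto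
qed

lemma fg_regular:
  assumes "cring R"
  shows "fg_module R (regular_module R)"
proof -
  interpret R: cring R by fact
  have M: "module R (regular_module R)" by (rule module_regular[OF assms])
  interpret M: module R "regular_module R" by (rule M)
  have s: "submodule (module_span R (regular_module R) {\<one>\<^bsub>R\<^esub>}) R (regular_module R)"
    by (rule M.submodule_span) auto
  have "r \<in> module_span R (regular_module R) {\<one>\<^bsub>R\<^esub>}" if "r \<in> carrier R" for r
    using M.submoduleD(6)[OF s, of r "\<one>\<^bsub>R\<^esub>"] M.span_superset[of "{\<one>\<^bsub>R\<^esub>}"] that by simp
  then show ?thesis using M M.submoduleD(1)[OF s] by (auto simp: fg_module_def intro!: exI[of _ "{\<one>\<^bsub>R\<^esub>}"])
qed

lemma fg_free: "cring R \<Longrightarrow> fg_module R (free_mod R n)"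
  unfolding free_mod_eq_pow_mod by (intro fg_pow fg_regular)


section \<open>Matrices acting on powers of a module\<close>

definition lincomb :: "('a, 'm, 'c) module_scheme \<Rightarrow> nat \<Rightarrow> (nat \<Rightarrow> 'a) \<Rightarrow> (nat \<Rightarrow> 'm) \<Rightarrow> 'm"
  where "lincomb X n x z = (\<Oplus>\<^bsub>X\<^esub>j\<in>{..<n}. x j \<odot>\<^bsub>X\<^esub> z j)"

definition mat_act ::
  "('a, 'm, 'c) module_scheme \<Rightarrow> nat \<Rightarrow> (nat \<Rightarrow> nat \<Rightarrow> 'a) \<Rightarrow> (nat \<Rightarrow> 'm) \<Rightarrow> nat \<Rightarrow> 'm"
  where "mat_act X n A z = (\<lambda>i\<in>{..<n}. lincomb X n (A i) z)"

text \<open>A matrix is the tuple of its rows. With this encoding the product \<open>AB\<close> is the action of \<open>A\<close>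
  on the tuple \<open>B\<close> of elements of \<open>R\<^sup>n\<close>.\<close>

abbreviation mats :: "('a, 'r) ring_scheme \<Rightarrow> nat \<Rightarrow> (nat \<Rightarrow> nat \<Rightarrow> 'a) set"
  where "mats R n \<equiv> carrier (pow_mod (free_mod R n) n)"

abbreviation mat_mult ::
  "('a, 'r) ring_scheme \<Rightarrow> nat \<Rightarrow> (nat \<Rightarrow> nat \<Rightarrow> 'a) \<Rightarrow> (nat \<Rightarrow> nat \<Rightarrow> 'a) \<Rightarrow> nat \<Rightarrow> nat \<Rightarrow> 'a"
  where "mat_mult R n \<equiv> mat_act (free_mod R n) n"

abbreviation unit_vec :: "('a, 'r) ring_scheme \<Rightarrow> nat \<Rightarrow> nat \<Rightarrow> nat \<Rightarrow> 'a"
  where "unit_vec R n i \<equiv> single (regular_module R) n i \<one>\<^bsub>R\<^esub>"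

definition id_mat :: "('a, 'r) ring_scheme \<Rightarrow> nat \<Rightarrow> nat \<Rightarrow> nat \<Rightarrow> 'a"
  where "id_mat R n = (\<lambda>i\<in>{..<n}. unit_vec R n i)"

lemma free_mod_simps [simp]:
  "carrier (free_mod R n) = {..<n} \<rightarrow>\<^sub>E carrier R" "ring.zero (free_mod R n) = (\<lambda>i \<in> {..<n}. \<zero>\<^bsub>R\<^esub>)"
  "add (free_mod R n) = (\<lambda>x y. \<lambda>i \<in> {..<n}. x i \<oplus>\<^bsub>R\<^esub> y i)"
  "smult (free_mod R n) = (\<lambda>a x. \<lambda>i \<in> {..<n}. a \<otimes>\<^bsub>R\<^esub> x i)"
  by (simp_all add: free_mod_def)

lemma id_mat_closed: "cring R \<Longrightarrow> id_mat R n \<in> mats R n"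
proof -
  assume "cring R"
  then interpret R: cring R .
  show "id_mat R n \<in> mats R n" by (auto simp: id_mat_def single_def)
qed

lemma mod_hom_finsum:
  assumes f: "f \<in> mod_hom R X Y" and X: "module R X" and Y: "module R Y"
    and "finite J" "\<And>j. j \<in> J \<Longrightarrow> g j \<in> carrier X"
  shows "f (\<Oplus>\<^bsub>X\<^esub>j\<in>J. g j) = (\<Oplus>\<^bsub>Y\<^esub>j\<in>J. f (g j))"
proof -
  interpret X: module R X by fact
  interpret Y: module R Y by fact
  show ?thesis
    using assms(4,5)
  proof (induction J rule: finite_induct)
    case empty
    then show ?case by (simp add: mod_hom_zero[OF f X Y])
  next
    case (insert j J)
    have "f (\<Oplus>\<^bsub>X\<^esub>j\<in>insert j J. g j) = f (g j \<oplus>\<^bsub>X\<^esub> (\<Oplus>\<^bsub>X\<^esub>j\<in>J. g j))"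
      using insert by (subst X.finsum_insert) auto
    also have "\<dots> = f (g j) \<oplus>\<^bsub>Y\<^esub> (\<Oplus>\<^bsub>Y\<^esub>j\<in>J. f (g j))"
      using insert by (subst mod_homD(2)[OF f]) auto
    also have "\<dots> = (\<Oplus>\<^bsub>Y\<^esub>j\<in>insert j J. f (g j))"
      using insert mod_homD(1)[OF f] by (subst Y.finsum_insert) auto
    finally show ?case .
  qed
qed

context module
begin

lemma submodule_finsum:
  assumes "submodule U R M" "finite J" "\<And>j. j \<in> J \<Longrightarrow> g j \<in> U"
  shows "(\<Oplus>\<^bsub>M\<^esub>j\<in>J. g j) \<in> U"
  using assms(2,3)
proof (induction J rule: finite_induct)
  case (insert j J)
  then show ?case using submoduleD[OF assms(1)] by (subst M.finsum_insert) auto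
qed (use submoduleD[OF assms(1)] in auto)

lemma lincomb_in_submodule:
  assumes "submodule U R M" "x \<in> carrier (free_mod R n)" "z \<in> {..<n} \<rightarrow> U"
  shows "lincomb M n x z \<in> U"
  unfolding lincomb_def using assms(2,3) submoduleD(6)[OF assms(1)]
  by (intro submodule_finsum[OF assms(1)]) (auto simp: PiE_iff Pi_iff)

lemma lincomb_closed:
  "x \<in> carrier (free_mod R n) \<Longrightarrow> z \<in> {..<n} \<rightarrow> carrier M \<Longrightarrow> lincomb M n x z \<in> carrier M"
  by (rule lincomb_in_submodule[OF carrier_is_submodule])

lemma lincomb_hom_right:
  assumes x: "x \<in> carrier (free_mod R n)"
  shows "lincomb M n x \<in> mod_hom R (pow_mod M n) M"
  unfolding mod_hom_iff
proof (intro conjI ballI)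
  have x': "\<And>j. j < n \<Longrightarrow> x j \<in> carrier R" using x by (auto simp: PiE_iff)
  fix y z assume yz: "y \<in> carrier (pow_mod M n)" "z \<in> carrier (pow_mod M n)"
  then have yz': "\<And>j. j < n \<Longrightarrow> y j \<in> carrier M" "\<And>j. j < n \<Longrightarrow> z j \<in> carrier M" by (auto simp: PiE_iff)
  show "lincomb M n x z \<in> carrier M" using x yz by (intro lincomb_closed) auto
  have "lincomb M n x (y \<oplus>\<^bsub>pow_mod M n\<^esub> z) = (\<Oplus>\<^bsub>M\<^esub>j\<in>{..<n}. x j \<odot>\<^bsub>M\<^esub> y j \<oplus>\<^bsub>M\<^esub> x j \<odot>\<^bsub>M\<^esub> z j)"
    unfolding lincomb_def using x' yz' by (intro M.finsum_cong') (auto simp: smult_r_distr)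
  also have "\<dots> = lincomb M n x y \<oplus>\<^bsub>M\<^esub> lincomb M n x z"
    unfolding lincomb_def using x' yz' by (intro M.finsum_addf) auto
  finally show "lincomb M n x (y \<oplus>\<^bsub>pow_mod M n\<^esub> z) = lincomb M n x y \<oplus>\<^bsub>M\<^esub> lincomb M n x z" .
next
  have x': "\<And>j. j < n \<Longrightarrow> x j \<in> carrier R" using x by (auto simp: PiE_iff)
  fix a z assume a: "a \<in> carrier R" and z: "z \<in> carrier (pow_mod M n)"
  then have z': "\<And>j. j < n \<Longrightarrow> z j \<in> carrier M" by (auto simp: PiE_iff)
  have "lincomb M n x (a \<odot>\<^bsub>pow_mod M n\<^esub> z) = (\<Oplus>\<^bsub>M\<^esub>j\<in>{..<n}. a \<odot>\<^bsub>M\<^esub> (x j \<odot>\<^bsub>M\<^esub> z j))"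
    unfolding lincomb_def using x' z' a
    by (intro M.finsum_cong') (auto simp: smult_assoc1[symmetric] R.m_comm)
  also have "\<dots> = a \<odot>\<^bsub>M\<^esub> lincomb M n x z"
    unfolding lincomb_def using x' z' a by (intro finsum_smult_ldistr[symmetric]) auto
  finally show "lincomb M n x (a \<odot>\<^bsub>pow_mod M n\<^esub> z) = a \<odot>\<^bsub>M\<^esub> lincomb M n x z" .
qed

lemma lincomb_hom_left:
  assumes z: "z \<in> carrier (pow_mod M n)"
  shows "(\<lambda>x. lincomb M n x z) \<in> mod_hom R (free_mod R n) M"
  unfolding mod_hom_iff
proof (intro conjI ballI)
  have z': "\<And>j. j < n \<Longrightarrow> z j \<in> carrier M" using z by (auto simp: PiE_iff)
  fix x y assume xy: "x \<in> carrier (free_mod R n)" "y \<in> carrier (free_mod R n)"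
  then have xy': "\<And>j. j < n \<Longrightarrow> x j \<in> carrier R" "\<And>j. j < n \<Longrightarrow> y j \<in> carrier R" by (auto simp: PiE_iff)
  show "lincomb M n y z \<in> carrier M" using xy z by (intro lincomb_closed) auto
  have "lincomb M n (x \<oplus>\<^bsub>free_mod R n\<^esub> y) z = (\<Oplus>\<^bsub>M\<^esub>j\<in>{..<n}. x j \<odot>\<^bsub>M\<^esub> z j \<oplus>\<^bsub>M\<^esub> y j \<odot>\<^bsub>M\<^esub> z j)"
    unfolding lincomb_def using xy' z' by (intro M.finsum_cong') (auto simp: smult_l_distr)
  also have "\<dots> = lincomb M n x z \<oplus>\<^bsub>M\<^esub> lincomb M n y z"
    unfolding lincomb_def using xy' z' by (intro M.finsum_addf) auto
  finally show "lincomb M n (x \<oplus>\<^bsub>free_mod R n\<^esub> y) z = lincomb M n x z \<oplus>\<^bsub>M\<^esub> lincomb M n y z" .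
next
  have z': "\<And>j. j < n \<Longrightarrow> z j \<in> carrier M" using z by (auto simp: PiE_iff)
  fix a x assume a: "a \<in> carrier R" and x: "x \<in> carrier (free_mod R n)"
  then have x': "\<And>j. j < n \<Longrightarrow> x j \<in> carrier R" by (auto simp: PiE_iff)
  have "lincomb M n (a \<odot>\<^bsub>free_mod R n\<^esub> x) z = (\<Oplus>\<^bsub>M\<^esub>j\<in>{..<n}. a \<odot>\<^bsub>M\<^esub> (x j \<odot>\<^bsub>M\<^esub> z j))"
    unfolding lincomb_def using x' z' a by (intro M.finsum_cong') (auto simp: smult_assoc1)
  also have "\<dots> = a \<odot>\<^bsub>M\<^esub> lincomb M n x z"
    unfolding lincomb_def using x' z' a by (intro finsum_smult_ldistr[symmetric]) auto
  finally show "lincomb M n (a \<odot>\<^bsub>free_mod R n\<^esub> x) z = a \<odot>\<^bsub>M\<^esub> lincomb M n x z" .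
qed

lemma lincomb_unit_vec:
  assumes z: "z \<in> carrier (pow_mod M n)" and i: "i < n"
  shows "lincomb M n (unit_vec R n i) z = z i"
proof -
  have z': "\<And>j. j < n \<Longrightarrow> z j \<in> carrier M" using z by (auto simp: PiE_iff)
  have "lincomb M n (unit_vec R n i) z = (\<Oplus>\<^bsub>M\<^esub>j\<in>{..<n}. if i = j then z j else \<zero>\<^bsub>M\<^esub>)"
    unfolding lincomb_def using z' by (intro M.finsum_cong') (auto simp: single_def)
  also have "\<dots> = z i" using z' i by (intro M.finsum_singleton) auto
  finally show ?thesis .
qed

end

lemma lincomb_natural:
  assumes f: "f \<in> mod_hom R X Y" and X: "module R X" and Y: "module R Y"
    and x: "x \<in> carrier (free_mod R n)" and z: "z \<in> {..<n} \<rightarrow> carrier X"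
  shows "f (lincomb X n x z) = lincomb Y n x (\<lambda>j\<in>{..<n}. f (z j))"
proof -
  interpret X: module R X by fact
  interpret Y: module R Y by fact
  have x': "\<And>j. j < n \<Longrightarrow> x j \<in> carrier R" using x by (auto simp: PiE_iff)
  have z': "\<And>j. j < n \<Longrightarrow> z j \<in> carrier X" using z by auto
  have "f (lincomb X n x z) = (\<Oplus>\<^bsub>Y\<^esub>j\<in>{..<n}. f (x j \<odot>\<^bsub>X\<^esub> z j))"
    unfolding lincomb_def using x' z' by (intro mod_hom_finsum[OF f X Y]) auto
  also have "\<dots> = lincomb Y n x (\<lambda>j\<in>{..<n}. f (z j))"
    unfolding lincomb_def using x' z' mod_homD[OF f] by (intro Y.finsum_cong') auto
  finally show ?thesis .
qed

lemma free_mod_carrier_row: "A \<in> mats R n \<Longrightarrow> i < n \<Longrightarrow> A i \<in> carrier (free_mod R n)"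
  by (auto simp: PiE_iff simp del: free_mod_simps)

lemma mat_act_hom:
  assumes X: "module R X" and A: "A \<in> mats R n"
  shows "mat_act X n A \<in> mod_hom R (pow_mod X n) (pow_mod X n)"
proof -
  interpret X: module R X by fact
  note h = mod_homD[OF X.lincomb_hom_right[OF free_mod_carrier_row[OF A]]]
  show ?thesis
    unfolding mod_hom_iff mat_act_def using h
    by (auto simp: fun_eq_iff simp del: free_mod_simps)
qed

lemma mat_act_submodule:
  assumes X: "module R X" and U: "submodule U R X" and A: "A \<in> mats R n" and z: "z \<in> {..<n} \<rightarrow>\<^sub>E U"
  shows "mat_act X n A z \<in> {..<n} \<rightarrow>\<^sub>E U"
proof -
  interpret X: module R X by fact
  show ?thesis unfolding mat_act_def using z free_mod_carrier_row[OF A]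
    by (auto intro!: X.lincomb_in_submodule[OF U] simp del: free_mod_simps)
qed

lemma mat_act_natural:
  assumes f: "f \<in> mod_hom R X Y" and X: "module R X" and Y: "module R Y"
    and A: "A \<in> mats R n" and z: "z \<in> {..<n} \<rightarrow> carrier X"
  shows "mat_act Y n A (\<lambda>j\<in>{..<n}. f (z j)) = (\<lambda>i\<in>{..<n}. f (mat_act X n A z i))"
  unfolding mat_act_def using lincomb_natural[OF f X Y free_mod_carrier_row[OF A] z]
  by (auto simp: fun_eq_iff simp del: free_mod_simps)

text \<open>Associativity of the matrix action is an instance of naturality, since \<open>x \<mapsto> lincomb X n x z\<close> is a
  homomorphism.\<close>

lemma lincomb_assoc:
  assumes R: "cring R" and X: "module R X" and x: "x \<in> carrier (free_mod R n)" and B: "B \<in> mats R n"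
    and z: "z \<in> carrier (pow_mod X n)"
  shows "lincomb X n (lincomb (free_mod R n) n x B) z = lincomb X n x (mat_act X n B z)"
proof -
  interpret X: module R X by fact
  show ?thesis unfolding mat_act_def
    using free_mod_carrier_row[OF B]
    by (intro lincomb_natural[OF X.lincomb_hom_left[OF z] module_free[OF R] X x]) (auto simp del: free_mod_simps)
qed

lemma mat_act_assoc:
  assumes R: "cring R" and X: "module R X" and A: "A \<in> mats R n" and B: "B \<in> mats R n"
    and z: "z \<in> carrier (pow_mod X n)"
  shows "mat_act X n (mat_mult R n A B) z = mat_act X n A (mat_act X n B z)"
proof (rule ext)
  fix i
  show "mat_act X n (mat_mult R n A B) z i = mat_act X n A (mat_act X n B z) i"
    using lincomb_assoc[OF R X free_mod_carrier_row[OF A] B z]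
    by (simp add: mat_act_def del: free_mod_simps)
qed

lemma mat_act_hom_left:
  assumes X: "module R X" and z: "z \<in> carrier (pow_mod X n)"
  shows "(\<lambda>A. mat_act X n A z) \<in> mod_hom R (pow_mod (free_mod R n) n) (pow_mod X n)"
proof -
  interpret X: module R X by fact
  note h = mod_homD[OF X.lincomb_hom_left[OF z]]
  show ?thesis
    unfolding mod_hom_iff mat_act_def using h
    by (auto simp: fun_eq_iff PiE_iff simp del: free_mod_simps)
qed

lemma mat_act_id:
  assumes X: "module R X" and z: "z \<in> carrier (pow_mod X n)"
  shows "mat_act X n (id_mat R n) z = z"
proof -
  interpret X: module R X by fact
  have "id_mat R n \<in> mats R n" by (rule id_mat_closed) unfold_locales
  then have "mat_act X n (id_mat R n) z \<in> carrier (pow_mod X n)"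
    using mod_homD(1)[OF mat_act_hom[OF X] z] by blast
  then show ?thesis
    using z by (rule pow_mod_eqI) (simp add: mat_act_def id_mat_def X.lincomb_unit_vec[OF z])
qed


section \<open>The Herbrand difference\<close>

definition act_ker ::
  "('a, 'm, 'c) module_scheme \<Rightarrow> nat \<Rightarrow> (nat \<Rightarrow> nat \<Rightarrow> 'a) \<Rightarrow> 'm set \<Rightarrow> 'm set \<Rightarrow> (nat \<Rightarrow> 'm) set"
  where "act_ker X n B U W = {z \<in> {..<n} \<rightarrow>\<^sub>E U. mat_act X n B z \<in> {..<n} \<rightarrow>\<^sub>E W}"

definition act_im ::
  "('a, 'm, 'c) module_scheme \<Rightarrow> nat \<Rightarrow> (nat \<Rightarrow> nat \<Rightarrow> 'a) \<Rightarrow> 'm set \<Rightarrow> 'm set \<Rightarrow> (nat \<Rightarrow> 'm) set"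
  where "act_im X n A U W =
    mat_act X n A ` ({..<n} \<rightarrow>\<^sub>E U) <+>\<^bsub>pow_mod X n\<^esub> ({..<n} \<rightarrow>\<^sub>E W)"

text \<open>The length of the homology of \<open>(U/W)\<^sup>n \<rightarrow> (U/W)\<^sup>n \<rightarrow> (U/W)\<^sup>n\<close> with maps \<open>A\<close> and \<open>B\<close>.\<close>

definition homology_length ::
  "('a, 'r) ring_scheme \<Rightarrow> 'a set \<Rightarrow> ('a, 'm, 'c) module_scheme \<Rightarrow> nat \<Rightarrow> (nat \<Rightarrow> nat \<Rightarrow> 'a) \<Rightarrow>
    (nat \<Rightarrow> nat \<Rightarrow> 'a) \<Rightarrow> 'm set \<Rightarrow> 'm set \<Rightarrow> enat"
  where "homology_length R S X n A B U W = index R S (pow_mod X n) (act_ker X n B U W) (act_im X n A U W)"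

text \<open>The Herbrand quotient of the two-periodic complex \<open>(U/W)\<^sup>n\<close> with maps \<open>A\<close> and \<open>B\<close>, written additively.
  If \<open>A\<close> and \<open>B\<close> come from a periodic free resolution of \<open>M\<close>, it is the difference of the lengths of an
  even and an odd \<open>Tor(U/W, M)\<close>, known as Hochster's theta pairing.\<close>

definition herbrand ::
  "('a, 'r) ring_scheme \<Rightarrow> 'a set \<Rightarrow> ('a, 'm, 'c) module_scheme \<Rightarrow> nat \<Rightarrow> (nat \<Rightarrow> nat \<Rightarrow> 'a) \<Rightarrow>
    (nat \<Rightarrow> nat \<Rightarrow> 'a) \<Rightarrow> 'm set \<Rightarrow> 'm set \<Rightarrow> int"
  where "herbrand R S X n A B U W =
    int (the_enat (homology_length R S X n A B U W)) - int (the_enat (homology_length R S X n B A U W))"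

text \<open>The quotient \<open>K/J\<close> is filtered by the image of \<open>K \<inter> P\<close>, which is \<open>(K \<inter> P)/(J \<inter> P)\<close>; the rest is
  \<open>(K + P)/(J + P)\<close>.\<close>

lemma (in module) index_split:
  assumes S: "submonoid S R" and J: "submodule J R M" and K: "submodule K R M" and P: "submodule P R M" and JK: "J \<subseteq> K"
  shows "index R S M K J = index R S M (K \<inter> P) (J \<inter> P) + index R S M (K <+>\<^bsub>M\<^esub> P) (J <+>\<^bsub>M\<^esub> P)"
proof -
  have M: "module R M" ..
  note SR = submonoid.subset[OF S]
  define V where "V = (K \<inter> P) <+>\<^bsub>M\<^esub> J"
  have KP: "submodule (K \<inter> P) R M" and JP: "submodule (J \<inter> P) R M" using submodule_Int J K P by auto
  have V: "submodule V R M" unfolding V_def by (intro submodule_set_add KP J)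
  have JV: "J \<subseteq> V" unfolding V_def using set_add_upper[OF KP J] by blast
  have VK: "V \<subseteq> K" unfolding V_def using JK by (intro set_add_least[OF K]) auto
  have "(J \<inter> P) <+>\<^bsub>M\<^esub> J = J"
    using set_add_least[OF J, of "J \<inter> P" J] set_add_upper[OF JP J] by blast
  then have 1: "index R S M V J = index R S M (K \<inter> P) (J \<inter> P)"
    using index_hom[OF mod_hom_id M M SR JP KP _ J] JK by (auto simp: V_def)
  have "V <+>\<^bsub>M\<^esub> P = J <+>\<^bsub>M\<^esub> P"
  proof
    have JPs: "submodule (J <+>\<^bsub>M\<^esub> P) R M" by (intro submodule_set_add J P)
    have "V \<subseteq> J <+>\<^bsub>M\<^esub> P" unfolding V_def using set_add_upper[OF J P] by (intro set_add_least[OF JPs]) auto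
    then show "V <+>\<^bsub>M\<^esub> P \<subseteq> J <+>\<^bsub>M\<^esub> P" using set_add_upper[OF J P] by (intro set_add_least[OF JPs]) auto
    show "J <+>\<^bsub>M\<^esub> P \<subseteq> V <+>\<^bsub>M\<^esub> P" using JV by (intro set_add_mono) auto
  qed
  moreover have "u \<in> V" if "u \<in> K" "u \<in> P" for u
    using that set_add_upper[OF KP J] unfolding V_def by blast
  ultimately have 2: "index R S M K V = index R S M (K <+>\<^bsub>M\<^esub> P) (J <+>\<^bsub>M\<^esub> P)"
    using index_hom[OF mod_hom_id M M SR V K VK P] by simp
  show ?thesis using index_add[OF S J V K JV VK] 1 2 by (simp add: add.commute)
qed


text \<open>The length of the image of a connecting homomorphism of the exact hexagon for \<open>W \<subseteq> V \<subseteq> U\<close>.\<close>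

definition connecting_length ::
  "('a, 'r) ring_scheme \<Rightarrow> 'a set \<Rightarrow> ('a, 'm, 'c) module_scheme \<Rightarrow> nat \<Rightarrow> (nat \<Rightarrow> nat \<Rightarrow> 'a) \<Rightarrow>
    'm set \<Rightarrow> 'm set \<Rightarrow> 'm set \<Rightarrow> enat"
  where "connecting_length R S X n A U V W =
    index R S (pow_mod X n) (act_im X n A U W \<inter> ({..<n} \<rightarrow>\<^sub>E V)) (act_im X n A V W)"

text \<open>The null-homotopies for the elements of \<open>I\<close> make \<open>I\<close> annihilate the homology of the complex with
  coefficients in any module, which is what makes lengths at \<open>S\<close> finite. They are required at both spots of
  the complex, so that the situation is symmetric in \<open>A\<close> and \<open>B\<close>.\<close>

locale periodic_complex =
  fixes R :: "('a, 'r) ring_scheme" and n :: nat and A B :: "nat \<Rightarrow> nat \<Rightarrow> 'a" and I S :: "'a set"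
  assumes cring: "cring R" and noeth: "noetherian_ring R"
    and A: "A \<in> mats R n" and B: "B \<in> mats R n"
    and AB: "mat_mult R n A B = \<zero>\<^bsub>pow_mod (free_mod R n) n\<^esub>"
    and BA: "mat_mult R n B A = \<zero>\<^bsub>pow_mod (free_mod R n) n\<^esub>"
    and I: "ideal I R" and S: "maximal_mult_set R I S"
    and homotopyA: "\<And>a. a \<in> I \<Longrightarrow> \<exists>Y\<in>mats R n. \<exists>Z\<in>mats R n. a \<odot>\<^bsub>pow_mod (free_mod R n) n\<^esub> id_mat R n =
      mat_mult R n Y B \<oplus>\<^bsub>pow_mod (free_mod R n) n\<^esub> mat_mult R n A Z"
    and homotopyB: "\<And>a. a \<in> I \<Longrightarrow> \<exists>Y\<in>mats R n. \<exists>Z\<in>mats R n. a \<odot>\<^bsub>pow_mod (free_mod R n) n\<^esub> id_mat R n =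
      mat_mult R n Y A \<oplus>\<^bsub>pow_mod (free_mod R n) n\<^esub> mat_mult R n B Z"
begin

lemma swap: "periodic_complex R n B A I S"
  using cring noeth A B AB BA I S homotopyA homotopyB by (intro periodic_complex.intro)

lemma mats_zero_act:
  assumes "module R X" "z \<in> carrier (pow_mod X n)"
  shows "mat_act X n \<zero>\<^bsub>pow_mod (free_mod R n) n\<^esub> z = \<zero>\<^bsub>pow_mod X n\<^esub>"
  by (rule mod_hom_zero[OF mat_act_hom_left[OF assms] module_pow[OF module_free[OF cring]] module_pow[OF assms(1)]])

lemma act_comp_zero:
  assumes "module R X" "z \<in> carrier (pow_mod X n)"
  shows "mat_act X n B (mat_act X n A z) = \<zero>\<^bsub>pow_mod X n\<^esub>"
  using mat_act_assoc[OF cring assms(1) B A assms(2)] mats_zero_act[OF assms] BA by simp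

lemma homotopy_act:
  assumes X: "module R X" and "a \<in> I"
  obtains Y Z where "Y \<in> mats R n" "Z \<in> mats R n"
    "\<And>z. z \<in> carrier (pow_mod X n) \<Longrightarrow> a \<odot>\<^bsub>pow_mod X n\<^esub> z =
      mat_act X n Y (mat_act X n B z) \<oplus>\<^bsub>pow_mod X n\<^esub> mat_act X n A (mat_act X n Z z)"
proof -
  obtain Y Z where YZ: "Y \<in> mats R n" "Z \<in> mats R n" "a \<odot>\<^bsub>pow_mod (free_mod R n) n\<^esub> id_mat R n =
      mat_mult R n Y B \<oplus>\<^bsub>pow_mod (free_mod R n) n\<^esub> mat_mult R n A Z"
    using homotopyA[OF assms(2)] by blast
  have a: "a \<in> carrier R" using assms(2) ideal.Icarr[OF I] by blast
  have mm: "mat_mult R n C D \<in> mats R n" if "C \<in> mats R n" "D \<in> mats R n" for C D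
    using mod_homD(1)[OF mat_act_hom[OF module_free[OF cring] that(1)] that(2)] .
  show thesis
  proof (rule that[OF YZ(1,2)])
    fix z assume z: "z \<in> carrier (pow_mod X n)"
    note h = mod_homD[OF mat_act_hom_left[OF X z]]
    have "a \<odot>\<^bsub>pow_mod X n\<^esub> z = mat_act X n (a \<odot>\<^bsub>pow_mod (free_mod R n) n\<^esub> id_mat R n) z"
      using h(3)[OF a id_mat_closed[OF cring]] mat_act_id[OF X z] by metis
    also have "\<dots> = mat_act X n (mat_mult R n Y B) z \<oplus>\<^bsub>pow_mod X n\<^esub> mat_act X n (mat_mult R n A Z) z"
      unfolding YZ(3) by (rule h(2)[OF mm[OF YZ(1) B] mm[OF A YZ(2)]])
    also have "\<dots> = mat_act X n Y (mat_act X n B z) \<oplus>\<^bsub>pow_mod X n\<^esub> mat_act X n A (mat_act X n Z z)"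
      using mat_act_assoc[OF cring X _ _ z] YZ(1,2) A B by metis
    finally show "a \<odot>\<^bsub>pow_mod X n\<^esub> z =
      mat_act X n Y (mat_act X n B z) \<oplus>\<^bsub>pow_mod X n\<^esub> mat_act X n A (mat_act X n Z z)" .
  qed
qed

context
  fixes X :: "('a, 'x, 'd) module_scheme"
  assumes X: "module R X"
begin

lemma submodule_act_ker:
  assumes "submodule U R X" "submodule W R X"
  shows "submodule (act_ker X n B U W) R (pow_mod X n)"
  unfolding act_ker_def
  by (intro submodule_vimage[OF mat_act_hom[OF X B]] module_pow X submodule_pow assms)

lemma submodule_act_im:
  assumes "submodule U R X" "submodule W R X"
  shows "submodule (act_im X n A U W) R (pow_mod X n)"
  unfolding act_im_def
  by (intro module.submodule_set_add submodule_image[OF mat_act_hom[OF X A]] module_pow X submodule_pow assms)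

lemma act_im_upper:
  assumes "submodule U R X" "submodule W R X"
  shows "mat_act X n A ` ({..<n} \<rightarrow>\<^sub>E U) \<subseteq> act_im X n A U W" "({..<n} \<rightarrow>\<^sub>E W) \<subseteq> act_im X n A U W"
  unfolding act_im_def
  using module.set_add_upper[OF module_pow[OF X] submodule_image[OF mat_act_hom[OF X A] module_pow[OF X] module_pow[OF X]
      submodule_pow[OF X assms(1)]] submodule_pow[OF X assms(2)]] by auto

lemma act_im_subset_ker:
  assumes U: "submodule U R X" and W: "submodule W R X" and "W \<subseteq> U"
  shows "act_im X n A U W \<subseteq> act_ker X n B U W"
  unfolding act_im_def
proof (rule module.set_add_least[OF module_pow[OF X] submodule_act_ker[OF U W]])
  interpret X: module R X by (rule X)
  show "mat_act X n A ` ({..<n} \<rightarrow>\<^sub>E U) \<subseteq> act_ker X n B U W"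
  proof safe
    fix z assume z: "z \<in> {..<n} \<rightarrow>\<^sub>E U"
    then have "z \<in> carrier (pow_mod X n)" using X.submoduleD(1)[OF U] by auto
    then have "mat_act X n B (mat_act X n A z) = \<zero>\<^bsub>pow_mod X n\<^esub>" by (rule act_comp_zero[OF X])
    then show "mat_act X n A z \<in> act_ker X n B U W"
      using mat_act_submodule[OF X U A z] X.submoduleD(3)[OF W] by (auto simp: act_ker_def)
  qed
  show "({..<n} \<rightarrow>\<^sub>E W) \<subseteq> act_ker X n B U W"
    using mat_act_submodule[OF X W B] PiE_mono[of "{..<n}" "\<lambda>_. W" "\<lambda>_. U"] assms(3)
    unfolding act_ker_def by blast
qed

lemma homology_length_finite:
  assumes fg: "fg_module R X" and U: "submodule U R X" and W: "submodule W R X" and "W \<subseteq> U"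
  shows "homology_length R S X n A B U W \<noteq> \<infinity>"
  unfolding homology_length_def
proof (rule index_finite[OF noeth S I fg_pow[OF fg]])
  interpret X: module R X by (rule X)
  show "submodule (act_ker X n B U W) R (pow_mod X n)" by (rule submodule_act_ker[OF U W])
  show "submodule (act_im X n A U W) R (pow_mod X n)" by (rule submodule_act_im[OF U W])
  show "act_im X n A U W \<subseteq> act_ker X n B U W" by (rule act_im_subset_ker[OF U W assms(4)])
  fix a z assume a: "a \<in> I" and z: "z \<in> act_ker X n B U W"
  then have z': "z \<in> {..<n} \<rightarrow>\<^sub>E U" "mat_act X n B z \<in> {..<n} \<rightarrow>\<^sub>E W" by (auto simp: act_ker_def)
  then have zc: "z \<in> carrier (pow_mod X n)" using X.submoduleD(1)[OF U] by auto
  obtain Y Z where YZ: "Y \<in> mats R n" "Z \<in> mats R n" "a \<odot>\<^bsub>pow_mod X n\<^esub> z =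
      mat_act X n Y (mat_act X n B z) \<oplus>\<^bsub>pow_mod X n\<^esub> mat_act X n A (mat_act X n Z z)"
    using homotopy_act[OF X a] zc by metis
  have 1: "mat_act X n Y (mat_act X n B z) \<in> act_im X n A U W"
    using mat_act_submodule[OF X W YZ(1) z'(2)] act_im_upper[OF U W] by blast
  have 2: "mat_act X n A (mat_act X n Z z) \<in> act_im X n A U W"
    using mat_act_submodule[OF X U YZ(2) z'(1)] act_im_upper[OF U W] by blast
  show "a \<odot>\<^bsub>pow_mod X n\<^esub> z \<in> act_im X n A U W"
    unfolding YZ(3) by (rule module.submoduleD(4)[OF module_pow[OF X] submodule_act_im[OF U W] 1 2])
qed

text \<open>The homology of \<open>U/W\<close> is an extension of two pieces, of lengths \<open>\<alpha>\<close> and \<open>\<beta>\<close>: the image of the homology of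
  \<open>V/W\<close>, and the image in the homology of \<open>U/V\<close>. The other two homology modules differ from these pieces by the
  image of a connecting homomorphism.\<close>

lemma homology_length_decomp:
  assumes U: "submodule U R X" and V: "submodule V R X" and W: "submodule W R X" and WV: "W \<subseteq> V" and VU: "V \<subseteq> U"
  shows "\<exists>\<alpha> \<beta>. homology_length R S X n A B U W = \<alpha> + \<beta> \<and>
    homology_length R S X n A B V W = \<alpha> + connecting_length R S X n A U V W \<and>
    homology_length R S X n A B U V =
      index R S (pow_mod X n) (act_ker X n B U V)
        (act_ker X n B U W <+>\<^bsub>pow_mod X n\<^esub> ({..<n} \<rightarrow>\<^sub>E V)) + \<beta>"
proof -
  interpret X: module R X by (rule X)
  interpret P: module R "pow_mod X n" by (rule module_pow[OF X])
  note S' = maximal_mult_setD(1)[OF S]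
  have WU: "W \<subseteq> U" using WV VU by blast
  let ?K = "act_ker X n B U W" and ?J = "act_im X n A U W" and ?P = "{..<n} \<rightarrow>\<^sub>E V"
  let ?ix = "index R S (pow_mod X n)"
  note K = submodule_act_ker[OF U W] and J = submodule_act_im[OF U W] and P = submodule_pow[OF X V, of n]
  have PU: "?P \<subseteq> ({..<n} \<rightarrow>\<^sub>E U)" using VU by (intro PiE_mono) auto
  have WP: "({..<n} \<rightarrow>\<^sub>E W) \<subseteq> ?P" using WV by (intro PiE_mono) auto
  have KV: "act_ker X n B V W = ?K \<inter> ?P" using PU unfolding act_ker_def by blast
  have JV: "act_im X n A U V = ?J <+>\<^bsub>pow_mod X n\<^esub> ?P"
  proof
    show "act_im X n A U V \<subseteq> ?J <+>\<^bsub>pow_mod X n\<^esub> ?P"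
      unfolding act_im_def[of X n A U V] by (intro set_add_mono act_im_upper[OF U W]) auto
    have "?J \<subseteq> act_im X n A U V" unfolding act_im_def using WP by (intro set_add_mono) auto
    then show "?J <+>\<^bsub>pow_mod X n\<^esub> ?P \<subseteq> act_im X n A U V"
      by (intro P.set_add_least[OF submodule_act_im[OF U V]] act_im_upper[OF U V])
  qed
  have JJ: "act_im X n A V W \<subseteq> ?J \<inter> ?P"
  proof -
    have "act_im X n A V W \<subseteq> ?J" unfolding act_im_def using PU by (intro set_add_mono image_mono) auto
    moreover have "act_im X n A V W \<subseteq> ?P" 
      unfolding act_im_def using WP mat_act_submodule[OF X V A] by (intro P.set_add_least[OF P]) auto
    ultimately show ?thesis by blast
  qed
  have KK: "?K <+>\<^bsub>pow_mod X n\<^esub> ?P \<subseteq> act_ker X n B U V"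
  proof (rule P.set_add_least[OF submodule_act_ker[OF U V]])
    show "?K \<subseteq> act_ker X n B U V" using WP unfolding act_ker_def by blast
    show "?P \<subseteq> act_ker X n B U V" using act_im_upper(2)[OF U V] act_im_subset_ker[OF U V VU] by blast
  qed
  have 1: "homology_length R S X n A B U W = ?ix (?K \<inter> ?P) (?J \<inter> ?P) + ?ix (?K <+>\<^bsub>pow_mod X n\<^esub> ?P) (?J <+>\<^bsub>pow_mod X n\<^esub> ?P)"
    unfolding homology_length_def by (rule P.index_split[OF S' J K P act_im_subset_ker[OF U W WU]])
  have 2: "homology_length R S X n A B V W = ?ix (?K \<inter> ?P) (?J \<inter> ?P) + connecting_length R S X n A U V W"
    unfolding homology_length_def connecting_length_def KV
    using act_im_subset_ker[OF U W WU]
    by (intro P.index_add S' submodule_act_im[OF V W] P.submodule_Int J K P JJ) auto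
  have "?J <+>\<^bsub>pow_mod X n\<^esub> ?P \<subseteq> ?K <+>\<^bsub>pow_mod X n\<^esub> ?P"
    by (intro set_add_mono act_im_subset_ker[OF U W WU]) auto
  then have 3: "homology_length R S X n A B U V = ?ix (act_ker X n B U V) (?K <+>\<^bsub>pow_mod X n\<^esub> ?P) +
      ?ix (?K <+>\<^bsub>pow_mod X n\<^esub> ?P) (?J <+>\<^bsub>pow_mod X n\<^esub> ?P)"
    unfolding homology_length_def JV
    by (intro P.index_add S' P.submodule_set_add submodule_act_ker[OF U V] J K P KK)
  show ?thesis using 1 2 3 by blast
qed

text \<open>The map \<open>A\<close> sends cycles of \<open>U/V\<close> into \<open>V/W\<close>. This is the connecting homomorphism: its image is counted on
  the left, and the cycles modulo its kernel are counted on the right.\<close>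

lemma connecting_length_eq:
  assumes U: "submodule U R X" and V: "submodule V R X" and W: "submodule W R X" and WV: "W \<subseteq> V" and VU: "V \<subseteq> U"
  shows "connecting_length R S X n A U V W = index R S (pow_mod X n) (act_ker X n A U V)
        (act_ker X n A U W <+>\<^bsub>pow_mod X n\<^esub> ({..<n} \<rightarrow>\<^sub>E V))"
proof -
  interpret sw: periodic_complex R n B A I S by (rule swap)
  interpret X: module R X by (rule X)
  have PX: "module R (pow_mod X n)" by (rule module_pow[OF X])
  interpret P: module R "pow_mod X n" by (rule PX)
  let ?P = "{..<n} \<rightarrow>\<^sub>E V" and ?Q = "{..<n} \<rightarrow>\<^sub>E W" and ?f = "mat_act X n A"
  have f: "?f \<in> mod_hom R (pow_mod X n) (pow_mod X n)" by (rule mat_act_hom[OF X A])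
  note KV = sw.submodule_act_ker[OF X U V] and K = sw.submodule_act_ker[OF X U W]
    and P = submodule_pow[OF X V, of n] and P0 = submodule_pow[OF X W, of n]
  have WP: "?Q \<subseteq> ?P" using WV by (intro PiE_mono) auto
  have PU: "?P \<subseteq> ({..<n} \<rightarrow>\<^sub>E U)" using VU by (intro PiE_mono) auto
  have Ks: "submodule (act_ker X n A U W <+>\<^bsub>pow_mod X n\<^esub> ?P) R (pow_mod X n)" by (intro P.submodule_set_add K P)
  have sub: "act_ker X n A U W <+>\<^bsub>pow_mod X n\<^esub> ?P \<subseteq> act_ker X n A U V"
  proof (rule P.set_add_least[OF KV])
    show "act_ker X n A U W \<subseteq> act_ker X n A U V" using WP unfolding act_ker_def by blast
    show "?P \<subseteq> act_ker X n A U V" using mat_act_submodule[OF X V A] PU unfolding act_ker_def by blast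
  qed
  have ker: "u \<in> act_ker X n A U W <+>\<^bsub>pow_mod X n\<^esub> ?P" if "u \<in> act_ker X n A U V" "?f u \<in> ?Q" for u
    using that P.set_add_upper[OF K P] by (auto simp: act_ker_def)
  have im1: "?f ` act_ker X n A U V <+>\<^bsub>pow_mod X n\<^esub> ?Q = act_im X n A U W \<inter> ?P"
  proof
    have "?f ` act_ker X n A U V \<subseteq> act_im X n A U W \<inter> ?P"
    proof
      fix y assume "y \<in> ?f ` act_ker X n A U V"
      then have "y \<in> ?f ` ({..<n} \<rightarrow>\<^sub>E U)" "y \<in> ?P" unfolding act_ker_def by blast+
      then show "y \<in> act_im X n A U W \<inter> ?P" using act_im_upper(1)[OF U W] by blast
    qed
    then show "?f ` act_ker X n A U V <+>\<^bsub>pow_mod X n\<^esub> ?Q \<subseteq> act_im X n A U W \<inter> ?P"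
      using act_im_upper(2)[OF U W] WP
      by (intro P.set_add_least P.submodule_Int submodule_act_im[OF U W] P) blast+
    show "act_im X n A U W \<inter> ?P \<subseteq> ?f ` act_ker X n A U V <+>\<^bsub>pow_mod X n\<^esub> ?Q"
    proof
      fix y assume y: "y \<in> act_im X n A U W \<inter> ?P"
      then have "y \<in> act_im X n A U W" by (rule IntD1)
      then obtain z w where z: "z \<in> {..<n} \<rightarrow>\<^sub>E U" "w \<in> ?Q" "y = ?f z \<oplus>\<^bsub>pow_mod X n\<^esub> w"
        unfolding act_im_def P.mem_set_add by blast
      have c: "?f z \<in> carrier (pow_mod X n)" "w \<in> carrier (pow_mod X n)"
        using P.submoduleD(2)[OF submodule_pow[OF X U] mat_act_submodule[OF X U A z(1)]] P.submoduleD(2)[OF P0 z(2)] .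
      have "?f z = y \<ominus>\<^bsub>pow_mod X n\<^esub> w" unfolding z(3) using P.M.add_minus_cancel(2)[OF c] by simp
      then have "?f z \<in> ?P" using P.submoduleD(5)[OF P, of y w] y z(2) WP by (simp only:) blast
      then have "z \<in> act_ker X n A U V" using z(1) by (simp add: act_ker_def)
      then show "y \<in> ?f ` act_ker X n A U V <+>\<^bsub>pow_mod X n\<^esub> ?Q" using z unfolding P.mem_set_add by blast
    qed
  qed
  have im2: "?f ` (act_ker X n A U W <+>\<^bsub>pow_mod X n\<^esub> ?P) <+>\<^bsub>pow_mod X n\<^esub> ?Q = act_im X n A V W"
  proof
    have "?f ` (act_ker X n A U W <+>\<^bsub>pow_mod X n\<^esub> ?P) \<subseteq> act_im X n A V W"
    proof safe
      fix u assume "u \<in> act_ker X n A U W <+>\<^bsub>pow_mod X n\<^esub> ?P"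
      then obtain k v where kv: "k \<in> act_ker X n A U W" "v \<in> ?P" "u = k \<oplus>\<^bsub>pow_mod X n\<^esub> v"
        unfolding P.mem_set_add by blast
      then have c: "k \<in> carrier (pow_mod X n)" "v \<in> carrier (pow_mod X n)"
        using P.submoduleD(2)[OF K] P.submoduleD(2)[OF P] by blast+
      have "?f u = ?f k \<oplus>\<^bsub>pow_mod X n\<^esub> ?f v" unfolding kv(3) by (rule mod_homD(2)[OF f c])
      moreover have "?f k \<in> act_im X n A V W" using kv(1) act_im_upper(2)[OF V W] by (auto simp: act_ker_def)
      moreover have "?f v \<in> act_im X n A V W" using kv(2) act_im_upper(1)[OF V W] by blast
      ultimately show "?f u \<in> act_im X n A V W" using P.submoduleD(4)[OF submodule_act_im[OF V W]] by metis
    qed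
    then show "?f ` (act_ker X n A U W <+>\<^bsub>pow_mod X n\<^esub> ?P) <+>\<^bsub>pow_mod X n\<^esub> ?Q \<subseteq> act_im X n A V W"
      by (intro P.set_add_least[OF submodule_act_im[OF V W]] act_im_upper[OF V W])
    show "act_im X n A V W \<subseteq> ?f ` (act_ker X n A U W <+>\<^bsub>pow_mod X n\<^esub> ?P) <+>\<^bsub>pow_mod X n\<^esub> ?Q"
      unfolding act_im_def by (intro set_add_mono image_mono P.set_add_upper[OF K P] order_refl)
  qed
  show ?thesis
    using index_hom[OF f PX PX maximal_mult_setD(2)[OF S] Ks KV sub P0 ker]
    unfolding im1 im2 connecting_length_def .
qed

end

lemma homology_length_eq_0_iff:
  assumes X: "module R X" and U: "submodule U R X" and W: "submodule W R X" and WU: "W \<subseteq> U"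
  shows "homology_length R S X n A B U W = 0 \<longleftrightarrow>
    negligible S (pow_mod X n) (act_ker X n B U W) (act_im X n A U W)"
  unfolding homology_length_def
  by (rule index_eq_0_iff[OF submodule_act_im[OF X U W] submodule_act_ker[OF X U W] act_im_subset_ker[OF X U W WU]])

lemma homology_length_eq_0:
  assumes X: "module R X" and U: "submodule U R X" and W: "submodule W R X" and WU: "W \<subseteq> U"
    and "act_ker X n B U W \<subseteq> act_im X n A U W"
  shows "homology_length R S X n A B U W = 0"
  unfolding homology_length_eq_0_iff[OF X U W WU] negligible_def
  using assms(5) maximal_mult_setD(2,3)[OF S]
    module.submoduleD(6)[OF module_pow[OF X] submodule_act_im[OF X U W]] by blast

text \<open>The exact hexagon in homology, counted: the two connecting lengths cancel.\<close>

lemma herbrand_add: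
  assumes fg: "fg_module R X" and U: "submodule U R X" and V: "submodule V R X" and W: "submodule W R X"
    and WV: "W \<subseteq> V" and VU: "V \<subseteq> U"
  shows "herbrand R S X n A B U W = herbrand R S X n A B U V + herbrand R S X n A B V W"
proof -
  interpret sw: periodic_complex R n B A I S by (rule swap)
  have X: "module R X" using fg by (simp add: fg_module_def)
  have WU: "W \<subseteq> U" using WV VU by blast
  obtain \<alpha> \<beta> where 1: "homology_length R S X n A B U W = \<alpha> + \<beta>"
    "homology_length R S X n A B V W = \<alpha> + connecting_length R S X n A U V W"
    "homology_length R S X n A B U V = connecting_length R S X n B U V W + \<beta>"
    using homology_length_decomp[OF X U V W WV VU] unfolding sw.connecting_length_eq[OF X U V W WV VU] by blast
  obtain \<alpha>' \<beta>' where 2: "homology_length R S X n B A U W = \<alpha>' + \<beta>'"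
    "homology_length R S X n B A V W = \<alpha>' + connecting_length R S X n B U V W"
    "homology_length R S X n B A U V = connecting_length R S X n A U V W + \<beta>'"
    using sw.homology_length_decomp[OF X U V W WV VU] unfolding connecting_length_eq[OF X U V W WV VU] by blast
  have "\<alpha> + \<beta> \<noteq> \<infinity>" "\<alpha>' + \<beta>' \<noteq> \<infinity>" "\<alpha> + connecting_length R S X n A U V W \<noteq> \<infinity>" "\<alpha>' + connecting_length R S X n B U V W \<noteq> \<infinity>"
    using homology_length_finite[OF X fg U W WU] sw.homology_length_finite[OF X fg U W WU]
      homology_length_finite[OF X fg V W WV] sw.homology_length_finite[OF X fg V W WV] 1 2 by simp_all
  then obtain a b a' b' c c' where "\<alpha> = enat a" "\<beta> = enat b" "\<alpha>' = enat a'" "\<beta>' = enat b'"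
    "connecting_length R S X n A U V W = enat c" "connecting_length R S X n B U V W = enat c'"
    by (auto simp: plus_eq_infty_iff_enat)
  then show ?thesis unfolding herbrand_def 1 2 by simp
qed

text \<open>Being killed by \<open>I\<close>, the module \<open>U/W\<close> has finite length at \<open>S\<close>. Counting kernels and images of \<open>A\<close> and \<open>B\<close>
  on \<open>(U/W)\<^sup>n\<close> then gives the same length for both homology modules.\<close>

lemma herbrand_finite_length:
  assumes fg: "fg_module R X" and U: "submodule U R X" and W: "submodule W R X" and WU: "W \<subseteq> U"
    and fin: "\<And>a u. a \<in> I \<Longrightarrow> u \<in> U \<Longrightarrow> a \<odot>\<^bsub>X\<^esub> u \<in> W"
  shows "herbrand R S X n A B U W = 0"
proof -
  interpret sw: periodic_complex R n B A I S by (rule swap)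
  have X: "module R X" using fg by (simp add: fg_module_def)
  interpret X: module R X by (rule X)
  have PX: "module R (pow_mod X n)" by (rule module_pow[OF X])
  interpret P: module R "pow_mod X n" by (rule PX)
  let ?P = "{..<n} \<rightarrow>\<^sub>E U" and ?Q = "{..<n} \<rightarrow>\<^sub>E W"
  let ?ix = "index R S (pow_mod X n)"
  note P = submodule_pow[OF X U, of n] and P0 = submodule_pow[OF X W, of n]
  note S' = maximal_mult_setD[OF S]
  have sub: "?Q \<subseteq> ?P" using WU by (intro PiE_mono) auto
  have finP: "?ix ?P ?Q \<noteq> \<infinity>"
    using fin by (intro index_finite[OF noeth S I fg_pow[OF fg] P P0 sub]) (auto simp: PiE_iff)
  have half: "?ix ?P ?Q = homology_length R S X n B' A' U W + ?ix (act_im X n B' U W) ?Q + ?ix (act_im X n A' U W) ?Q"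
    if "periodic_complex R n A' B' I S" for A' B'
  proof -
    interpret c: periodic_complex R n A' B' I S by fact
    interpret c': periodic_complex R n B' A' I S by (rule c.swap)
    let ?K = "act_ker X n A' U W"
    note K = c'.submodule_act_ker[OF X U W] and J = c'.submodule_act_im[OF X U W]
    have f: "mat_act X n A' \<in> mod_hom R (pow_mod X n) (pow_mod X n)" by (rule mat_act_hom[OF X c.A])
    have KP: "?K \<subseteq> ?P" by (auto simp: act_ker_def)
    have P0J: "?Q \<subseteq> act_im X n B' U W" by (rule c'.act_im_upper[OF X U W])
    have JK: "act_im X n B' U W \<subseteq> ?K" by (rule c'.act_im_subset_ker[OF X U W WU])
    have "mat_act X n A' ` ?K <+>\<^bsub>pow_mod X n\<^esub> ?Q = ?Q"
    proof
      show "mat_act X n A' ` ?K <+>\<^bsub>pow_mod X n\<^esub> ?Q \<subseteq> ?Q"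
        by (rule P.set_add_least[OF P0]) (auto simp: act_ker_def)
      show "?Q \<subseteq> mat_act X n A' ` ?K <+>\<^bsub>pow_mod X n\<^esub> ?Q"
        by (rule P.set_add_upper[OF submodule_image[OF f PX PX K] P0])
    qed
    then have "?ix (act_im X n A' U W) ?Q = ?ix ?P ?K"
      using index_hom[OF f PX PX S'(2) K P KP P0] by (auto simp: act_im_def act_ker_def)
    moreover have "?ix ?P ?Q = ?ix ?P ?K + ?ix ?K ?Q"
      using P0J JK by (intro P.index_add S' P0 K P KP) auto
    moreover have "?ix ?K ?Q = homology_length R S X n B' A' U W + ?ix (act_im X n B' U W) ?Q"
      unfolding homology_length_def by (intro P.index_add S' P0 K J P0J JK)
    ultimately show ?thesis by (simp add: add.commute add.left_commute)
  qed
  note h1 = half[OF periodic_complex_axioms] and h2 = half[OF swap]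
  note fin' = finP[unfolded h1] finP[unfolded h2]
  from fin' obtain a b c d where "homology_length R S X n B A U W = enat a" "?ix (act_im X n B U W) ?Q = enat b"
    "?ix (act_im X n A U W) ?Q = enat c" "homology_length R S X n A B U W = enat d"
    by (auto simp: plus_eq_infty_iff_enat)
  moreover from this have "a = d" using h1 h2 by simp
  ultimately show ?thesis by (simp add: herbrand_def)
qed

end

definition pow_map :: "nat \<Rightarrow> ('m \<Rightarrow> 'n) \<Rightarrow> (nat \<Rightarrow> 'm) \<Rightarrow> nat \<Rightarrow> 'n"
  where "pow_map n f z = (\<lambda>i\<in>{..<n}. f (z i))"

lemma pow_map_hom:
  assumes f: "f \<in> mod_hom R X Y" and X: "module R X"
  shows "pow_map n f \<in> mod_hom R (pow_mod X n) (pow_mod Y n)"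
proof -
  interpret X: module R X by fact
  show ?thesis using mod_homD[OF f] by (auto simp: mod_hom_iff pow_map_def fun_eq_iff PiE_iff)
qed

lemma pow_map_image: "pow_map n f ` ({..<n} \<rightarrow>\<^sub>E U) = {..<n} \<rightarrow>\<^sub>E (f ` U)"
proof
  show "pow_map n f ` ({..<n} \<rightarrow>\<^sub>E U) \<subseteq> {..<n} \<rightarrow>\<^sub>E (f ` U)"
  proof
    fix y assume "y \<in> pow_map n f ` ({..<n} \<rightarrow>\<^sub>E U)"
    then obtain z where z: "z \<in> {..<n} \<rightarrow>\<^sub>E U" "y = pow_map n f z" by blast
    have "f (z i) \<in> f ` U" if "i \<in> {..<n}" for i using PiE_mem[OF z(1) that] by (rule imageI)
    then show "y \<in> {..<n} \<rightarrow>\<^sub>E (f ` U)" unfolding z(2) pow_map_def by (intro PiE_I) simp_all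
  qed
  show "{..<n} \<rightarrow>\<^sub>E (f ` U) \<subseteq> pow_map n f ` ({..<n} \<rightarrow>\<^sub>E U)"
  proof
    fix y assume y: "y \<in> {..<n} \<rightarrow>\<^sub>E (f ` U)"
    have "\<forall>i\<in>{..<n}. \<exists>u\<in>U. y i = f u"
    proof
      fix i assume "i \<in> {..<n}"
      then have "y i \<in> f ` U" using y by (rule PiE_mem[rotated])
      then show "\<exists>u\<in>U. y i = f u" by blast
    qed
    then obtain u where u: "\<And>i. i < n \<Longrightarrow> u i \<in> U \<and> y i = f (u i)" by (metis lessThan_iff)
    have "y = pow_map n f (\<lambda>i\<in>{..<n}. u i)"
      using u PiE_arb[OF y] by (auto simp: pow_map_def fun_eq_iff)
    then show "y \<in> pow_map n f ` ({..<n} \<rightarrow>\<^sub>E U)" using u by (auto intro!: image_eqI)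
  qed
qed

context periodic_complex
begin

lemma homology_length_hom:
  assumes X: "module R X" and Y: "module R Y" and f: "f \<in> mod_hom R X Y"
    and U: "submodule U R X" and W: "submodule W R X" and WU: "W \<subseteq> U"
    and ker: "\<And>u. u \<in> U \<Longrightarrow> f u = \<zero>\<^bsub>Y\<^esub> \<Longrightarrow> u \<in> W"
  shows "homology_length R S Y n A B (f ` U) (f ` W) = homology_length R S X n A B U W"
proof -
  interpret X: module R X by (rule X)
  interpret Y: module R Y by (rule Y)
  have PX: "module R (pow_mod X n)" and PY: "module R (pow_mod Y n)" using module_pow X Y by auto
  interpret PX: module R "pow_mod X n" by (rule PX)
  interpret PY: module R "pow_mod Y n" by (rule PY)
  let ?F = "pow_map n f"
  have F: "?F \<in> mod_hom R (pow_mod X n) (pow_mod Y n)" by (rule pow_map_hom[OF f X])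
  have nat: "mat_act Y n C (?F z) = ?F (mat_act X n C z)" if "C \<in> mats R n" "z \<in> {..<n} \<rightarrow>\<^sub>E U" for C z
    unfolding pow_map_def using that X.submoduleD(2)[OF U] by (intro mat_act_natural[OF f X Y]) auto
  note K = submodule_act_ker[OF X U W] and J = submodule_act_im[OF X U W]
  have imJ: "?F ` act_im X n A U W = act_im Y n A (f ` U) (f ` W)"
  proof -
    have c1: "mat_act X n A z \<in> carrier (pow_mod X n)" if "z \<in> {..<n} \<rightarrow>\<^sub>E U" for z
      using mat_act_submodule[OF X U A that] PX.submoduleD(2)[OF submodule_pow[OF X U]] by blast
    have c2: "w \<in> carrier (pow_mod X n)" if "w \<in> {..<n} \<rightarrow>\<^sub>E W" for w
      using that PX.submoduleD(2)[OF submodule_pow[OF X W]] by blast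
    have "act_im Y n A (f ` U) (f ` W) =
        mat_act Y n A ` (?F ` ({..<n} \<rightarrow>\<^sub>E U)) <+>\<^bsub>pow_mod Y n\<^esub> ?F ` ({..<n} \<rightarrow>\<^sub>E W)"
      by (simp only: act_im_def pow_map_image)
    also have "mat_act Y n A ` (?F ` ({..<n} \<rightarrow>\<^sub>E U)) = ?F ` (mat_act X n A ` ({..<n} \<rightarrow>\<^sub>E U))"
      unfolding image_image using nat[OF A] by (intro image_cong refl)
    also have "?F ` (mat_act X n A ` ({..<n} \<rightarrow>\<^sub>E U)) <+>\<^bsub>pow_mod Y n\<^esub> ?F ` ({..<n} \<rightarrow>\<^sub>E W) = ?F ` act_im X n A U W"
    proof (intro subset_antisym subsetI)
      fix y assume "y \<in> ?F ` (mat_act X n A ` ({..<n} \<rightarrow>\<^sub>E U)) <+>\<^bsub>pow_mod Y n\<^esub> ?F ` ({..<n} \<rightarrow>\<^sub>E W)"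
      then obtain z w where zw: "z \<in> {..<n} \<rightarrow>\<^sub>E U" "w \<in> {..<n} \<rightarrow>\<^sub>E W" "y = ?F (mat_act X n A z) \<oplus>\<^bsub>pow_mod Y n\<^esub> ?F w"
        unfolding PY.mem_set_add by blast
      then have "y = ?F (mat_act X n A z \<oplus>\<^bsub>pow_mod X n\<^esub> w)"
        using mod_homD(2)[OF F c1 c2] by metis
      moreover have "mat_act X n A z \<oplus>\<^bsub>pow_mod X n\<^esub> w \<in> act_im X n A U W"
        unfolding act_im_def PX.mem_set_add using zw(1,2) by blast
      ultimately show "y \<in> ?F ` act_im X n A U W" by blast
    next
      fix y assume "y \<in> ?F ` act_im X n A U W"
      then obtain j where "j \<in> act_im X n A U W" "y = ?F j" by blast
      then obtain z w where zw: "z \<in> {..<n} \<rightarrow>\<^sub>E U" "w \<in> {..<n} \<rightarrow>\<^sub>E W" "y = ?F (mat_act X n A z \<oplus>\<^bsub>pow_mod X n\<^esub> w)"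
        unfolding act_im_def PX.mem_set_add by blast
      then have "y = ?F (mat_act X n A z) \<oplus>\<^bsub>pow_mod Y n\<^esub> ?F w" using mod_homD(2)[OF F c1 c2] by metis
      then show "y \<in> ?F ` (mat_act X n A ` ({..<n} \<rightarrow>\<^sub>E U)) <+>\<^bsub>pow_mod Y n\<^esub> ?F ` ({..<n} \<rightarrow>\<^sub>E W)"
        unfolding PY.mem_set_add using zw(1,2) by blast
    qed
    finally show ?thesis by simp
  qed
  have imK: "?F ` act_ker X n B U W = act_ker Y n B (f ` U) (f ` W)"
  proof (intro subset_antisym subsetI)
    fix y assume "y \<in> ?F ` act_ker X n B U W"
    then obtain z where z: "z \<in> act_ker X n B U W" "y = ?F z" by blast
    then have z': "z \<in> {..<n} \<rightarrow>\<^sub>E U" "mat_act X n B z \<in> {..<n} \<rightarrow>\<^sub>E W" by (simp_all add: act_ker_def)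
    have "?F z \<in> {..<n} \<rightarrow>\<^sub>E (f ` U)" "?F (mat_act X n B z) \<in> {..<n} \<rightarrow>\<^sub>E (f ` W)"
      unfolding pow_map_image[symmetric] by (rule imageI[OF z'(1)], rule imageI[OF z'(2)])
    then show "y \<in> act_ker Y n B (f ` U) (f ` W)"
      unfolding act_ker_def z(2) nat[OF B z'(1), symmetric] by simp
  next
    fix y assume y: "y \<in> act_ker Y n B (f ` U) (f ` W)"
    then have "y \<in> ?F ` ({..<n} \<rightarrow>\<^sub>E U)" unfolding act_ker_def pow_map_image by simp
    then obtain z where z: "z \<in> {..<n} \<rightarrow>\<^sub>E U" "y = ?F z" by blast
    have BzU: "mat_act X n B z \<in> {..<n} \<rightarrow>\<^sub>E U" by (rule mat_act_submodule[OF X U B z(1)])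
    have Bz: "?F (mat_act X n B z) \<in> {..<n} \<rightarrow>\<^sub>E (f ` W)"
      using y nat[OF B z(1)] unfolding act_ker_def z(2) by simp
    have "mat_act X n B z i \<in> W" if i: "i < n" for i
    proof -
      have "f (mat_act X n B z i) \<in> f ` W" using Bz i by (auto simp: pow_map_def PiE_iff)
      then obtain w where w: "w \<in> W" "f (mat_act X n B z i) = f w" by auto
      have u: "mat_act X n B z i \<in> U" using BzU i by (auto simp: PiE_iff)
      have c: "mat_act X n B z i \<in> carrier X" "w \<in> carrier X" using u w(1) X.submoduleD(2)[OF U] X.submoduleD(2)[OF W] by auto
      have "f (mat_act X n B z i \<ominus>\<^bsub>X\<^esub> w) = \<zero>\<^bsub>Y\<^esub>"
        using mod_hom_minus[OF f X Y c] w(2) mod_homD(1)[OF f c(2)] by (simp add: a_minus_def Y.M.r_neg)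
      then have "mat_act X n B z i \<ominus>\<^bsub>X\<^esub> w \<in> W" using ker u w(1) WU X.submoduleD(5)[OF U] by blast
      then have "(mat_act X n B z i \<ominus>\<^bsub>X\<^esub> w) \<oplus>\<^bsub>X\<^esub> w \<in> W" using X.submoduleD(4)[OF W] w(1) by blast
      then show ?thesis using X.M.add_minus_cancel(3)[OF c] by simp
    qed
    then have "z \<in> act_ker X n B U W" unfolding act_ker_def using z(1) BzU by (auto simp: PiE_iff)
    then show "y \<in> ?F ` act_ker X n B U W" using z(2) by blast
  qed
  have sub: "act_im X n A U W \<subseteq> act_ker X n B U W" by (rule act_im_subset_ker[OF X U W WU])
  have kerF: "z \<in> act_im X n A U W" if "z \<in> act_ker X n B U W" "?F z \<in> {\<zero>\<^bsub>pow_mod Y n\<^esub>}" for z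
  proof -
    have z: "z \<in> {..<n} \<rightarrow>\<^sub>E U" using that(1) by (simp add: act_ker_def)
    have "f (z i) = \<zero>\<^bsub>Y\<^esub>" if "i < n" for i
    proof -
      have "?F z i = \<zero>\<^bsub>Y\<^esub>" using \<open>?F z \<in> {\<zero>\<^bsub>pow_mod Y n\<^esub>}\<close> that by simp
      then show ?thesis using that by (simp add: pow_map_def)
    qed
    then have "z \<in> {..<n} \<rightarrow>\<^sub>E W" using z ker by (auto simp: PiE_iff)
    then show ?thesis using act_im_upper(2)[OF X U W] by blast
  qed
  have "index R S (pow_mod Y n) (?F ` act_ker X n B U W <+>\<^bsub>pow_mod Y n\<^esub> {\<zero>\<^bsub>pow_mod Y n\<^esub>})
      (?F ` act_im X n A U W <+>\<^bsub>pow_mod Y n\<^esub> {\<zero>\<^bsub>pow_mod Y n\<^esub>}) = homology_length R S X n A B U W"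
    unfolding homology_length_def
    by (rule index_hom[OF F PX PY maximal_mult_setD(2)[OF S] J K sub PY.submodule_zero kerF])
  then show ?thesis
    unfolding PY.set_add_zero[OF submodule_image[OF F PX PY K]] PY.set_add_zero[OF submodule_image[OF F PX PY J]]
    unfolding imJ imK homology_length_def .
qed

lemma herbrand_hom:
  assumes "module R X" "module R Y" "f \<in> mod_hom R X Y"
    and "submodule U R X" "submodule W R X" "W \<subseteq> U" "\<And>u. u \<in> U \<Longrightarrow> f u = \<zero>\<^bsub>Y\<^esub> \<Longrightarrow> u \<in> W"
  shows "herbrand R S Y n A B (f ` U) (f ` W) = herbrand R S X n A B U W"
  unfolding herbrand_def
  using homology_length_hom[OF assms] periodic_complex.homology_length_hom[OF swap assms] by simp

lemma herbrand_iso: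
  assumes X: "module R X" and Y: "module R Y" and iso: "mod_iso R X Y"
  shows "herbrand R S Y n A B (carrier Y) {\<zero>\<^bsub>Y\<^esub>} = herbrand R S X n A B (carrier X) {\<zero>\<^bsub>X\<^esub>}"
proof -
  interpret X: module R X by (rule X)
  obtain f where f: "f \<in> mod_hom R X Y" "bij_betw f (carrier X) (carrier Y)" using iso by (auto simp: mod_iso_def)
  have z: "f \<zero>\<^bsub>X\<^esub> = \<zero>\<^bsub>Y\<^esub>" by (rule mod_hom_zero[OF f(1) X Y])
  have "herbrand R S Y n A B (f ` carrier X) (f ` {\<zero>\<^bsub>X\<^esub>}) = herbrand R S X n A B (carrier X) {\<zero>\<^bsub>X\<^esub>}"
  proof (rule herbrand_hom[OF X Y f(1) X.carrier_is_submodule X.submodule_zero])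
    fix u assume "u \<in> carrier X" "f u = \<zero>\<^bsub>Y\<^esub>"
    then show "u \<in> {\<zero>\<^bsub>X\<^esub>}" using inj_onD[OF bij_betw_imp_inj_on[OF f(2)], of u "\<zero>\<^bsub>X\<^esub>"] z by simp
  qed simp
  then show ?thesis using z f(2) by (simp add: bij_betw_def)
qed

lemma herbrand_short_exact:
  assumes fg: "fg_module R X" and Y: "module R Y" and Z: "module R Z" and ex: "short_exact R Y f X g Z"
  shows "herbrand R S X n A B (carrier X) {\<zero>\<^bsub>X\<^esub>} =
    herbrand R S Y n A B (carrier Y) {\<zero>\<^bsub>Y\<^esub>} + herbrand R S Z n A B (carrier Z) {\<zero>\<^bsub>Z\<^esub>}"
proof -
  have X: "module R X" using fg by (simp add: fg_module_def)
  interpret X: module R X by (rule X)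
  interpret Y: module R Y by (rule Y)
  interpret Z: module R Z by (rule Z)
  have f: "f \<in> mod_hom R Y X" and g: "g \<in> mod_hom R X Z" and inj: "inj_on f (carrier Y)"
    and im: "f ` carrier Y = a_kernel X Z g" and surj: "g ` carrier X = carrier Z"
    using ex by (auto simp: short_exact_def)
  let ?V = "f ` carrier Y"
  have V: "submodule ?V R X" by (rule submodule_image[OF f Y X Y.carrier_is_submodule])
  have V_ker: "?V = {x \<in> carrier X. g x = \<zero>\<^bsub>Z\<^esub>}" using im by (simp add: a_kernel_def kernel_def)
  have sub: "{\<zero>\<^bsub>X\<^esub>} \<subseteq> ?V" "?V \<subseteq> carrier X" using X.submoduleD[OF V] by auto
  have "herbrand R S X n A B (carrier X) {\<zero>\<^bsub>X\<^esub>} =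
      herbrand R S X n A B (carrier X) ?V + herbrand R S X n A B ?V {\<zero>\<^bsub>X\<^esub>}"
    by (rule herbrand_add[OF fg X.carrier_is_submodule V X.submodule_zero sub])
  also have "herbrand R S X n A B (carrier X) ?V = herbrand R S Z n A B (g ` carrier X) (g ` ?V)"
    using V_ker by (intro herbrand_hom[symmetric] X Z g X.carrier_is_submodule V sub) auto
  also have "g ` ?V = {\<zero>\<^bsub>Z\<^esub>}" using V_ker mod_hom_zero[OF g X Z] by auto
  also have "herbrand R S X n A B ?V {\<zero>\<^bsub>X\<^esub>} = herbrand R S X n A B ?V (f ` {\<zero>\<^bsub>Y\<^esub>})"
    using mod_hom_zero[OF f Y X] by simp
  also have "\<dots> = herbrand R S Y n A B (carrier Y) {\<zero>\<^bsub>Y\<^esub>}"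
  proof (rule herbrand_hom[OF Y X f Y.carrier_is_submodule Y.submodule_zero])
    fix u assume "u \<in> carrier Y" "f u = \<zero>\<^bsub>X\<^esub>"
    then show "u \<in> {\<zero>\<^bsub>Y\<^esub>}" using inj_onD[OF inj, of u "\<zero>\<^bsub>Y\<^esub>"] mod_hom_zero[OF f Y X] by simp
  qed simp
  finally show ?thesis using surj by simp
qed

end


section \<open>Square matrices over a ring\<close>

definition row_act :: "('a, 'r) ring_scheme \<Rightarrow> nat \<Rightarrow> (nat \<Rightarrow> nat \<Rightarrow> 'a) \<Rightarrow> (nat \<Rightarrow> 'a) \<Rightarrow> nat \<Rightarrow> 'a"
  where "row_act R n A x = lincomb (free_mod R n) n x A"

lemma row_act_hom:
  assumes "cring R" "A \<in> mats R n"
  shows "row_act R n A \<in> mod_hom R (free_mod R n) (free_mod R n)"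
proof -
  interpret F: module R "free_mod R n" by (rule module_free[OF assms(1)])
  show ?thesis using F.lincomb_hom_left[OF assms(2)] by (simp add: row_act_def[abs_def])
qed

lemma mat_mult_row: "mat_mult R n T B = (\<lambda>i\<in>{..<n}. row_act R n B (T i))"
  by (simp add: mat_act_def row_act_def)

lemma row_act_row_act:
  assumes "cring R" "A \<in> mats R n" "B \<in> mats R n" "x \<in> carrier (free_mod R n)"
  shows "row_act R n B (row_act R n A x) = row_act R n (mat_mult R n A B) x"
  unfolding row_act_def by (rule lincomb_assoc[OF assms(1) module_free[OF assms(1)] assms(4,2,3)])

lemma proj_hom:
  assumes "j < n" shows "(\<lambda>x. x j) \<in> mod_hom R (free_mod R n) (regular_module R)"
  using assms by (auto simp: mod_hom_iff PiE_iff)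

lemma mat_mult_column:
  assumes R: "cring R" and A: "A \<in> mats R n" and Z: "Z \<in> mats R n" and j: "j < n" and i: "i < n"
  shows "mat_mult R n A Z i j = mat_act (regular_module R) n A (\<lambda>i\<in>{..<n}. Z i j) i"
proof -
  have z: "Z \<in> {..<n} \<rightarrow> carrier (free_mod R n)" using Z by (auto simp del: free_mod_simps)
  show ?thesis
    using mat_act_natural[OF proj_hom[OF j] module_free[OF R] module_regular[OF R] A z] i by (simp add: fun_eq_iff)
qed

lemma lincomb_id:
  assumes R: "cring R" and x: "x \<in> carrier (free_mod R n)"
  shows "lincomb (free_mod R n) n x (id_mat R n) = x"
proof -
  interpret R: cring R by fact
  interpret F: module R "free_mod R n" by (rule module_free[OF R])
  interpret M: module R "regular_module R" by (rule module_regular[OF R])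
  have id: "id_mat R n \<in> {..<n} \<rightarrow> carrier (free_mod R n)" using id_mat_closed[OF R] by (auto simp del: free_mod_simps)
  have "lincomb (free_mod R n) n x (id_mat R n) \<in> carrier (pow_mod (regular_module R) n)"
    using F.lincomb_closed[OF x id] by simp
  moreover have "x \<in> carrier (pow_mod (regular_module R) n)" using x by simp
  moreover have "lincomb (free_mod R n) n x (id_mat R n) j = x j" if j: "j < n" for j
  proof -
    have x': "\<And>i. i < n \<Longrightarrow> x i \<in> carrier R" using x by (auto simp: PiE_iff)
    have "lincomb (free_mod R n) n x (id_mat R n) j = lincomb (regular_module R) n x (\<lambda>i\<in>{..<n}. id_mat R n i j)"
      by (rule lincomb_natural[OF proj_hom[OF j] module_free[OF R] module_regular[OF R] x id])
    also have "\<dots> = (\<Oplus>\<^bsub>regular_module R\<^esub>i\<in>{..<n}. if j = i then x i else \<zero>\<^bsub>regular_module R\<^esub>)"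
      unfolding lincomb_def using x' j by (intro M.M.finsum_cong') (auto simp: id_mat_def single_def)
    also have "\<dots> = x j" using x' j by (intro M.M.finsum_singleton) auto
    finally show ?thesis .
  qed
  ultimately show ?thesis by (rule pow_mod_eqI)
qed

lemma mat_mult_id_right: "cring R \<Longrightarrow> B \<in> mats R n \<Longrightarrow> mat_mult R n B (id_mat R n) = B"
proof -
  assume R: "cring R" and B: "B \<in> mats R n"
  have "mat_mult R n B (id_mat R n) \<in> mats R n"
    using mod_homD(1)[OF mat_act_hom[OF module_free[OF R] B] id_mat_closed[OF R]] .
  then show "mat_mult R n B (id_mat R n) = B"
    using B by (rule pow_mod_eqI) (simp add: mat_act_def lincomb_id[OF R free_mod_carrier_row[OF B]])
qed

lemma mat_mult_closed: "cring R \<Longrightarrow> A \<in> mats R n \<Longrightarrow> B \<in> mats R n \<Longrightarrow> mat_mult R n A B \<in> mats R n"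
  using mod_homD(1)[OF mat_act_hom[OF module_free]] .

definition coord_subspace :: "('a, 'r) ring_scheme \<Rightarrow> nat \<Rightarrow> nat set \<Rightarrow> (nat \<Rightarrow> 'a) set"
  where "coord_subspace R n J = {x \<in> carrier (free_mod R n). \<forall>j<n. j \<notin> J \<longrightarrow> x j = \<zero>\<^bsub>R\<^esub>}"

lemma submodule_coord:
  assumes "cring R" shows "submodule (coord_subspace R n J) R (free_mod R n)"
proof -
  interpret R: cring R by fact
  interpret F: module R "free_mod R n" by (rule module_free[OF assms])
  show ?thesis unfolding F.submodule_iff by (auto simp: coord_subspace_def PiE_iff extensional_def)
qed

lemma coord_subspace_UNIV: "coord_subspace R n UNIV = carrier (free_mod R n)"
  by (auto simp: coord_subspace_def)

text \<open>Exactness over \<open>R\<close> gives exactness column by column, with zero columns lifted to zero.\<close>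

lemma exact_columns:
  assumes R: "cring R" and A: "A \<in> mats R n" and B: "B \<in> mats R n"
    and ex: "\<And>z. z \<in> carrier (free_mod R n) \<Longrightarrow> mat_act (regular_module R) n B z = \<zero>\<^bsub>free_mod R n\<^esub> \<Longrightarrow>
      \<exists>y\<in>carrier (free_mod R n). z = mat_act (regular_module R) n A y"
    and Z: "Z \<in> {..<n} \<rightarrow>\<^sub>E coord_subspace R n J" and BZ: "mat_mult R n B Z = \<zero>\<^bsub>pow_mod (free_mod R n) n\<^esub>"
  shows "\<exists>Y\<in>{..<n} \<rightarrow>\<^sub>E coord_subspace R n J. Z = mat_mult R n A Y"
proof -
  interpret R: cring R by fact
  have Zm: "Z \<in> mats R n" using Z by (auto simp: coord_subspace_def PiE_iff)
  have Zc: "Z i \<in> coord_subspace R n J" if "i < n" for i using Z that by (simp add: PiE_iff)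
  have col: "(\<lambda>i\<in>{..<n}. Z i j) \<in> carrier (free_mod R n)" if "j < n" for j
    using Zm that by (auto simp: PiE_iff)
  have "\<exists>y\<in>carrier (free_mod R n). (\<lambda>i\<in>{..<n}. Z i j) = mat_act (regular_module R) n A y" if j: "j < n" for j
  proof (rule ex[OF col[OF j]])
    show "mat_act (regular_module R) n B (\<lambda>i\<in>{..<n}. Z i j) = \<zero>\<^bsub>free_mod R n\<^esub>"
    proof
      fix i
      show "mat_act (regular_module R) n B (\<lambda>i\<in>{..<n}. Z i j) i = \<zero>\<^bsub>free_mod R n\<^esub> i"
      proof (cases "i < n")
        case True
        then show ?thesis using mat_mult_column[OF R B Zm j True] BZ j by simp
      next
        case False
        then show ?thesis by (simp add: mat_act_def)
      qed
    qed
  qed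
  then have "\<forall>j. \<exists>y. j < n \<longrightarrow> y \<in> carrier (free_mod R n) \<and> (\<lambda>i\<in>{..<n}. Z i j) = mat_act (regular_module R) n A y"
    by blast
  then obtain y where y: "\<And>j. j < n \<Longrightarrow> y j \<in> carrier (free_mod R n)"
    "\<And>j. j < n \<Longrightarrow> (\<lambda>i\<in>{..<n}. Z i j) = mat_act (regular_module R) n A (y j)" by metis
  define Y where "Y = (\<lambda>i\<in>{..<n}. \<lambda>j\<in>{..<n}. if j \<in> J then y j i else \<zero>\<^bsub>R\<^esub>)"
  have y1: "y j i \<in> carrier R" if "j < n" "i < n" for i j using y(1)[OF that(1)] that(2) by (auto simp: PiE_iff)
  have Y: "Y \<in> {..<n} \<rightarrow>\<^sub>E coord_subspace R n J"
    using y1 by (auto simp: Y_def coord_subspace_def)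
  then have Ym: "Y \<in> mats R n" by (auto simp: coord_subspace_def PiE_iff)
  have "mat_mult R n A Y i j = Z i j" if i: "i < n" and j: "j < n" for i j
  proof -
    have "mat_mult R n A Y i j = mat_act (regular_module R) n A (\<lambda>i\<in>{..<n}. Y i j) i"
      by (rule mat_mult_column[OF R A Ym j i])
    also have "\<dots> = Z i j"
    proof (cases "j \<in> J")
      case True
      have "(\<lambda>i\<in>{..<n}. Y i j) = y j" using True j PiE_arb[of "y j" "{..<n}" "\<lambda>_. carrier R"] y(1)[OF j]
        by (auto simp: Y_def fun_eq_iff)
      then show ?thesis using fun_cong[OF y(2)[OF j], of i] i by simp
    next
      case False
      have "(\<lambda>i\<in>{..<n}. Y i j) = \<zero>\<^bsub>pow_mod (regular_module R) n\<^esub>" using False j by (auto simp: Y_def fun_eq_iff)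
      then have "mat_act (regular_module R) n A (\<lambda>i\<in>{..<n}. Y i j) = \<zero>\<^bsub>pow_mod (regular_module R) n\<^esub>"
        using mod_hom_zero[OF mat_act_hom[OF module_regular[OF R] A]] module_pow[OF module_regular[OF R]] by metis
      then show ?thesis using Zc[OF i] False i j by (simp add: coord_subspace_def)
    qed
    finally show ?thesis .
  qed
  moreover have "mat_mult R n A Y \<in> mats R n" by (rule mat_mult_closed[OF R A Ym])
  ultimately have "mat_mult R n A Y = Z"
    using Zm by (intro pow_mod_eqI[of _ "free_mod R n" n] pow_mod_eqI[of _ "regular_module R" n]) (auto simp: PiE_iff)
  then show ?thesis using Y by blast
qed


section \<open>Vanishing of the stable endomorphism ring\<close>

locale exact_periodic_complex = periodic_complex +
  assumes exA: "\<And>z. z \<in> carrier (free_mod R n) \<Longrightarrow> mat_act (regular_module R) n A z = \<zero>\<^bsub>free_mod R n\<^esub> \<Longrightarrow>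
      \<exists>y\<in>carrier (free_mod R n). z = mat_act (regular_module R) n B y"
    and exB: "\<And>z. z \<in> carrier (free_mod R n) \<Longrightarrow> mat_act (regular_module R) n B z = \<zero>\<^bsub>free_mod R n\<^esub> \<Longrightarrow>
      \<exists>y\<in>carrier (free_mod R n). z = mat_act (regular_module R) n A y"
begin

lemma swap_exact: "exact_periodic_complex R n B A I S"
  using swap exA exB by (intro exact_periodic_complex.intro exact_periodic_complex_axioms.intro)

lemma homology_length_coord:
  "homology_length R S (free_mod R n) n A B (coord_subspace R n J) {\<zero>\<^bsub>free_mod R n\<^esub>} = 0"
proof -
  let ?F = "free_mod R n" and ?V = "coord_subspace R n J"
  have F: "module R ?F" by (rule module_free[OF cring])
  interpret F: module R ?F by (rule F)
  note V = submodule_coord[OF cring, of n J]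
  have Z0: "{\<zero>\<^bsub>?F\<^esub>} \<subseteq> ?V" using F.submoduleD(3)[OF V] by blast
  show ?thesis
  proof (rule homology_length_eq_0[OF F V F.submodule_zero Z0], rule subsetI)
    fix z assume "z \<in> act_ker ?F n B ?V {\<zero>\<^bsub>?F\<^esub>}"
    then have z: "z \<in> {..<n} \<rightarrow>\<^sub>E ?V" "mat_mult R n B z \<in> {..<n} \<rightarrow>\<^sub>E {\<zero>\<^bsub>?F\<^esub>}" by (simp_all add: act_ker_def)
    have "mat_mult R n B z = \<zero>\<^bsub>pow_mod ?F n\<^esub>"
      using z(2) by (intro pow_mod_eqI[of _ ?F n]) (auto simp: PiE_iff)
    then have "\<exists>Y\<in>{..<n} \<rightarrow>\<^sub>E ?V. z = mat_mult R n A Y" using exact_columns[OF cring A B exB z(1)] by blast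
    then show "z \<in> act_im ?F n A ?V {\<zero>\<^bsub>?F\<^esub>}" using act_im_upper(1)[OF F V F.submodule_zero] by blast
  qed
qed

lemma herbrand_coord:
  "herbrand R S (free_mod R n) n A B (coord_subspace R n J) {\<zero>\<^bsub>free_mod R n\<^esub>} = 0"
  unfolding herbrand_def
  using homology_length_coord exact_periodic_complex.homology_length_coord[OF swap_exact] by simp

lemma herbrand_regular:
  "herbrand R S (regular_module R) n A B (carrier R) {\<zero>\<^bsub>R\<^esub>} = 0"
proof -
  have *: "homology_length R S (regular_module R) n A B (carrier R) {\<zero>\<^bsub>R\<^esub>} = 0"
    if "exact_periodic_complex R n A B I S" for A B
  proof -
    interpret c: exact_periodic_complex R n A B I S by fact
    have N: "module R (regular_module R)" by (rule module_regular[OF cring])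
    interpret N: module R "regular_module R" by (rule N)
    have T: "submodule (carrier R) R (regular_module R)" using N.carrier_is_submodule by simp
    have Z: "submodule {\<zero>\<^bsub>R\<^esub>} R (regular_module R)" using N.submodule_zero by simp
    have ZT: "{\<zero>\<^bsub>R\<^esub>} \<subseteq> carrier R" using N.submoduleD(1)[OF Z] by simp
    show ?thesis
    proof (rule c.homology_length_eq_0[OF N T Z ZT], rule subsetI)
      fix z assume "z \<in> act_ker (regular_module R) n B (carrier R) {\<zero>\<^bsub>R\<^esub>}"
      then have z: "z \<in> {..<n} \<rightarrow>\<^sub>E carrier R" "mat_act (regular_module R) n B z \<in> {..<n} \<rightarrow>\<^sub>E {\<zero>\<^bsub>R\<^esub>}"
        by (simp_all add: act_ker_def)
      have "mat_act (regular_module R) n B z = \<zero>\<^bsub>pow_mod (regular_module R) n\<^esub>"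
        using z(2) by (intro pow_mod_eqI[of _ "regular_module R" n]) (auto simp: PiE_iff)
      then have "\<exists>y\<in>carrier (free_mod R n). z = mat_act (regular_module R) n A y"
        using z(1) by (intro c.exB) simp_all
      then obtain y where "y \<in> {..<n} \<rightarrow>\<^sub>E carrier R" "z = mat_act (regular_module R) n A y" by auto
      then show "z \<in> act_im (regular_module R) n A (carrier R) {\<zero>\<^bsub>R\<^esub>}" using c.act_im_upper(1)[OF N T Z] by blast
    qed
  qed
  show ?thesis
    unfolding herbrand_def using *[OF exact_periodic_complex_axioms] *[OF swap_exact] by simp
qed

abbreviation row_ker :: "(nat \<Rightarrow> nat \<Rightarrow> 'a) \<Rightarrow> (nat \<Rightarrow> 'a) set"
  where "row_ker C \<equiv> {x \<in> carrier (free_mod R n). row_act R n C x = \<zero>\<^bsub>free_mod R n\<^esub>}"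

abbreviation row_im :: "(nat \<Rightarrow> nat \<Rightarrow> 'a) \<Rightarrow> (nat \<Rightarrow> 'a) set"
  where "row_im C \<equiv> row_act R n C ` carrier (free_mod R n)"

lemma row_im_subset_ker: "row_im A \<subseteq> row_ker B"
proof -
  have F: "module R (free_mod R n)" by (rule module_free[OF cring])
  have "row_act R n B (row_act R n A x) = \<zero>\<^bsub>free_mod R n\<^esub>" if x: "x \<in> carrier (free_mod R n)" for x
    unfolding row_act_row_act[OF cring A B x] AB unfolding row_act_def
    by (rule mod_hom_zero[OF module.lincomb_hom_right[OF F x] module_pow[OF F] F])
  then show ?thesis using mod_homD(1)[OF row_act_hom[OF cring A]] by auto
qed

text \<open>The cohomology \<open>row_ker B / row_im A\<close> of the dual complex is \<open>Ext\<^sup>1\<close> of the cokernel of \<open>A\<close> with values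
  in \<open>R\<close>.\<close>

lemma homotopy_row_ker:
  assumes a: "a \<in> I" and x: "x \<in> row_ker B"
  shows "a \<odot>\<^bsub>free_mod R n\<^esub> x \<in> row_im A"
proof -
  let ?F = "free_mod R n"
  have F: "module R ?F" by (rule module_free[OF cring])
  interpret F: module R ?F by (rule F)
  have x': "x \<in> carrier ?F" "row_act R n B x = \<zero>\<^bsub>?F\<^esub>" using x by auto
  have aR: "a \<in> carrier R" using a ideal.Icarr[OF I] by blast
  obtain Y Z where YZ: "Y \<in> mats R n" "Z \<in> mats R n" "a \<odot>\<^bsub>pow_mod ?F n\<^esub> id_mat R n =
      mat_mult R n Y A \<oplus>\<^bsub>pow_mod ?F n\<^esub> mat_mult R n B Z"
    using homotopyB[OF a] by blast
  note h = mod_homD[OF F.lincomb_hom_right[OF x'(1)]]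
  have "a \<odot>\<^bsub>?F\<^esub> x = lincomb ?F n x (a \<odot>\<^bsub>pow_mod ?F n\<^esub> id_mat R n)"
    using h(3)[OF aR id_mat_closed[OF cring]] lincomb_id[OF cring x'(1)] by metis
  also have "\<dots> = row_act R n (mat_mult R n Y A) x \<oplus>\<^bsub>?F\<^esub> row_act R n (mat_mult R n B Z) x"
    unfolding YZ(3) row_act_def by (rule h(2)[OF mat_mult_closed[OF cring YZ(1) A] mat_mult_closed[OF cring B YZ(2)]])
  also have "row_act R n (mat_mult R n B Z) x = row_act R n Z \<zero>\<^bsub>?F\<^esub>"
    using row_act_row_act[OF cring B YZ(2) x'(1)] x'(2) by metis
  also have "\<dots> = \<zero>\<^bsub>?F\<^esub>" by (rule mod_hom_zero[OF row_act_hom[OF cring YZ(2)] F F])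
  also have "row_act R n (mat_mult R n Y A) x = row_act R n A (row_act R n Y x)"
    using row_act_row_act[OF cring YZ(1) A x'(1)] by metis
  finally have eq: "a \<odot>\<^bsub>?F\<^esub> x = row_act R n A (row_act R n Y x) \<oplus>\<^bsub>?F\<^esub> \<zero>\<^bsub>?F\<^esub>" .
  have Yx: "row_act R n Y x \<in> carrier ?F" by (rule mod_homD(1)[OF row_act_hom[OF cring YZ(1)] x'(1)])
  have "a \<odot>\<^bsub>?F\<^esub> x = row_act R n A (row_act R n Y x)"
    unfolding eq using F.M.r_zero[OF mod_homD(1)[OF row_act_hom[OF cring A] Yx]] .
  then show ?thesis using Yx by blast
qed

text \<open>The dual complex \<open>0 \<rightarrow> row_ker A \<rightarrow> R\<^sup>n \<rightarrow> R\<^sup>n \<rightarrow> R\<^sup>n \<rightarrow> R\<^sup>n / row_im B \<rightarrow> 0\<close> is exact up to a module killed by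
  \<open>I\<close>. As the Herbrand difference is additive, vanishes on \<open>R\<^sup>n\<close> and ignores modules killed by \<open>I\<close>, its values at the
  two ends agree up to sign.\<close>

lemma herbrand_cokernel:
  assumes "herbrand R S (free_mod R n) n A B (row_ker A) {\<zero>\<^bsub>free_mod R n\<^esub>} = 0"
  shows "herbrand R S (free_mod R n) n A B (carrier (free_mod R n)) (row_im B) = 0"
proof -
  let ?F = "free_mod R n"
  let ?h = "herbrand R S ?F n A B" and ?T = "carrier ?F"
  have F: "module R ?F" by (rule module_free[OF cring])
  have fg: "fg_module R ?F" by (rule fg_free[OF cring])
  interpret F: module R ?F by (rule F)
  interpret sw: exact_periodic_complex R n B A I S by (rule swap_exact)
  note T = F.carrier_is_submodule and Z = F.submodule_zero
  have ker: "submodule (row_ker C) R ?F" "submodule (row_im C) R ?F" "{\<zero>\<^bsub>?F\<^esub>} \<subseteq> row_ker C" "row_ker C \<subseteq> ?T"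
     "{\<zero>\<^bsub>?F\<^esub>} \<subseteq> row_im C" "row_im C \<subseteq> ?T" "row_act R n C ` row_ker C = {\<zero>\<^bsub>?F\<^esub>}"
    if C: "C \<in> mats R n" for C
  proof -
    note f = row_act_hom[OF cring C]
    show 1: "submodule (row_ker C) R ?F" using submodule_vimage[OF f F F T Z] by simp
    show 2: "submodule (row_im C) R ?F" by (rule submodule_image[OF f F F T])
    show "{\<zero>\<^bsub>?F\<^esub>} \<subseteq> row_im C" "row_im C \<subseteq> ?T" using F.submoduleD[OF 2] by auto
    show 3: "{\<zero>\<^bsub>?F\<^esub>} \<subseteq> row_ker C" using F.submoduleD(3)[OF 1] by blast
    show "row_ker C \<subseteq> ?T" by blast
    have "row_act R n C \<zero>\<^bsub>?F\<^esub> = \<zero>\<^bsub>?F\<^esub>" using 3 by blast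
    then have "\<zero>\<^bsub>?F\<^esub> \<in> row_act R n C ` row_ker C" using 3 by (intro image_eqI[of _ _ "\<zero>\<^bsub>?F\<^esub>"]) (simp_all only: insert_subset)
    then show "row_act R n C ` row_ker C = {\<zero>\<^bsub>?F\<^esub>}" by blast
  qed
  have total: "?h ?T {\<zero>\<^bsub>?F\<^esub>} = 0" using herbrand_coord[of UNIV] by (simp only: coord_subspace_UNIV)
  have im: "?h (row_im C) {\<zero>\<^bsub>?F\<^esub>} = ?h ?T (row_ker C)" if C: "C \<in> mats R n" for C
    using herbrand_hom[OF F F row_act_hom[OF cring C] T ker(1)[OF C] ker(4)[OF C]] unfolding ker(7)[OF C] by blast
  have "?h ?T (row_im B) + ?h (row_im B) {\<zero>\<^bsub>?F\<^esub>} = 0"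
    using herbrand_add[OF fg T ker(2)[OF B] Z ker(5)[OF B] ker(6)[OF B]] total by simp
  moreover have "?h ?T (row_ker B) + ?h (row_ker B) {\<zero>\<^bsub>?F\<^esub>} = 0"
    using herbrand_add[OF fg T ker(1)[OF B] Z ker(3)[OF B] ker(4)[OF B]] total by simp
  moreover have "?h (row_ker B) {\<zero>\<^bsub>?F\<^esub>} = ?h (row_ker B) (row_im A) + ?h (row_im A) {\<zero>\<^bsub>?F\<^esub>}"
    by (rule herbrand_add[OF fg ker(1)[OF B] ker(2)[OF A] Z ker(5)[OF A] row_im_subset_ker])
  moreover have "?h (row_ker B) (row_im A) = 0"
    by (rule herbrand_finite_length[OF fg ker(1)[OF B] ker(2)[OF A] row_im_subset_ker homotopy_row_ker])
  moreover have "?h ?T (row_ker A) + ?h (row_ker A) {\<zero>\<^bsub>?F\<^esub>} = 0"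
    using herbrand_add[OF fg T ker(1)[OF A] Z ker(3)[OF A] ker(4)[OF A]] total by simp
  ultimately show ?thesis using im[OF A] im[OF B] assms by simp
qed

text \<open>The lifting hypothesis says that one homology module of the complex with coefficients in
  \<open>R\<^sup>n / row_im B\<close> is zero. The Herbrand difference being zero, the other one has length zero. The identity matrix
  is a cycle for it, so a multiple of the identity by an element of \<open>S\<close> is a boundary.\<close>

theorem null_homotopic_unit:
  assumes lift: "\<And>T C. T \<in> mats R n \<Longrightarrow> C \<in> mats R n \<Longrightarrow> mat_mult R n A C = mat_mult R n T B \<Longrightarrow>
      \<exists>Y\<in>mats R n. \<exists>Z\<in>mats R n. C = mat_mult R n B Y \<oplus>\<^bsub>pow_mod (free_mod R n) n\<^esub> mat_mult R n Z B"
    and dual: "herbrand R S (free_mod R n) n A B (row_ker A) {\<zero>\<^bsub>free_mod R n\<^esub>} = 0"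
  shows "\<exists>s\<in>S. \<exists>Y\<in>mats R n. \<exists>Z\<in>mats R n. s \<odot>\<^bsub>pow_mod (free_mod R n) n\<^esub> id_mat R n =
      mat_mult R n Y B \<oplus>\<^bsub>pow_mod (free_mod R n) n\<^esub> mat_mult R n A Z"
proof -
  let ?F = "free_mod R n" and ?T = "carrier (free_mod R n)"
  let ?P = "pow_mod ?F n"
  have F: "module R ?F" by (rule module_free[OF cring])
  have fg: "fg_module R ?F" by (rule fg_free[OF cring])
  have PF: "module R ?P" by (rule module_pow[OF F])
  interpret F: module R ?F by (rule F)
  interpret P: module R ?P by (rule PF)
  interpret sw: exact_periodic_complex R n B A I S by (rule swap_exact)
  note T = F.carrier_is_submodule
  have W: "submodule (row_im B) R ?F" by (rule submodule_image[OF row_act_hom[OF cring B] F F T])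
  have WT: "row_im B \<subseteq> ?T" using F.submoduleD(1)[OF W] .
  have rows: "\<exists>Y\<in>mats R n. D = mat_mult R n Y B" if D: "D \<in> {..<n} \<rightarrow>\<^sub>E row_im B" for D
  proof -
    have "D \<in> pow_map n (row_act R n B) ` ({..<n} \<rightarrow>\<^sub>E ?T)" using D unfolding pow_map_image .
    then obtain Y where Y: "Y \<in> {..<n} \<rightarrow>\<^sub>E ?T" "D = pow_map n (row_act R n B) Y" by blast
    then show ?thesis by (intro bexI[of _ Y]) (simp_all only: pow_mod_simps mat_mult_row pow_map_def)
  qed
  have rows': "mat_mult R n Y B \<in> {..<n} \<rightarrow>\<^sub>E row_im B" if Y: "Y \<in> mats R n" for Y
    unfolding pow_map_image[symmetric] mat_mult_row using Y 
    by (intro image_eqI[of _ _ Y]) (simp_all only: pow_map_def pow_mod_simps)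
  have "homology_length R S ?F n B A ?T (row_im B) = 0"
  proof (rule sw.homology_length_eq_0[OF F T W WT], rule subsetI)
    fix C assume "C \<in> act_ker ?F n A ?T (row_im B)"
    then have C: "C \<in> mats R n" "mat_mult R n A C \<in> {..<n} \<rightarrow>\<^sub>E row_im B" by (simp_all only: act_ker_def pow_mod_simps mem_Collect_eq)
    obtain U where U: "U \<in> mats R n" "mat_mult R n A C = mat_mult R n U B" using rows[OF C(2)] by blast
    obtain Y Z where YZ: "Y \<in> mats R n" "Z \<in> mats R n" "C = mat_mult R n B Y \<oplus>\<^bsub>?P\<^esub> mat_mult R n Z B"
      using lift[OF U(1) C(1) U(2)] by blast
    have "mat_mult R n B Y \<in> mat_mult R n B ` ({..<n} \<rightarrow>\<^sub>E ?T)" using YZ(1) unfolding pow_mod_simps by (rule imageI)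
    then show "C \<in> act_im ?F n B ?T (row_im B)"
      unfolding act_im_def P.mem_set_add using YZ(3) rows'[OF YZ(2)] by blast
  qed
  then have "the_enat (homology_length R S ?F n A B ?T (row_im B)) = 0"
    using herbrand_cokernel[OF dual] by (simp add: herbrand_def zero_enat_def)
  then have "homology_length R S ?F n A B ?T (row_im B) = 0"
    using homology_length_finite[OF F fg T W WT] by (auto simp: zero_enat_def)
  then have neg: "negligible S ?P (act_ker ?F n B ?T (row_im B)) (act_im ?F n A ?T (row_im B))"
    unfolding homology_length_eq_0_iff[OF F T W WT] .
  have "mat_mult R n B (id_mat R n) = mat_mult R n (id_mat R n) B"
    using mat_mult_id_right[OF cring B] mat_act_id[OF F B] by simp
  then have "id_mat R n \<in> act_ker ?F n B ?T (row_im B)"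
    using id_mat_closed[OF cring, of n] rows'[OF id_mat_closed[OF cring]] unfolding act_ker_def pow_mod_simps by simp
  then obtain s where s: "s \<in> S" "s \<odot>\<^bsub>?P\<^esub> id_mat R n \<in> act_im ?F n A ?T (row_im B)"
    using neg unfolding negligible_def by blast
  then obtain Z D where ZD: "Z \<in> mats R n" "D \<in> {..<n} \<rightarrow>\<^sub>E row_im B" "s \<odot>\<^bsub>?P\<^esub> id_mat R n = mat_mult R n A Z \<oplus>\<^bsub>?P\<^esub> D"
    unfolding act_im_def P.mem_set_add pow_mod_simps by blast
  obtain Y where Y: "Y \<in> mats R n" "D = mat_mult R n Y B" using rows[OF ZD(2)] by blast
  have "s \<odot>\<^bsub>?P\<^esub> id_mat R n = mat_mult R n Y B \<oplus>\<^bsub>?P\<^esub> mat_mult R n A Z"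
    unfolding ZD(3) Y(2) by (rule P.M.a_comm[OF mat_mult_closed[OF cring A ZD(1)] mat_mult_closed[OF cring Y(1) B]])
  then show ?thesis using s(1) Y(1) ZD(1) by blast
qed

end


section \<open>Additive functions on the Grothendieck group\<close>

lemma mod_iso_refl: "mod_iso R M M"
  unfolding mod_iso_def by (rule bexI[OF _ mod_hom_id]) (auto simp: bij_betw_def)

lemma mod_iso_trans: "mod_iso R L M \<Longrightarrow> mod_iso R M N \<Longrightarrow> mod_iso R L N"
  unfolding mod_iso_def
proof (elim bexE)
  fix f g assume "f \<in> mod_hom R L M" "bij_betw f (carrier L) (carrier M)"
    "g \<in> mod_hom R M N" "bij_betw g (carrier M) (carrier N)"
  then show "\<exists>f\<in>mod_hom R L N. bij_betw f (carrier L) (carrier N)"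
    using mod_hom_comp[of f R L M g N] bij_betw_trans[of f _ _ g] by (auto simp: comp_def)
qed

lemma mod_iso_sym:
  assumes M: "module R M" and "mod_iso R M N"
  shows "mod_iso R N M"
proof -
  interpret M: module R M by (rule M)
  obtain f where f: "f \<in> mod_hom R M N" "bij_betw f (carrier M) (carrier N)"
    using assms(2) by (auto simp: mod_iso_def)
  let ?g = "inv_into (carrier M) f"
  have g: "?g y \<in> carrier M" "f (?g y) = y" if "y \<in> carrier N" for y
    using f(2) that by (auto simp: bij_betw_def inv_into_into f_inv_into_f)
  have inj: "x = y" if "x \<in> carrier M" "y \<in> carrier M" "f x = f y" for x y
    using f(2) that by (auto simp: bij_betw_def dest: inj_onD)
  have "?g \<in> mod_hom R N M"
    unfolding mod_hom_iff
  proof (intro conjI ballI)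
    fix x y assume x: "x \<in> carrier N" and y: "y \<in> carrier N"
    show "?g y \<in> carrier M" by (rule g(1)[OF y])
    have eq: "x \<oplus>\<^bsub>N\<^esub> y = f (?g x \<oplus>\<^bsub>M\<^esub> ?g y)"
      using g[OF x] g[OF y] by (simp add: mod_homD(2)[OF f(1)])
    then have "x \<oplus>\<^bsub>N\<^esub> y \<in> carrier N" using g(1) x y mod_homD(1)[OF f(1)] by simp
    then show "?g (x \<oplus>\<^bsub>N\<^esub> y) = ?g x \<oplus>\<^bsub>M\<^esub> ?g y"
      using g x y eq by (intro inj) auto
  next
    fix a y assume a: "a \<in> carrier R" and y: "y \<in> carrier N"
    have eq: "a \<odot>\<^bsub>N\<^esub> y = f (a \<odot>\<^bsub>M\<^esub> ?g y)"
      using g[OF y] a by (simp add: mod_homD(3)[OF f(1)])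
    then have "a \<odot>\<^bsub>N\<^esub> y \<in> carrier N" using g(1)[OF y] a mod_homD(1)[OF f(1)] by simp
    then show "?g (a \<odot>\<^bsub>N\<^esub> y) = a \<odot>\<^bsub>M\<^esub> ?g y"
      using g y a eq by (intro inj) auto
  qed
  then show ?thesis using bij_betw_inv_into[OF f(2)] by (auto simp: mod_iso_def)
qed

lemma iso_class_eq:
  assumes "mod_iso R M N" "mod_iso R N M"
  shows "iso_class R M = iso_class R N"
  using mod_iso_trans[OF assms(1)] mod_iso_trans[OF assms(2)] by (auto simp: iso_class_def)

lemma rat_group_simps [simp]:
  "carrier rat_group = UNIV" "x \<otimes>\<^bsub>rat_group\<^esub> y = x + y" "\<one>\<^bsub>rat_group\<^esub> = 0"
  by (simp_all add: rat_group_def)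

lemma comm_group_rat: "comm_group rat_group"
proof (rule comm_groupI)
  fix x assume "x \<in> carrier rat_group"
  show "\<exists>y\<in>carrier rat_group. y \<otimes>\<^bsub>rat_group\<^esub> x = \<one>\<^bsub>rat_group\<^esub>"
    by (rule bexI[of _ "- x"]) auto
qed auto

lemma rat_hom_diff:
  assumes h: "h \<in> hom (free_Abelian_group S) rat_group" and a: "Poly_Mapping.keys a \<subseteq> S" and b: "Poly_Mapping.keys b \<subseteq> S"
  shows "h (a - b) = h a - h b"
proof -
  have "Poly_Mapping.keys (a - b) \<subseteq> S" using keys_diff[of a b] a b by blast
  then have "h ((a - b) + b) = h (a - b) + h b" using hom_mult[OF h, of "a - b" b] b by simp
  then show ?thesis by simp
qed

lemma comm_group_presented:
  assumes "Q \<subseteq> carrier (free_Abelian_group S)"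
  shows "comm_group (presented_group S Q)" "generate (free_Abelian_group S) Q \<lhd> free_Abelian_group S"
proof -
  interpret G: comm_group "free_Abelian_group S" by (rule abelian_free_Abelian_group)
  have s: "subgroup (generate (free_Abelian_group S) Q) (free_Abelian_group S)"
    by (rule G.generate_is_subgroup[OF assms])
  then show "generate (free_Abelian_group S) Q \<lhd> free_Abelian_group S" by (rule G.subgroup_imp_normal)
  show "comm_group (presented_group S Q)"
    unfolding presented_group_def using s by (rule G.abelian_FactGroup)
qed

lemma presented_gen_closed:
  assumes "x \<in> S" shows "presented_gen S Q x \<in> carrier (presented_group S Q)"
  using assms by (auto simp: presented_gen_def presented_group_def carrier_FactGroup)

text \<open>The relators are tested on an arbitrary homomorphism that extends \<open>f\<close>, because the extension to the free
  abelian group has no convenient closed form.\<close>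

lemma presented_group_universal:
  fixes f :: "'x \<Rightarrow> rat"
  assumes Q: "Q \<subseteq> carrier (free_Abelian_group S)"
    and rel: "\<And>h q. h \<in> hom (free_Abelian_group S) rat_group \<Longrightarrow> (\<And>x. x \<in> S \<Longrightarrow> h (frag_of x) = f x) \<Longrightarrow>
      q \<in> Q \<Longrightarrow> h q = 0"
  obtains g where "g \<in> hom (presented_group S Q) rat_group" "\<And>x. x \<in> S \<Longrightarrow> g (presented_gen S Q x) = f x"
proof -
  interpret G: group "free_Abelian_group S" by simp
  interpret H: comm_group rat_group by (rule comm_group_rat)
  obtain h where h: "h \<in> hom (free_Abelian_group S) rat_group" "\<And>x. x \<in> S \<Longrightarrow> h (frag_of x) = f x"
    using H.free_Abelian_group_universal[of f S] by auto
  interpret h: group_hom "free_Abelian_group S" rat_group h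
    using h(1) by unfold_locales
  let ?N = "generate (free_Abelian_group S) Q"
  have "Q \<subseteq> kernel (free_Abelian_group S) rat_group h"
  proof
    fix q assume "q \<in> Q"
    then show "q \<in> kernel (free_Abelian_group S) rat_group h"
      using rel[OF h] subsetD[OF Q] by (simp add: kernel_def del: carrier_free_Abelian_group_iff)
  qed
  then have "?N \<subseteq> kernel (free_Abelian_group S) rat_group h"
    by (rule G.generate_subgroup_incl[OF _ h.subgroup_kernel])
  then obtain g where g: "g \<in> hom (free_Abelian_group S Mod ?N) rat_group"
    "\<And>x. x \<in> carrier (free_Abelian_group S) \<Longrightarrow> g (?N #>\<^bsub>free_Abelian_group S\<^esub> x) = h x"
    using h.FactGroup_universal_kernel[OF comm_group_presented(2)[OF Q]] by blast
  show thesis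
    using g h(2) by (intro that[of g]) (auto simp: presented_group_def presented_gen_def)
qed

text \<open>An integer-valued additive function descends to the Grothendieck group, then modulo \<open>[R]\<close> as it vanishes
  there, and finally to the tensor product with the rationals through the bilinear map \<open>(a, b) \<mapsto> g a * b\<close>.\<close>

lemma additive_function_vanishes:
  fixes \<chi> :: "'a fg_rep \<Rightarrow> int" and R :: "('a, 'r) ring_scheme"
  assumes iso: "\<And>X Y :: 'a fg_rep. fg_module R X \<Longrightarrow> fg_module R Y \<Longrightarrow> mod_iso R X Y \<Longrightarrow> \<chi> X = \<chi> Y"
    and add: "\<And>(X' :: 'a fg_rep) (X :: 'a fg_rep) (X'' :: 'a fg_rep) f g.
      fg_module R X' \<Longrightarrow> fg_module R X \<Longrightarrow> fg_module R X'' \<Longrightarrow> short_exact R X' f X g X'' \<Longrightarrow> \<chi> X = \<chi> X' + \<chi> X''"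
    and reg: "mod_iso R X1 (regular_module R)" "fg_module R X1" "mod_iso R (regular_module R) X1" "\<chi> X1 = 0"
    and D: "mod_iso R X0 D" "fg_module R X0" "mod_iso R D X0"
    and zero: "rational_reduced_groth_class R D = \<one>\<^bsub>rational_reduced_groth_group R\<^esub>"
  shows "\<chi> X0 = 0"
proof -
  let ?S = "iso_classes R" and ?Q = "exact_relations R"
  let ?f = "\<lambda>C. of_int (\<chi> (SOME X. X \<in> C)) :: rat"
  have f: "?f (iso_class R X) = of_int (\<chi> X)" if X: "fg_module R X" for X :: "'a fg_rep"
  proof -
    have "X \<in> iso_class R X" using X mod_iso_refl by (auto simp: iso_class_def)
    then have "(SOME Y. Y \<in> iso_class R X) \<in> iso_class R X" by (rule someI)
    then show ?thesis using iso[OF X] by (auto simp: iso_class_def)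
  qed
  have S: "iso_class R X \<in> ?S" if "fg_module R X" for X :: "'a fg_rep"
    using that by (auto simp: iso_classes_def)
  have keys: "Poly_Mapping.keys (frag_of (iso_class R X) - frag_of (iso_class R X')) \<subseteq> ?S"
    if "fg_module R X" "fg_module R X'" for X X' :: "'a fg_rep"
    using keys_diff[of "frag_of (iso_class R X)" "frag_of (iso_class R X')"] S that by auto
  have Q: "?Q \<subseteq> carrier (free_Abelian_group ?S)"
  proof
    fix q assume "q \<in> ?Q"
    then obtain X' X X'' :: "'a fg_rep" where
      X: "q = frag_of (iso_class R X) - frag_of (iso_class R X') - frag_of (iso_class R X'')"
      "fg_module R X'" "fg_module R X" "fg_module R X''" unfolding exact_relations_def by blast
    have "Poly_Mapping.keys q \<subseteq> ?S"
      unfolding X(1)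
      using keys_diff[of "frag_of (iso_class R X) - frag_of (iso_class R X')" "frag_of (iso_class R X'')"]
        keys[OF X(3,2)] S[OF X(4)] by auto
    then show "q \<in> carrier (free_Abelian_group ?S)" by simp
  qed
  obtain g1 where g1: "g1 \<in> hom (groth_group R) rat_group" "\<And>C. C \<in> ?S \<Longrightarrow> g1 (presented_gen ?S ?Q C) = ?f C"
  proof (rule presented_group_universal[OF Q, of ?f])
    fix h q assume h: "h \<in> hom (free_Abelian_group ?S) rat_group" "\<And>C. C \<in> ?S \<Longrightarrow> h (frag_of C) = ?f C" and "q \<in> ?Q"
    then obtain X' X X'' :: "'a fg_rep" and k l where
      X: "q = frag_of (iso_class R X) - frag_of (iso_class R X') - frag_of (iso_class R X'')"
      "fg_module R X'" "fg_module R X" "fg_module R X''" "short_exact R X' k X l X''"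
      unfolding exact_relations_def by blast
    have "h q = h (frag_of (iso_class R X)) - h (frag_of (iso_class R X')) - h (frag_of (iso_class R X''))"
      unfolding X(1) using rat_hom_diff[OF h(1)] keys[OF X(3,2)] S X(2-4) by simp
    also have "\<dots> = of_int (\<chi> X - \<chi> X' - \<chi> X'')" using h(2) S X(2-4) f by simp
    finally show "h q = 0" using add[OF X(2-5)] by simp
  qed (use that in \<open>simp add: groth_group_def\<close>)
  have comm1: "comm_group (groth_group R)" unfolding groth_group_def by (rule comm_group_presented(1)[OF Q])
  interpret G1: comm_group "groth_group R" by (rule comm1)
  interpret H: comm_group rat_group by (rule comm_group_rat)
  interpret g1: group_hom "groth_group R" rat_group g1 using g1(1) by unfold_locales
  have cls: "groth_class R L \<in> carrier (groth_group R)" "g1 (groth_class R L) = of_int (\<chi> X)"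
    if "mod_iso R X L" "fg_module R X" "mod_iso R L X" for L :: "('a, 'l, 'd) module_scheme" and X
    unfolding groth_class_def iso_class_eq[OF that(3,1)]
    using presented_gen_closed[OF S[OF that(2)]] g1(2)[OF S[OF that(2)]] f[OF that(2)] by (simp_all add: groth_group_def)
  let ?N = "groth_free_subgroup R"
  have "{groth_class R (regular_module R)} \<subseteq> kernel (groth_group R) rat_group g1"
    using cls[OF reg(1-3)] reg(4) by (auto simp: kernel_def)
  then have N: "?N \<subseteq> kernel (groth_group R) rat_group g1"
    unfolding groth_free_subgroup_def by (rule G1.generate_subgroup_incl[OF _ g1.subgroup_kernel])
  have sub: "subgroup ?N (groth_group R)"
    unfolding groth_free_subgroup_def using cls[OF reg(1-3)] by (intro G1.generate_is_subgroup) auto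
  obtain g2 where g2: "g2 \<in> hom (reduced_groth_group R) rat_group"
    "\<And>x. x \<in> carrier (groth_group R) \<Longrightarrow> g2 (?N #>\<^bsub>groth_group R\<^esub> x) = g1 x"
    unfolding reduced_groth_group_def
    using g1.FactGroup_universal_kernel[OF G1.subgroup_imp_normal[OF sub] N] by blast
  have D1: "reduced_groth_class R D \<in> carrier (reduced_groth_group R)" "g2 (reduced_groth_class R D) = of_int (\<chi> X0)"
    unfolding reduced_groth_class_def reduced_groth_group_def
    using cls[OF D] g2(2) by (auto simp: carrier_FactGroup)
  let ?G = "reduced_groth_group R"
  interpret G2: comm_group ?G unfolding reduced_groth_group_def using sub by (rule G1.abelian_FactGroup)
  let ?T = "carrier ?G \<times> carrier rat_group" and ?TR = "tensor_relations ?G rat_group"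
  have k2: "Poly_Mapping.keys (frag_of x - frag_of y) \<subseteq> ?T" if "x \<in> ?T" "y \<in> ?T" for x y
    using keys_diff[of "frag_of x" "frag_of y"] that by auto
  have k3: "Poly_Mapping.keys (frag_of x - frag_of y - frag_of z) \<subseteq> ?T" if "x \<in> ?T" "y \<in> ?T" "z \<in> ?T" for x y z
    using keys_diff[of "frag_of x - frag_of y" "frag_of z"] k2[OF that(1,2)] that(3) by auto
  have TR: "?TR \<subseteq> carrier (free_Abelian_group ?T)"
  proof
    fix q assume "q \<in> ?TR"
    then have "\<exists>x\<in>?T. \<exists>y\<in>?T. \<exists>z\<in>?T. q = frag_of x - frag_of y - frag_of z"
      unfolding tensor_relations_def by fastforce
    then obtain x y z where "x \<in> ?T" "y \<in> ?T" "z \<in> ?T" "q = frag_of x - frag_of y - frag_of z" by blast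
    then show "q \<in> carrier (free_Abelian_group ?T)" using k3[of x y z] by simp
  qed
  obtain g3 where g3: "g3 \<in> hom (tensor_group ?G rat_group) rat_group"
    "\<And>x. x \<in> ?T \<Longrightarrow> g3 (presented_gen ?T ?TR x) = (\<lambda>(a, b). g2 a * b) x"
  proof (rule presented_group_universal[OF TR, of "\<lambda>(a, b). g2 a * b"])
    fix h q assume h: "h \<in> hom (free_Abelian_group ?T) rat_group" "\<And>x. x \<in> ?T \<Longrightarrow> h (frag_of x) = (\<lambda>(a, b). g2 a * b) x"
      and q: "q \<in> ?TR"
    have h3: "h (frag_of x - frag_of y - frag_of z) = h (frag_of x) - h (frag_of y) - h (frag_of z)"
      if "x \<in> ?T" "y \<in> ?T" "z \<in> ?T" for x y z
      using rat_hom_diff[OF h(1) k2[OF that(1,2)], of "frag_of z"] rat_hom_diff[OF h(1), of "frag_of x" "frag_of y"] that by simp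
    from q consider (l) a a' b where "q = frag_of (a \<otimes>\<^bsub>?G\<^esub> a', b) - frag_of (a, b) - frag_of (a', b)"
        "a \<in> carrier ?G" "a' \<in> carrier ?G"
      | (r) a b b' where "q = frag_of (a, b + b') - frag_of (a, b) - frag_of (a, b')" "a \<in> carrier ?G"
      unfolding tensor_relations_def by auto
    then show "h q = 0"
    proof cases
      case l
      have "h q = g2 (a \<otimes>\<^bsub>?G\<^esub> a') * b - g2 a * b - g2 a' * b"
        unfolding l(1) using h3[of "(a \<otimes>\<^bsub>?G\<^esub> a', b)" "(a, b)" "(a', b)"] h(2) l(2,3) by simp
      then show ?thesis using hom_mult[OF g2(1) l(2,3)] by (simp add: algebra_simps)
    next
      case r
      have "h q = g2 a * (b + b') - g2 a * b - g2 a * b'"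
        unfolding r(1) using h3[of "(a, b + b')" "(a, b)" "(a, b')"] h(2) r(2) by simp
      then show ?thesis by (simp add: algebra_simps)
    qed
  qed (use that in \<open>simp add: tensor_group_def\<close>)
  have cT: "comm_group (tensor_group ?G rat_group)" unfolding tensor_group_def by (rule comm_group_presented(1)[OF TR])
  then interpret T: comm_group "tensor_group ?G rat_group" .
  have "g3 \<one>\<^bsub>tensor_group ?G rat_group\<^esub> = 0"
    using hom_one[OF g3(1) T.is_group H.is_group] by simp
  moreover have "g3 (rational_reduced_groth_class R D) = g2 (reduced_groth_class R D) * 1"
    unfolding rational_reduced_groth_class_def pure_tensor_def
    by (subst g3(2)) (use D1(1) in auto)
  ultimately show ?thesis
    using zero D1(2) unfolding rational_reduced_groth_group_def by simp
qed


section \<open>Representatives of submodules of free modules\<close>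

text \<open>Replacing \<open>x\<close> by \<open>{x}\<close> moves a submodule of a free module to the type over which the Grothendieck group is
  built.\<close>

definition singleton_module :: "('a, 'm, 'c) module_scheme \<Rightarrow> ('a, 'm set) module"
  where "singleton_module M =
    \<lparr>carrier = (\<lambda>x. {x}) ` carrier M, monoid.mult = undefined, one = undefined,
     ring.zero = {\<zero>\<^bsub>M\<^esub>}, add = (\<lambda>X Y. {the_elem X \<oplus>\<^bsub>M\<^esub> the_elem Y}),
     smult = (\<lambda>a X. {a \<odot>\<^bsub>M\<^esub> the_elem X})\<rparr>"

lemma singleton_module_simps [simp]:
  "carrier (singleton_module M) = (\<lambda>x. {x}) ` carrier M" "ring.zero (singleton_module M) = {\<zero>\<^bsub>M\<^esub>}"
  "add (singleton_module M) = (\<lambda>X Y. {the_elem X \<oplus>\<^bsub>M\<^esub> the_elem Y})"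
  "smult (singleton_module M) = (\<lambda>a X. {a \<odot>\<^bsub>M\<^esub> the_elem X})"
  by (simp_all add: singleton_module_def)

lemma module_singleton:
  assumes "module R M"
  shows "module R (singleton_module M)"
proof -
  interpret M: module R M by fact
  show ?thesis
  proof (rule moduleI)
    show "cring R" ..
    show "abelian_group (singleton_module M)"
    proof (rule abelian_groupI)
      fix x assume "x \<in> carrier (singleton_module M)"
      then obtain y where "y \<in> carrier M" "x = {y}" by auto
      then show "\<exists>y\<in>carrier (singleton_module M). y \<oplus>\<^bsub>singleton_module M\<^esub> x = \<zero>\<^bsub>singleton_module M\<^esub>"
        by (intro bexI[of _ "{\<ominus>\<^bsub>M\<^esub> y}"]) (auto simp: M.M.l_neg)
    qed (auto simp: M.M.a_ac)
  qed (auto simp: M.smult_l_distr M.smult_r_distr M.smult_assoc1)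
qed

lemma singleton_hom: "(\<lambda>x. {x}) \<in> mod_hom R M (singleton_module M)"
  by (simp add: mod_hom_iff)

lemma fg_singleton: "fg_module R M \<Longrightarrow> fg_module R (singleton_module M)"
  by (rule fg_module_image[OF singleton_hom]) (auto simp: fg_module_def module_singleton)

lemma mod_iso_singleton: "mod_iso R M (singleton_module M)"
  unfolding mod_iso_def by (rule bexI[OF _ singleton_hom]) (auto simp: bij_betw_def inj_on_def)


section \<open>Local rings\<close>

lemma ex_maximalideal:
  assumes "cring R" "noetherian_ring R" "ideal J R" "\<one>\<^bsub>R\<^esub> \<notin> J"
  shows "\<exists>K. maximalideal K R \<and> J \<subseteq> K"
proof -
  interpret R: cring R by fact
  interpret N: noetherian_ring R by fact
  define A where "A = {K. ideal K R \<and> J \<subseteq> K \<and> \<one>\<^bsub>R\<^esub> \<notin> K}"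
  have ne: "A \<noteq> {}" using assms(3,4) by (auto simp: A_def)
  have "\<exists>K\<in>A. \<forall>L\<in>A. K \<subseteq> L \<longrightarrow> L = K"
  proof (rule subset_Zorn_nonempty[OF ne])
    fix C assume C: "C \<noteq> {}" "subset.chain A C"
    then have "subset.chain {J. ideal J R} C" by (auto simp: subset.chain_def A_def)
    then have "\<Union>C \<in> C" using N.ideal_chain_is_trivial C(1) by blast
    then show "\<Union>C \<in> A" using C(2) by (auto simp: subset.chain_def)
  qed
  then obtain K where K: "K \<in> A" "\<And>L. L \<in> A \<Longrightarrow> K \<subseteq> L \<Longrightarrow> L = K" by blast
  have "maximalideal K R"
  proof (rule maximalidealI)
    show "ideal K R" using K(1) by (simp add: A_def)
    show "carrier R \<noteq> K" using K(1) by (auto simp: A_def)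
    fix L assume L: "ideal L R" "K \<subseteq> L" "L \<subseteq> carrier R"
    show "L = K \<or> L = carrier R"
    proof (cases "\<one>\<^bsub>R\<^esub> \<in> L")
      case True
      then show ?thesis using ideal.one_imp_carrier[OF L(1)] by simp
    next
      case False
      then have "L \<in> A" using L K(1) by (auto simp: A_def)
      then show ?thesis using K(2) L(2) by blast
    qed
  qed
  then show ?thesis using K(1) by (auto simp: A_def)
qed

lemma maximalideal_max_ideal:
  assumes "local_ring R" shows "maximalideal (max_ideal R) R" "\<And>K. maximalideal K R \<Longrightarrow> K = max_ideal R"
proof -
  interpret local_ring R by fact
  have *: "\<exists>!m. maximalideal m R" by (rule unique_maximal)
  show "maximalideal (max_ideal R) R" unfolding max_ideal_def by (rule theI'[OF *])
  then show "\<And>K. maximalideal K R \<Longrightarrow> K = max_ideal R" using * by blast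
qed

lemma one_minus_unit:
  assumes "local_ring R" "noetherian_ring R" and c: "c \<in> max_ideal R"
  obtains u where "u \<in> carrier R" "u \<otimes>\<^bsub>R\<^esub> (\<one>\<^bsub>R\<^esub> \<ominus>\<^bsub>R\<^esub> c) = \<one>\<^bsub>R\<^esub>"
proof -
  interpret local_ring R by fact
  interpret m: maximalideal "max_ideal R" R by (rule maximalideal_max_ideal[OF assms(1)])
  have cR: "c \<in> carrier R" using c m.a_subset by blast
  define d where "d = \<one>\<^bsub>R\<^esub> \<ominus>\<^bsub>R\<^esub> c"
  have d: "d \<in> carrier R" using cR by (simp add: d_def)
  have "\<one>\<^bsub>R\<^esub> \<in> PIdl\<^bsub>R\<^esub> d"
  proof (rule ccontr)
    assume "\<one>\<^bsub>R\<^esub> \<notin> PIdl\<^bsub>R\<^esub> d"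
    then obtain K where K: "maximalideal K R" "PIdl\<^bsub>R\<^esub> d \<subseteq> K"
      using ex_maximalideal[OF is_cring assms(2) cgenideal_ideal[OF d]] by blast
    then have "d \<in> max_ideal R"
      using maximalideal_max_ideal(2)[OF assms(1) K(1)] cgenideal_self[OF d] by blast
    then have "d \<oplus>\<^bsub>R\<^esub> c \<in> max_ideal R" using c by (rule m.a_closed)
    then have "\<one>\<^bsub>R\<^esub> \<in> max_ideal R" unfolding d_def using add_minus_cancel(3)[of "\<one>\<^bsub>R\<^esub>" c] cR by simp
    then show False using m.one_imp_carrier m.I_notcarr by simp
  qed
  then obtain u where "u \<in> carrier R" "\<one>\<^bsub>R\<^esub> = u \<otimes>\<^bsub>R\<^esub> d" by (auto simp: cgenideal_def)
  then show thesis by (intro that[of u]) (simp_all add: d_def)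
qed

text \<open>The last hypothesis says that the span \<open>N\<close> of \<open>G\<close> is contained in \<open>m N\<close>. It makes a generator \<open>g\<close> congruent
  to \<open>c g\<close> with \<open>c \<in> m\<close> modulo the other ones. As \<open>1 - c\<close> is a unit, \<open>g\<close> can be discarded.\<close>

lemma nakayama:
  assumes "local_ring R" "noetherian_ring R" "module R M"
    and "finite G" "G \<subseteq> carrier M"
    and "\<And>H. submodule H R M \<Longrightarrow>
      (\<And>c y. c \<in> max_ideal R \<Longrightarrow> y \<in> module_span R M G \<Longrightarrow> c \<odot>\<^bsub>M\<^esub> y \<in> H) \<Longrightarrow> module_span R M G \<subseteq> H"
  shows "module_span R M G = {\<zero>\<^bsub>M\<^esub>}"
proof -
  interpret R: local_ring R by fact
  interpret m: maximalideal "max_ideal R" R by (rule maximalideal_max_ideal[OF assms(1)])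
  interpret M: module R M by fact
  have N: "module R (regular_module R)" by (rule module_regular[OF R.is_cring])
  show ?thesis
    using assms(4-6)
  proof (induction G rule: finite_induct)
    case empty
    show ?case by (rule M.span_empty)
  next
    case (insert g G)
    have g: "g \<in> carrier M" and G: "G \<subseteq> carrier M" using insert by auto
    let ?S = "module_span R M G" and ?I = "(\<lambda>c. c \<odot>\<^bsub>M\<^esub> g) ` max_ideal R"
    note S = M.submodule_span[OF G]
    note S' = M.submoduleD[OF S]
    have f: "(\<lambda>c. c \<odot>\<^bsub>M\<^esub> g) \<in> mod_hom R (regular_module R) M"
      using g by (auto simp: mod_hom_iff M.smult_l_distr M.smult_assoc1)
    have I: "submodule ?I R M"
      by (rule submodule_image[OF f N assms(3)]) (simp add: submodule_regular_iff[OF R.is_cring] m.is_ideal)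
    have H: "submodule (?I <+>\<^bsub>M\<^esub> ?S) R M" by (rule M.submodule_set_add[OF I S])
    have "module_span R M (insert g G) \<subseteq> ?I <+>\<^bsub>M\<^esub> ?S"
    proof (rule insert.prems(2)[OF H])
      fix c y assume c: "c \<in> max_ideal R" and "y \<in> module_span R M (insert g G)"
      then obtain r w where rw: "r \<in> carrier R" "w \<in> ?S" "y = r \<odot>\<^bsub>M\<^esub> g \<oplus>\<^bsub>M\<^esub> w"
        unfolding M.span_insert[OF g G] M.mem_set_add by blast
      have cR: "c \<in> carrier R" using c m.a_subset by blast
      have "c \<odot>\<^bsub>M\<^esub> y = (c \<otimes>\<^bsub>R\<^esub> r) \<odot>\<^bsub>M\<^esub> g \<oplus>\<^bsub>M\<^esub> c \<odot>\<^bsub>M\<^esub> w"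
        using rw cR g S'(2) by (simp add: M.smult_r_distr M.smult_assoc1)
      moreover have "c \<otimes>\<^bsub>R\<^esub> r \<in> max_ideal R" using c rw(1) by (rule m.I_r_closed)
      moreover have "c \<odot>\<^bsub>M\<^esub> w \<in> ?S" using cR rw(2) by (rule S'(6))
      ultimately show "c \<odot>\<^bsub>M\<^esub> y \<in> ?I <+>\<^bsub>M\<^esub> ?S" unfolding M.mem_set_add by blast
    qed
    then have "g \<in> ?I <+>\<^bsub>M\<^esub> ?S" using M.span_superset[of "insert g G"] by blast
    then obtain c w where cw: "c \<in> max_ideal R" "w \<in> ?S" "g = c \<odot>\<^bsub>M\<^esub> g \<oplus>\<^bsub>M\<^esub> w"
      unfolding M.mem_set_add by blast
    have cR: "c \<in> carrier R" using cw(1) m.a_subset by blast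
    obtain u where u: "u \<in> carrier R" "u \<otimes>\<^bsub>R\<^esub> (\<one>\<^bsub>R\<^esub> \<ominus>\<^bsub>R\<^esub> c) = \<one>\<^bsub>R\<^esub>"
      using one_minus_unit[OF assms(1,2) cw(1)] .
    have "(\<one>\<^bsub>R\<^esub> \<ominus>\<^bsub>R\<^esub> c) \<odot>\<^bsub>M\<^esub> g = g \<ominus>\<^bsub>M\<^esub> c \<odot>\<^bsub>M\<^esub> g"
      using cR g by (simp add: a_minus_def M.smult_l_distr M.smult_l_minus)
    also have "\<dots> = w"
    proof -
      have "(c \<odot>\<^bsub>M\<^esub> g \<oplus>\<^bsub>M\<^esub> w) \<ominus>\<^bsub>M\<^esub> c \<odot>\<^bsub>M\<^esub> g = w"
        using cR g S'(2)[OF cw(2)] by (intro M.M.add_minus_cancel(1)) auto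
      then show ?thesis using cw(3) by simp
    qed
    finally have "u \<odot>\<^bsub>M\<^esub> w = u \<odot>\<^bsub>M\<^esub> ((\<one>\<^bsub>R\<^esub> \<ominus>\<^bsub>R\<^esub> c) \<odot>\<^bsub>M\<^esub> g)" by simp
    also have "\<dots> = (u \<otimes>\<^bsub>R\<^esub> (\<one>\<^bsub>R\<^esub> \<ominus>\<^bsub>R\<^esub> c)) \<odot>\<^bsub>M\<^esub> g"
      using u(1) cR g by (intro M.smult_assoc1[symmetric]) auto
    also have "\<dots> = g" using u(2) g by simp
    finally have "g \<in> ?S" using S'(6)[OF u(1) cw(2)] by simp
    then have "module_span R M (insert g G) \<subseteq> ?S"
      using M.span_superset[of G] by (intro M.span_least S) auto
    then have eq: "module_span R M (insert g G) = ?S"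
      using M.span_mono[of G "insert g G"] insert.prems(1) by blast
    show ?case unfolding eq
    proof (rule insert.IH[OF G])
      fix H assume "submodule H R M" "\<And>c y. c \<in> max_ideal R \<Longrightarrow> y \<in> ?S \<Longrightarrow> c \<odot>\<^bsub>M\<^esub> y \<in> H"
      then show "?S \<subseteq> H" using insert.prems(2)[of H] unfolding eq by blast
    qed
  qed
qed


section \<open>Homomorphisms out of free modules\<close>

lemma unit_vec_closed: "cring R \<Longrightarrow> unit_vec R n i \<in> carrier (free_mod R n)"
proof -
  assume "cring R"
  then interpret R: cring R .
  show ?thesis by (auto simp: single_def)
qed

lemma hom_free_eq_lincomb:
  assumes R: "cring R" and Y: "module R Y" and g: "g \<in> mod_hom R (free_mod R n) Y" and x: "x \<in> carrier (free_mod R n)"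
  shows "g x = lincomb Y n x (\<lambda>i\<in>{..<n}. g (unit_vec R n i))"
proof -
  have id: "id_mat R n \<in> {..<n} \<rightarrow> carrier (free_mod R n)" using id_mat_closed[OF R] by (auto simp del: free_mod_simps)
  have "g x = g (lincomb (free_mod R n) n x (id_mat R n))" using lincomb_id[OF R x] by simp
  also have "\<dots> = lincomb Y n x (\<lambda>i\<in>{..<n}. g (id_mat R n i))"
    by (rule lincomb_natural[OF g module_free[OF R] Y x id])
  also have "(\<lambda>i\<in>{..<n}. g (id_mat R n i)) = (\<lambda>i\<in>{..<n}. g (unit_vec R n i))"
    by (auto simp: id_mat_def fun_eq_iff)
  finally show ?thesis .
qed

lemma free_lift:
  assumes R: "cring R" and X: "module R X" and Y: "module R Y" and f: "f \<in> mod_hom R X Y"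
    and g: "g \<in> mod_hom R (free_mod R n) Y" and sub: "\<And>x. x \<in> carrier (free_mod R n) \<Longrightarrow> g x \<in> f ` carrier X"
  obtains h where "h \<in> mod_hom R (free_mod R n) X" "\<And>x. x \<in> carrier (free_mod R n) \<Longrightarrow> f (h x) = g x"
proof -
  interpret X: module R X by (rule X)
  have "\<forall>i. \<exists>z. z \<in> carrier X \<and> f z = g (unit_vec R n i)" using sub[OF unit_vec_closed[OF R]] by (metis imageE)
  then obtain z where z: "\<And>i. z i \<in> carrier X" "\<And>i. f (z i) = g (unit_vec R n i)" by metis
  define z' where "z' = (\<lambda>i\<in>{..<n}. z i)"
  have z': "z' \<in> carrier (pow_mod X n)" using z(1) by (auto simp: z'_def)
  show thesis
  proof (rule that[OF X.lincomb_hom_left[OF z']])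
    fix x assume x: "x \<in> carrier (free_mod R n)"
    have "f (lincomb X n x z') = lincomb Y n x (\<lambda>i\<in>{..<n}. f (z' i))"
      using z' by (intro lincomb_natural[OF f X Y x]) auto
    also have "(\<lambda>i\<in>{..<n}. f (z' i)) = (\<lambda>i\<in>{..<n}. g (unit_vec R n i))"
      using z(2) by (auto simp: z'_def fun_eq_iff)
    finally show "f (lincomb X n x z') = g x" unfolding hom_free_eq_lincomb[OF R Y g x] .
  qed
qed

definition mat_of :: "('a, 'r) ring_scheme \<Rightarrow> nat \<Rightarrow> ((nat \<Rightarrow> 'a) \<Rightarrow> nat \<Rightarrow> 'a) \<Rightarrow> nat \<Rightarrow> nat \<Rightarrow> 'a"
  where "mat_of R n \<alpha> = (\<lambda>i\<in>{..<n}. \<lambda>j\<in>{..<n}. \<alpha> (unit_vec R n j) i)"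

lemma lincomb_regular_commute:
  assumes R: "cring R" and "x \<in> carrier (free_mod R n)" "y \<in> carrier (free_mod R n)"
  shows "lincomb (regular_module R) n x y = lincomb (regular_module R) n y x"
proof -
  interpret R: cring R by fact
  interpret M: module R "regular_module R" by (rule module_regular[OF R])
  show ?thesis unfolding lincomb_def using assms(2,3)
    by (intro M.M.finsum_cong') (auto simp: PiE_iff R.m_comm)
qed

lemma mat_of:
  assumes R: "cring R" and \<alpha>: "\<alpha> \<in> mod_hom R (free_mod R n) (free_mod R n)"
  shows "mat_of R n \<alpha> \<in> mats R n"
    and "\<And>z. z \<in> carrier (free_mod R n) \<Longrightarrow> mat_act (regular_module R) n (mat_of R n \<alpha>) z = \<alpha> z"
proof -
  have F: "module R (free_mod R n)" by (rule module_free[OF R])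
  have col: "\<alpha> (unit_vec R n j) \<in> carrier (free_mod R n)" for j by (rule mod_homD(1)[OF \<alpha> unit_vec_closed[OF R]])
  show 1: "mat_of R n \<alpha> \<in> mats R n" using col by (auto simp: mat_of_def PiE_iff)
  fix z assume z: "z \<in> carrier (free_mod R n)"
  have "mat_act (regular_module R) n (mat_of R n \<alpha>) z \<in> carrier (pow_mod (regular_module R) n)"
    using mod_homD(1)[OF mat_act_hom[OF module_regular[OF R] 1]] z by simp
  moreover have "\<alpha> z \<in> carrier (pow_mod (regular_module R) n)" using mod_homD(1)[OF \<alpha> z] by simp
  moreover have "mat_act (regular_module R) n (mat_of R n \<alpha>) z i = \<alpha> z i" if i: "i < n" for i
  proof -
    let ?c = "\<lambda>j\<in>{..<n}. \<alpha> (unit_vec R n j)"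
    have row: "mat_of R n \<alpha> i \<in> carrier (free_mod R n)" by (rule free_mod_carrier_row[OF 1 i])
    have "\<alpha> z i = lincomb (free_mod R n) n z ?c i" using hom_free_eq_lincomb[OF R F \<alpha> z] by simp
    also have "\<dots> = lincomb (regular_module R) n z (\<lambda>j\<in>{..<n}. ?c j i)"
      using col by (intro lincomb_natural[OF proj_hom[OF i] F module_regular[OF R] z]) (auto simp del: free_mod_simps)
    also have "(\<lambda>j\<in>{..<n}. ?c j i) = mat_of R n \<alpha> i" using i by (auto simp: mat_of_def fun_eq_iff)
    also have "lincomb (regular_module R) n z (mat_of R n \<alpha> i) = lincomb (regular_module R) n (mat_of R n \<alpha> i) z"
      by (rule lincomb_regular_commute[OF R z row])
    finally show ?thesis using i by (simp add: mat_act_def)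
  qed
  ultimately show "mat_act (regular_module R) n (mat_of R n \<alpha>) z = \<alpha> z" by (rule pow_mod_eqI)
qed

lemma lincomb_regular_unit_vec:
  assumes R: "cring R" and x: "x \<in> carrier (free_mod R n)" and j: "j < n"
  shows "lincomb (regular_module R) n x (unit_vec R n j) = x j"
proof -
  interpret M: module R "regular_module R" by (rule module_regular[OF R])
  have x': "x \<in> carrier (pow_mod (regular_module R) n)" using x by simp
  show ?thesis using lincomb_regular_commute[OF R x unit_vec_closed[OF R]] M.lincomb_unit_vec[OF x' j] by simp
qed

lemma mat_eqI:
  assumes R: "cring R" and A: "A \<in> mats R n" and B: "B \<in> mats R n"
    and eq: "\<And>z. z \<in> carrier (free_mod R n) \<Longrightarrow> mat_act (regular_module R) n A z = mat_act (regular_module R) n B z"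
  shows "A = B"
proof -
  have "A i j = B i j" if i: "i < n" and j: "j < n" for i j
    using fun_cong[OF eq[OF unit_vec_closed[OF R, of n j]], of i] i
      lincomb_regular_unit_vec[OF R free_mod_carrier_row[OF A i] j]
      lincomb_regular_unit_vec[OF R free_mod_carrier_row[OF B i] j]
    by (simp add: mat_act_def)
  then show ?thesis using A B
    by (intro pow_mod_eqI[of A "free_mod R n" n B] pow_mod_eqI[of _ "regular_module R" n]) (auto simp: PiE_iff)
qed


section \<open>Rigidity\<close>

lemma a_kernel_eq: "a_kernel X Y f = {x \<in> carrier X. f x = \<zero>\<^bsub>Y\<^esub>}"
  by (simp add: a_kernel_def kernel_def)

lemma zero_hom:
  assumes "module R X" "module R Y"
  shows "(\<lambda>x\<in>carrier X. \<zero>\<^bsub>Y\<^esub>) \<in> mod_hom R X Y"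
proof -
  interpret X: module R X by fact
  interpret Y: module R Y by fact
  show ?thesis by (auto simp: mod_hom_iff)
qed

text \<open>For a surjective \<open>e\<close> this is the vanishing of \<open>Ext\<^sup>1(M, M)\<close>, by the long exact sequence of the presentation.\<close>

definition hom_extends ::
  "('a, 'r) ring_scheme \<Rightarrow> ('a, 'm, 'c) module_scheme \<Rightarrow> nat \<Rightarrow> ((nat \<Rightarrow> 'a) \<Rightarrow> 'm) \<Rightarrow> bool"
  where "hom_extends R M m e \<longleftrightarrow>
    (\<forall>\<psi>\<in>mod_hom R ((free_mod R m)\<lparr>carrier := a_kernel (free_mod R m) M e\<rparr>) M.
      \<exists>\<chi>\<in>mod_hom R (free_mod R m) M. \<forall>x\<in>a_kernel (free_mod R m) M e. \<chi> x = \<psi> x)"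

text \<open>Composing with the first differential turns homomorphisms from the first syzygy into \<open>1\<close>-cocycles, and a
  cobounding \<open>0\<close>-cochain is an extension to the free module.\<close>

lemma rigid_hom_extends:
  assumes R: "cring R" and M: "module R M" and rig: "rigid R M"
  obtains m e where "e \<in> mod_hom R (free_mod R m) M" "e ` carrier (free_mod R m) = carrier M" "hom_extends R M m e"
proof -
  interpret M: module R M by (rule M)
  obtain F where F: "free_resolution R M F" "carrier (ext_module R F M 1) = {\<zero>\<^bsub>ext_module R F M 1\<^esub>}"
    using rig by (auto simp: rigid_def)
  let ?e = "res_aug F" and ?d1 = "res_diff F 1" and ?d2 = "res_diff F 2"
  let ?F0 = "res_mod R F 0" and ?F1 = "res_mod R F 1" and ?F2 = "res_mod R F 2"
  have e: "?e \<in> mod_hom R ?F0 M" "?e ` carrier ?F0 = carrier M" and d1: "?d1 \<in> mod_hom R ?F1 ?F0"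
    and d2: "?d2 \<in> mod_hom R ?F2 ?F1"
    and im1: "?d1 ` carrier ?F1 = a_kernel ?F0 M ?e" and im2: "?d2 ` carrier ?F2 = a_kernel ?F1 ?F0 ?d1"
    using F(1) by (simp_all add: free_resolution_def numeral_2_eq_2)
  have modF: "module R (res_mod R F i)" for i unfolding res_mod_def by (rule module_free[OF R])
  have cocycle: "f \<in> coboundaries R F M 1"
    if f: "f \<in> mod_hom R ?F1 M" "f \<in> extensional (carrier ?F1)" "\<And>x. x \<in> carrier ?F2 \<Longrightarrow> f (?d2 x) = \<zero>\<^bsub>M\<^esub>" for f
  proof -
    let ?C = "cochains R F M 1" and ?B = "coboundaries R F M 1"
    let ?K = "a_kernel ?C (cochains R F M 2) (codiff R F 1)"
    have fK: "f \<in> ?K"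
      using f by (auto simp: a_kernel_eq cochains_def hom_module_def codiff_def numeral_2_eq_2 fun_eq_iff)
    have zB: "(\<lambda>x\<in>carrier ?F1. \<zero>\<^bsub>M\<^esub>) \<in> ?B"
    proof -
      have "(\<lambda>x\<in>carrier ?F0. \<zero>\<^bsub>M\<^esub>) \<in> carrier (cochains R F M 0)"
        using zero_hom[OF modF M] by (simp add: cochains_def hom_module_def)
      then have "codiff R F 0 (\<lambda>x\<in>carrier ?F0. \<zero>\<^bsub>M\<^esub>) \<in> ?B" by simp
      moreover have "codiff R F 0 (\<lambda>x\<in>carrier ?F0. \<zero>\<^bsub>M\<^esub>) = (\<lambda>x\<in>carrier ?F1. \<zero>\<^bsub>M\<^esub>)"
        using mod_homD(1)[OF d1] by (auto simp: codiff_def fun_eq_iff)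
      ultimately show ?thesis by simp
    qed
    have ext: "carrier (ext_module R F M 1) = (\<Union>a\<in>?K. {?B +>\<^bsub>?C\<^esub> a})"
      unfolding ext_module_def quotient_module_def A_RCOSETS_def'
      by (simp add: a_r_coset_def' numeral_2_eq_2)
    have z: "\<zero>\<^bsub>ext_module R F M 1\<^esub> = ?B" by (simp add: ext_module_def quotient_module_def)
    have "?B +>\<^bsub>?C\<^esub> f \<in> {?B}" using F(2) fK unfolding ext z by blast
    then have "?B +>\<^bsub>?C\<^esub> f = ?B" by blast
    moreover have "(\<lambda>x\<in>carrier ?F1. \<zero>\<^bsub>M\<^esub>) \<oplus>\<^bsub>?C\<^esub> f \<in> ?B +>\<^bsub>?C\<^esub> f"
      using zB unfolding a_r_coset_def' by blast
    moreover have "(\<lambda>x\<in>carrier ?F1. \<zero>\<^bsub>M\<^esub>) \<oplus>\<^bsub>?C\<^esub> f = f"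
      using f(2) mod_homD(1)[OF f(1)] by (auto simp: cochains_def hom_module_def fun_eq_iff extensional_def)
    ultimately show ?thesis by simp
  qed
  have "hom_extends R M (res_rank F 0) ?e"
    unfolding hom_extends_def res_mod_def[symmetric]
  proof
    let ?K = "a_kernel ?F0 M ?e"
    fix \<psi> assume \<psi>: "\<psi> \<in> mod_hom R (?F0\<lparr>carrier := ?K\<rparr>) M"
    note h\<psi> = mod_homD[OF \<psi>]
    define f where "f = restrict (\<psi> \<circ> ?d1) (carrier ?F1)"
    have dK: "?d1 x \<in> ?K" if "x \<in> carrier ?F1" for x using im1 that by blast
    have "f \<in> coboundaries R F M 1"
    proof (rule cocycle)
      interpret F1: module R ?F1 by (rule modF)
      have feq: "f x = \<psi> (?d1 x)" if "x \<in> carrier ?F1" for x using that by (simp add: f_def)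
      note h1 = mod_homD[OF d1]
      show "f \<in> mod_hom R ?F1 M"
        unfolding mod_hom_iff
      proof (intro conjI ballI)
        fix x y assume x: "x \<in> carrier ?F1" and y: "y \<in> carrier ?F1"
        show "f y \<in> carrier M" unfolding feq[OF y] using h\<psi>(1) dK[OF y] by simp
        show "f (x \<oplus>\<^bsub>?F1\<^esub> y) = f x \<oplus>\<^bsub>M\<^esub> f y"
          unfolding feq[OF x] feq[OF y] feq[OF F1.M.a_closed[OF x y]] h1(2)[OF x y]
          using h\<psi>(2) dK[OF x] dK[OF y] by simp
      next
        fix a x assume a: "a \<in> carrier R" and x: "x \<in> carrier ?F1"
        show "f (a \<odot>\<^bsub>?F1\<^esub> x) = a \<odot>\<^bsub>M\<^esub> f x"
          unfolding feq[OF x] feq[OF F1.smult_closed[OF a x]] h1(3)[OF a x]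
          using h\<psi>(3) dK[OF x] a by simp
      qed
      show "f \<in> extensional (carrier ?F1)" by (simp add: f_def)
      fix x assume x: "x \<in> carrier ?F2"
      have "?d2 x \<in> a_kernel ?F1 ?F0 ?d1" using im2 x by blast
      then have "f (?d2 x) = \<psi> \<zero>\<^bsub>?F0\<^esub>" by (auto simp: f_def a_kernel_eq)
      also have "\<dots> = \<zero>\<^bsub>M\<^esub>"
      proof -
        have "submodule ?K R ?F0"
          unfolding im1[symmetric] by (rule submodule_image[OF d1 modF modF module.carrier_is_submodule[OF modF]])
        then have "module R (?F0\<lparr>carrier := ?K\<rparr>)" using submodule.submodule_is_module[OF _ modF] by blast
        then show ?thesis using mod_hom_zero[OF \<psi> _ M] by simp
      qed
      finally show "f (?d2 x) = \<zero>\<^bsub>M\<^esub>" .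
    qed
    then have "f \<in> codiff R F 0 ` carrier (cochains R F M 0)" by simp
    then obtain \<chi> where \<chi>: "\<chi> \<in> carrier (cochains R F M 0)" "f = codiff R F 0 \<chi>" by blast
    have "\<chi> \<in> mod_hom R ?F0 M" using \<chi>(1) by (simp add: cochains_def hom_module_def)
    moreover have "\<chi> x = \<psi> x" if "x \<in> ?K" for x
    proof -
      have "x \<in> ?d1 ` carrier ?F1" unfolding im1 by (rule that)
      then obtain y where y: "y \<in> carrier ?F1" "x = ?d1 y" by blast
      then show ?thesis using fun_cong[OF \<chi>(2), of y] by (simp add: f_def codiff_def)
    qed
    ultimately show "\<exists>\<chi>\<in>mod_hom R ?F0 M. \<forall>x\<in>?K. \<chi> x = \<psi> x" by blast
  qed
  then show thesis using e that unfolding res_mod_def by blast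
qed

text \<open>Vanishing of \<open>Ext\<^sup>1\<close> does not depend on the presentation: comparison maps \<open>f\<close>, \<open>g\<close> between the two
  presentations turn an extension problem for the second one into one for the first one, and
  \<open>g f - id\<close> takes values in the kernel, so that the difference is defined on the whole free module.\<close>

lemma hom_extends_independent:
  assumes R: "cring R" and M: "module R M"
    and e: "e \<in> mod_hom R (free_mod R m) M" "e ` carrier (free_mod R m) = carrier M" "hom_extends R M m e"
    and e': "e' \<in> mod_hom R (free_mod R m') M" "e' ` carrier (free_mod R m') = carrier M"
  shows "hom_extends R M m' e'"
  unfolding hom_extends_def
proof
  interpret M: module R M by (rule M)
  let ?F = "free_mod R m" and ?F' = "free_mod R m'"
  let ?K = "a_kernel ?F M e" and ?K' = "a_kernel ?F' M e'"
  have F: "module R ?F" and F': "module R ?F'" using module_free[OF R] by auto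
  interpret F': module R ?F' by (rule F')
  fix \<psi> assume \<psi>: "\<psi> \<in> mod_hom R (?F'\<lparr>carrier := ?K'\<rparr>) M"
  obtain f where f: "f \<in> mod_hom R ?F' ?F" "\<And>x. x \<in> carrier ?F' \<Longrightarrow> e (f x) = e' x"
    using free_lift[OF R F M e(1) e'(1)] mod_homD(1)[OF e'(1)] unfolding e(2) by blast
  obtain g where g: "g \<in> mod_hom R ?F ?F'" "\<And>x. x \<in> carrier ?F \<Longrightarrow> e' (g x) = e x"
    using free_lift[OF R F' M e'(1) e(1)] mod_homD(1)[OF e(1)] unfolding e'(2) by blast
  let ?\<delta> = "\<lambda>x. g (f x) \<ominus>\<^bsub>?F'\<^esub> x"
  have gf: "(\<lambda>x. g (f x)) \<in> mod_hom R ?F' ?F'" by (rule mod_hom_comp[OF f(1) g(1)])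
  have \<delta>: "?\<delta> \<in> mod_hom R ?F' ?F'" by (rule mod_hom_diff[OF gf mod_hom_id F'])
  have \<delta>K: "?\<delta> x \<in> ?K'" if x: "x \<in> carrier ?F'" for x
  proof -
    have "e' (?\<delta> x) = e' (g (f x)) \<ominus>\<^bsub>M\<^esub> e' x"
      by (rule mod_hom_minus[OF e'(1) F' M mod_homD(1)[OF gf x] x])
    also have "e' (g (f x)) = e' x" unfolding g(2)[OF mod_homD(1)[OF f(1) x]] by (rule f(2)[OF x])
    also have "e' x \<ominus>\<^bsub>M\<^esub> e' x = \<zero>\<^bsub>M\<^esub>" unfolding a_minus_def by (rule M.M.r_neg[OF mod_homD(1)[OF e'(1) x]])
    finally show ?thesis using mod_homD(1)[OF \<delta> x] unfolding a_kernel_eq by blast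
  qed
  have gK: "g x \<in> ?K'" if "x \<in> ?K" for x
    using that mod_homD(1)[OF g(1)] g(2) by (auto simp: a_kernel_eq simp del: free_mod_simps)
  have fK: "f x \<in> ?K" if "x \<in> ?K'" for x
    using that mod_homD(1)[OF f(1)] f(2) by (auto simp: a_kernel_eq simp del: free_mod_simps)
  have Ksub: "?K \<subseteq> carrier ?F" "?K' \<subseteq> carrier ?F'" unfolding a_kernel_eq by blast+
  have "g \<in> mod_hom R (?F\<lparr>carrier := ?K\<rparr>) (?F'\<lparr>carrier := ?K'\<rparr>)"
    using gK by (intro mod_hom_submodule_cod[OF mod_hom_submodule_dom[OF g(1) Ksub(1)]]) (simp add: image_subset_iff)
  note mod_hom_comp[OF this \<psi>]
  from bspec[OF e(3)[unfolded hom_extends_def] this]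
  obtain \<chi> where \<chi>: "\<chi> \<in> mod_hom R ?F M" "\<And>x. x \<in> ?K \<Longrightarrow> \<chi> x = \<psi> (g x)" by blast
  have "?\<delta> \<in> mod_hom R ?F' (?F'\<lparr>carrier := ?K'\<rparr>)"
    by (rule mod_hom_submodule_cod[OF \<delta>]) (rule image_subsetI, rule \<delta>K)
  from mod_hom_diff[OF mod_hom_comp[OF f(1) \<chi>(1)] mod_hom_comp[OF this \<psi>] M]
  have hom: "(\<lambda>x. \<chi> (f x) \<ominus>\<^bsub>M\<^esub> \<psi> (?\<delta> x)) \<in> mod_hom R ?F' M" .
  have eq: "\<chi> (f x) \<ominus>\<^bsub>M\<^esub> \<psi> (?\<delta> x) = \<psi> x" if x: "x \<in> ?K'" for x
  proof -
    have xc: "x \<in> carrier ?F'" using x Ksub(2) by blast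
    have \<psi>c: "\<psi> y \<in> carrier M" if "y \<in> ?K'" for y using mod_homD(1)[OF \<psi>] that by simp
    have "\<psi> (g (f x)) = \<psi> (?\<delta> x \<oplus>\<^bsub>?F'\<^esub> x)"
      using F'.M.add_minus_cancel(3)[OF mod_homD(1)[OF gf xc] xc] by simp
    also have "\<dots> = \<psi> (?\<delta> x) \<oplus>\<^bsub>M\<^esub> \<psi> x" using mod_homD(2)[OF \<psi>] \<delta>K[OF xc] x by (simp del: free_mod_simps)
    finally show ?thesis
      unfolding \<chi>(2)[OF fK[OF x]] using M.M.add_minus_cancel(1)[OF \<psi>c[OF \<delta>K[OF xc]] \<psi>c[OF x]] by simp
  qed
  show "\<exists>\<chi>\<in>mod_hom R ?F' M. \<forall>x\<in>?K'. \<chi> x = \<psi> x"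
    by (rule bexI[OF _ hom], rule ballI, rule eq)
qed


section \<open>Lengths of direct sums and free modules\<close>

lemma direct_sum_simps [simp]:
  "carrier (direct_sum M N) = carrier M \<times> carrier N" "ring.zero (direct_sum M N) = (\<zero>\<^bsub>M\<^esub>, \<zero>\<^bsub>N\<^esub>)"
  "p \<oplus>\<^bsub>direct_sum M N\<^esub> q = (fst p \<oplus>\<^bsub>M\<^esub> fst q, snd p \<oplus>\<^bsub>N\<^esub> snd q)"
  "a \<odot>\<^bsub>direct_sum M N\<^esub> p = (a \<odot>\<^bsub>M\<^esub> fst p, a \<odot>\<^bsub>N\<^esub> snd p)"
  by (simp_all add: direct_sum_def case_prod_beta)

lemma module_direct_sum:
  assumes "module R M" "module R N"
  shows "module R (direct_sum M N)"
proof -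
  interpret M: module R M by fact
  interpret N: module R N by fact
  show ?thesis
  proof (rule moduleI)
    show "cring R" ..
    show "abelian_group (direct_sum M N)"
    proof (rule abelian_groupI)
      fix x assume "x \<in> carrier (direct_sum M N)"
      then show "\<exists>y\<in>carrier (direct_sum M N). y \<oplus>\<^bsub>direct_sum M N\<^esub> x = \<zero>\<^bsub>direct_sum M N\<^esub>"
        by (intro bexI[of _ "(\<ominus>\<^bsub>M\<^esub> fst x, \<ominus>\<^bsub>N\<^esub> snd x)"]) (auto simp: M.M.l_neg N.M.l_neg)
    qed (auto simp: M.M.a_ac N.M.a_ac)
  qed (auto simp: M.smult_l_distr N.smult_l_distr M.smult_r_distr N.smult_r_distr M.smult_assoc1 N.smult_assoc1)
qed

lemma pair_hom:
  "f \<in> mod_hom R X M \<Longrightarrow> g \<in> mod_hom R X N \<Longrightarrow> (\<lambda>x. (f x, g x)) \<in> mod_hom R X (direct_sum M N)"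
  by (simp add: mod_hom_iff)

lemma fst_hom: "f \<in> mod_hom R X (direct_sum M N) \<Longrightarrow> (\<lambda>x. fst (f x)) \<in> mod_hom R X M"
  by (auto simp: mod_hom_iff)

lemma snd_hom: "f \<in> mod_hom R X (direct_sum M N) \<Longrightarrow> (\<lambda>x. snd (f x)) \<in> mod_hom R X N"
  by (auto simp: mod_hom_iff)

lemma mod_hom_weaken_cod:
  "f \<in> mod_hom R X (N\<lparr>carrier := U\<rparr>) \<Longrightarrow> U \<subseteq> carrier N \<Longrightarrow> f \<in> mod_hom R X N"
  by (auto simp: mod_hom_iff)

lemma index_hom_zero:
  assumes f: "f \<in> mod_hom R M N" and M: "module R M" and N: "module R N" and S: "S \<subseteq> carrier R"
    and W: "submodule W R M" and U: "submodule U R M" and WU: "W \<subseteq> U"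
    and ker: "\<And>u. u \<in> U \<Longrightarrow> f u = \<zero>\<^bsub>N\<^esub> \<Longrightarrow> u \<in> W"
  shows "index R S N (f ` U) (f ` W) = index R S M U W"
proof -
  interpret N: module R N by fact
  show ?thesis
    using index_hom[OF f M N S W U WU N.submodule_zero] ker
      N.set_add_zero[OF submodule_image[OF f M N U]] N.set_add_zero[OF submodule_image[OF f M N W]] by simp
qed

abbreviation mod_length :: "('a, 'r) ring_scheme \<Rightarrow> 'a set \<Rightarrow> ('a, 'm, 'c) module_scheme \<Rightarrow> enat"
  where "mod_length R S M \<equiv> index R S M (carrier M) {\<zero>\<^bsub>M\<^esub>}"

lemma mod_length_inj:
  assumes f: "f \<in> mod_hom R M N" and M: "module R M" and N: "module R N" and S: "S \<subseteq> carrier R"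
    and inj: "inj_on f (carrier M)"
  shows "index R S N (f ` carrier M) {\<zero>\<^bsub>N\<^esub>} = mod_length R S M"
proof -
  interpret M: module R M by fact
  have z: "f \<zero>\<^bsub>M\<^esub> = \<zero>\<^bsub>N\<^esub>" by (rule mod_hom_zero[OF f M N])
  have "index R S N (f ` carrier M) (f ` {\<zero>\<^bsub>M\<^esub>}) = mod_length R S M"
  proof (rule index_hom_zero[OF f M N S M.submodule_zero M.carrier_is_submodule])
    fix u assume "u \<in> carrier M" "f u = \<zero>\<^bsub>N\<^esub>"
    then show "u \<in> {\<zero>\<^bsub>M\<^esub>}" using inj_onD[OF inj, of u "\<zero>\<^bsub>M\<^esub>"] z by simp
  qed simp
  then show ?thesis using z by simp
qed

lemma mod_length_short_exact:
  assumes S: "submonoid S R" and M: "module R M" and N: "module R N" and f: "f \<in> mod_hom R M N"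
    and surj: "f ` carrier M = carrier N"
  shows "mod_length R S M = mod_length R S N + index R S M (a_kernel M N f) {\<zero>\<^bsub>M\<^esub>}"
proof -
  interpret M: module R M by fact
  interpret N: module R N by fact
  let ?K = "a_kernel M N f"
  have K: "submodule ?K R M"
    using submodule_vimage[OF f M N M.carrier_is_submodule N.submodule_zero] by (simp add: a_kernel_eq)
  have z: "f \<zero>\<^bsub>M\<^esub> = \<zero>\<^bsub>N\<^esub>" by (rule mod_hom_zero[OF f M N])
  have fK: "f ` ?K = {\<zero>\<^bsub>N\<^esub>}" using M.submoduleD(3)[OF K] z by (auto simp: a_kernel_eq)
  have "index R S N (f ` carrier M) (f ` ?K) = index R S M (carrier M) ?K"
    using M.submoduleD(1)[OF K]
    by (intro index_hom_zero[OF f M N submonoid.subset[OF S] K M.carrier_is_submodule]) (auto simp: a_kernel_eq)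
  moreover have "mod_length R S M = index R S M (carrier M) ?K + index R S M ?K {\<zero>\<^bsub>M\<^esub>}"
    using M.submoduleD[OF K] by (intro M.index_add S M.submodule_zero K M.carrier_is_submodule) auto
  ultimately show ?thesis unfolding fK surj by simp
qed

lemma mod_length_direct_sum:
  assumes S: "submonoid S R" and M: "module R M" and N: "module R N"
  shows "mod_length R S (direct_sum M N) = mod_length R S M + mod_length R S N"
proof -
  interpret M: module R M by fact
  interpret N: module R N by fact
  note D = module_direct_sum[OF M N]
  have f: "(\<lambda>x. fst x) \<in> mod_hom R (direct_sum M N) M" by (rule fst_hom[OF mod_hom_id])
  have g: "(\<lambda>y. (\<zero>\<^bsub>M\<^esub>, y)) \<in> mod_hom R N (direct_sum M N)"
    by (simp add: mod_hom_iff)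
  have 1: "mod_length R S (direct_sum M N) = mod_length R S M +
      index R S (direct_sum M N) (a_kernel (direct_sum M N) M (\<lambda>x. fst x)) {\<zero>\<^bsub>direct_sum M N\<^esub>}"
    by (rule mod_length_short_exact[OF S D M f]) (auto intro!: image_eqI[of _ _ "(_, \<zero>\<^bsub>N\<^esub>)"])
  have "a_kernel (direct_sum M N) M (\<lambda>x. fst x) = (\<lambda>y. (\<zero>\<^bsub>M\<^esub>, y)) ` carrier N" by (auto simp: a_kernel_eq)
  then show ?thesis
    using 1 mod_length_inj[OF g N D submonoid.subset[OF S]] by (simp add: inj_on_def)
qed

lemma mod_length_iso:
  assumes S: "S \<subseteq> carrier R" and M: "module R M" and N: "module R N" and "mod_iso R M N"
  shows "mod_length R S N = mod_length R S M"
proof -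
  obtain f where f: "f \<in> mod_hom R M N" "bij_betw f (carrier M) (carrier N)"
    using assms(4) by (auto simp: mod_iso_def)
  then show ?thesis using mod_length_inj[OF f(1) M N S] by (simp add: bij_betw_def)
qed

lemma index_submodule_self:
  assumes M: "module R M" and S: "S \<subseteq> carrier R" and U: "submodule U R M"
  shows "index R S M U {\<zero>\<^bsub>M\<^esub>} = mod_length R S (M\<lparr>carrier := U\<rparr>)"
proof -
  interpret M: module R M by fact
  have "(\<lambda>x. x) \<in> mod_hom R (M\<lparr>carrier := U\<rparr>) M"
    by (rule mod_hom_submodule_dom[OF mod_hom_id M.submoduleD(1)[OF U]])
  from mod_length_inj[OF this submodule.submodule_is_module[OF U M] M S] show ?thesis by simp
qed

text \<open>The subspaces of vectors that are supported on the first \<open>j\<close> coordinates form a filtration with quotients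
  \<open>R\<close>.\<close>

lemma mod_length_free:
  assumes R: "cring R" and S: "submonoid S R" and r: "mod_length R S (regular_module R) = enat r"
  shows "mod_length R S (free_mod R m) = enat (m * r)"
proof -
  interpret R: cring R by fact
  have F: "module R (free_mod R m)" by (rule module_free[OF R])
  interpret F: module R "free_mod R m" by (rule F)
  have N: "module R (regular_module R)" by (rule module_regular[OF R])
  let ?V = "\<lambda>j. coord_subspace R m {..<j}"
  let ?z = "\<zero>\<^bsub>free_mod R m\<^esub>"
  note V = submodule_coord[OF R]
  have "index R S (free_mod R m) (?V j) {?z} = enat (j * r)" if "j \<le> m" for j
    using that
  proof (induction j)
    case 0
    have "?V 0 = {?z}"
    proof
      show "?V 0 \<subseteq> {?z}"
      proof
        fix x assume x: "x \<in> ?V 0"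
        have "x = ?z" using x by (intro pow_mod_eqI[of _ "regular_module R" m]) (auto simp: coord_subspace_def)
        then show "x \<in> {?z}" by simp
      qed
      show "{?z} \<subseteq> ?V 0" using F.submoduleD(3)[OF V] by blast
    qed
    moreover have "negligible S (free_mod R m) {?z} {?z}"
      using submonoid.one_closed[OF S] F.smult_one[OF F.M.zero_closed] by (force simp: negligible_def simp del: free_mod_simps)
    ultimately show ?case
      using index_eq_0_iff[OF F.submodule_zero F.submodule_zero, of S]
      by (simp add: zero_enat_def del: free_mod_simps)
  next
    case (Suc j)
    then have j: "j < m" by simp
    let ?p = "\<lambda>x. x j"
    have sub: "?V j \<subseteq> ?V (Suc j)" by (auto simp: coord_subspace_def)
    have z: "{?z} \<subseteq> ?V j" using F.submoduleD(3)[OF V] by blast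
    have im: "?p ` ?V (Suc j) = carrier R"
    proof
      show "?p ` ?V (Suc j) \<subseteq> carrier R" using j by (auto simp: coord_subspace_def PiE_iff)
      show "carrier R \<subseteq> ?p ` ?V (Suc j)"
      proof
        fix a assume "a \<in> carrier R"
        then have "single (regular_module R) m j a \<in> ?V (Suc j)" by (auto simp: coord_subspace_def single_def)
        moreover have "a = ?p (single (regular_module R) m j a)" using j by (simp add: single_def)
        ultimately show "a \<in> ?p ` ?V (Suc j)" by blast
      qed
    qed
    have im0: "?p ` ?V j = {\<zero>\<^bsub>R\<^esub>}"
    proof
      show "?p ` ?V j \<subseteq> {\<zero>\<^bsub>R\<^esub>}" using j by (auto simp: coord_subspace_def)
      show "{\<zero>\<^bsub>R\<^esub>} \<subseteq> ?p ` ?V j" using z j by (auto intro!: image_eqI[of _ _ ?z])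
    qed
    have kerp: "u \<in> ?V j" if u: "u \<in> ?V (Suc j)" "u j = \<zero>\<^bsub>regular_module R\<^esub>" for u
    proof -
      have "u i = \<zero>\<^bsub>R\<^esub>" if "i < m" "i \<notin> {..<j}" for i
        using u that by (cases "i = j") (auto simp: coord_subspace_def)
      then show ?thesis using u(1) unfolding coord_subspace_def by blast
    qed
    have "index R S (free_mod R m) (?V (Suc j)) (?V j) = mod_length R S (regular_module R)"
      using index_hom_zero[OF proj_hom[OF j] F N submonoid.subset[OF S] V V sub kerp] unfolding im im0 by simp
    moreover have "index R S (free_mod R m) (?V (Suc j)) {?z} =
        index R S (free_mod R m) (?V (Suc j)) (?V j) + index R S (free_mod R m) (?V j) {?z}"
      by (rule F.index_add[OF S F.submodule_zero V V z sub])
    ultimately show ?case using Suc.IH Suc.prems r by (simp del: free_mod_simps)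
  qed
  from this[of m] show ?thesis
    using coord_subspace_UNIV[of R m] by (simp add: coord_subspace_def cong: conj_cong)
qed

text \<open>Length at a minimal prime of \<open>R\<close> is additive on all finitely generated modules, and \<open>R\<close> has
  nonzero finite length there, so the two free summands make up for the difference of Betti numbers.\<close>

lemma periodic_rank_eq:
  assumes R: "cring R" and noeth: "noetherian_ring R" and one: "\<one>\<^bsub>R\<^esub> \<noteq> \<zero>\<^bsub>R\<^esub>" and M: "module R M"
    and e: "e \<in> mod_hom R (free_mod R b0) M" "e ` carrier (free_mod R b0) = carrier M"
    and d: "d \<in> mod_hom R (free_mod R b1) (free_mod R b0)"
      "d ` carrier (free_mod R b1) = a_kernel (free_mod R b0) M e"
    and Z: "Z = a_kernel (free_mod R b1) (free_mod R b0) d"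
    and iso: "mod_iso R (direct_sum M (free_mod R k)) (direct_sum ((free_mod R b1)\<lparr>carrier := Z\<rparr>) (free_mod R l))"
  shows "b0 + k = b1 + l"
proof -
  interpret R: cring R by fact
  interpret M: module R M by fact
  have F: "module R (free_mod R m)" for m by (rule module_free[OF R])
  have N: "module R (regular_module R)" by (rule module_regular[OF R])
  interpret N: module R "regular_module R" by (rule N)
  obtain S where S: "maximal_mult_set R {\<zero>\<^bsub>R\<^esub>} S" using ex_maximal_mult_set[OF R, of "{\<zero>\<^bsub>R\<^esub>}"] one by auto
  note S' = maximal_mult_setD[OF S]
  have "mod_length R S (regular_module R) \<noteq> \<infinity>"
    using index_ring_finite[OF R noeth S R.zeroideal] by simp
  then obtain r where r: "mod_length R S (regular_module R) = enat r" by auto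
  have "\<not> negligible S (regular_module R) (carrier R) {\<zero>\<^bsub>R\<^esub>}"
    unfolding negligible_def using S'(2,4) by (auto intro!: bexI[of _ "\<one>\<^bsub>R\<^esub>"])
  then have "r \<noteq> 0"
    using index_eq_0_iff[OF N.submodule_zero N.carrier_is_submodule, of S] r by (auto simp: zero_enat_def)
  note len = mod_length_free[OF R S'(1) r]
  have Zs: "submodule Z R (free_mod R b1)"
    using submodule_vimage[OF d(1) F F module.carrier_is_submodule[OF F] module.submodule_zero[OF F]]
    by (simp add: Z a_kernel_eq)
  let ?Z = "(free_mod R b1)\<lparr>carrier := Z\<rparr>"
  have Zm: "module R ?Z" by (rule submodule.submodule_is_module[OF Zs F])
  let ?K = "a_kernel (free_mod R b0) M e"
  have Ks: "submodule ?K R (free_mod R b0)"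
    unfolding d(2)[symmetric] by (rule submodule_image[OF d(1) F F module.carrier_is_submodule[OF F]])
  let ?KM = "(free_mod R b0)\<lparr>carrier := ?K\<rparr>"
  have Km: "module R ?KM" by (rule submodule.submodule_is_module[OF Ks F])
  have "mod_length R S (free_mod R b0) = mod_length R S M + mod_length R S ?KM"
    using mod_length_short_exact[OF S'(1) F M e] index_submodule_self[OF F S'(2) Ks] by simp
  then have 1: "enat (b0 * r) = mod_length R S M + mod_length R S ?KM" unfolding len .
  have d': "d \<in> mod_hom R (free_mod R b1) ?KM" by (rule mod_hom_submodule_cod[OF d(1)]) (use d(2) in blast)
  have "a_kernel (free_mod R b1) ?KM d = Z" by (simp add: Z a_kernel_eq)
  then have "mod_length R S (free_mod R b1) = mod_length R S ?KM + mod_length R S ?Z"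
    using mod_length_short_exact[OF S'(1) F Km d'] index_submodule_self[OF F S'(2) Zs] d(2) by simp
  then have 2: "enat (b1 * r) = mod_length R S ?KM + mod_length R S ?Z" unfolding len .
  have "mod_length R S (direct_sum ?Z (free_mod R l)) = mod_length R S (direct_sum M (free_mod R k))"
    by (rule mod_length_iso[OF S'(2) module_direct_sum[OF M F] module_direct_sum[OF Zm F] iso])
  then have 3: "mod_length R S ?Z + enat (l * r) = mod_length R S M + enat (k * r)"
    unfolding mod_length_direct_sum[OF S'(1) M F] mod_length_direct_sum[OF S'(1) Zm F] len .
  obtain m c z where mcz: "mod_length R S M = enat m" "mod_length R S ?KM = enat c" "mod_length R S ?Z = enat z"
    using 1 2 by (cases "mod_length R S M"; cases "mod_length R S ?KM"; cases "mod_length R S ?Z") auto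
  have "b0 * r = m + c" "b1 * r = c + z" "z + l * r = m + k * r"
    using 1 2 3 unfolding mcz by simp_all
  then have "(b0 + k) * r = (b1 + l) * r" by (simp add: algebra_simps)
  then show ?thesis using \<open>r \<noteq> 0\<close> by simp
qed


section \<open>Splitting coordinate vectors\<close>

definition take_vec :: "nat \<Rightarrow> (nat \<Rightarrow> 'a) \<Rightarrow> nat \<Rightarrow> 'a"
  where "take_vec m x = (\<lambda>i\<in>{..<m}. x i)"

definition drop_vec :: "nat \<Rightarrow> nat \<Rightarrow> (nat \<Rightarrow> 'a) \<Rightarrow> nat \<Rightarrow> 'a"
  where "drop_vec m k x = (\<lambda>i\<in>{..<k}. x (m + i))"

definition join_vec :: "nat \<Rightarrow> nat \<Rightarrow> (nat \<Rightarrow> 'a) \<Rightarrow> (nat \<Rightarrow> 'a) \<Rightarrow> nat \<Rightarrow> 'a"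
  where "join_vec m k x y = (\<lambda>i\<in>{..<m + k}. if i < m then x i else y (i - m))"

lemma take_vec_hom: "take_vec m \<in> mod_hom R (free_mod R (m + k)) (free_mod R m)"
  by (auto simp: mod_hom_iff take_vec_def fun_eq_iff PiE_iff)

lemma drop_vec_hom: "drop_vec m k \<in> mod_hom R (free_mod R (m + k)) (free_mod R k)"
  by (auto simp: mod_hom_iff drop_vec_def fun_eq_iff PiE_iff)

lemma join_vec_closed:
  assumes "x \<in> carrier (free_mod R m)" "y \<in> carrier (free_mod R k)"
  shows "join_vec m k x y \<in> carrier (free_mod R (m + k))"
  using assms by (auto simp: join_vec_def PiE_iff)

lemma join_vec_hom:
  assumes "f \<in> mod_hom R X (free_mod R m)" "g \<in> mod_hom R X (free_mod R k)"
  shows "(\<lambda>x. join_vec m k (f x) (g x)) \<in> mod_hom R X (free_mod R (m + k))"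
  unfolding mod_hom_iff
proof (intro conjI ballI)
  fix x y assume "x \<in> carrier X" "y \<in> carrier X"
  then show "join_vec m k (f y) (g y) \<in> carrier (free_mod R (m + k))"
    using mod_homD(1)[OF assms(1)] mod_homD(1)[OF assms(2)] by (intro join_vec_closed)
  show "join_vec m k (f (x \<oplus>\<^bsub>X\<^esub> y)) (g (x \<oplus>\<^bsub>X\<^esub> y)) =
      join_vec m k (f x) (g x) \<oplus>\<^bsub>free_mod R (m + k)\<^esub> join_vec m k (f y) (g y)"
    using mod_homD(2)[OF assms(1) \<open>x \<in> carrier X\<close> \<open>y \<in> carrier X\<close>] mod_homD(2)[OF assms(2) \<open>x \<in> carrier X\<close> \<open>y \<in> carrier X\<close>]
    by (auto simp: join_vec_def fun_eq_iff)
next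
  fix a x assume "a \<in> carrier R" "x \<in> carrier X"
  then show "join_vec m k (f (a \<odot>\<^bsub>X\<^esub> x)) (g (a \<odot>\<^bsub>X\<^esub> x)) =
      a \<odot>\<^bsub>free_mod R (m + k)\<^esub> join_vec m k (f x) (g x)"
    using mod_homD(3)[OF assms(1)] mod_homD(3)[OF assms(2)]
    by (auto simp: join_vec_def fun_eq_iff)
qed

lemma take_join: "x \<in> carrier (free_mod R m) \<Longrightarrow> take_vec m (join_vec m k x y) = x"
  by (rule pow_mod_eqI[of _ "regular_module R" m]) (auto simp: take_vec_def join_vec_def PiE_iff)

lemma drop_join: "y \<in> carrier (free_mod R k) \<Longrightarrow> drop_vec m k (join_vec m k x y) = y"
  by (rule pow_mod_eqI[of _ "regular_module R" k]) (auto simp: drop_vec_def join_vec_def PiE_iff)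

lemma join_take_drop:
  "z \<in> carrier (free_mod R (m + k)) \<Longrightarrow> join_vec m k (take_vec m z) (drop_vec m k z) = z"
  by (rule pow_mod_eqI[of _ "regular_module R" "m + k"]) (auto simp: take_vec_def drop_vec_def join_vec_def PiE_iff)

lemma join_zero: "join_vec m k \<zero>\<^bsub>free_mod R m\<^esub> \<zero>\<^bsub>free_mod R k\<^esub> = \<zero>\<^bsub>free_mod R (m + k)\<^esub>"
  by (auto simp: join_vec_def fun_eq_iff)


section \<open>The two-periodic complex of square matrices\<close>

text \<open>The module \<open>M\<close> with the beginning of a minimal free resolution and with an isomorphism \<open>\<phi>\<close> that expresses
  periodicity; \<open>Z\<close> is the second syzygy. The two descriptions of \<open>n\<close> are what makes the matrices square.\<close>

locale two_periodic_module =
  fixes R :: "('a, 'r) ring_scheme" and M :: "('a, 'm, 'c) module_scheme"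
    and e :: "(nat \<Rightarrow> 'a) \<Rightarrow> 'm" and d :: "(nat \<Rightarrow> 'a) \<Rightarrow> nat \<Rightarrow> 'a" and b0 b1 k l n :: nat
    and Z :: "(nat \<Rightarrow> 'a) set" and \<phi> :: "'m \<times> (nat \<Rightarrow> 'a) \<Rightarrow> (nat \<Rightarrow> 'a) \<times> (nat \<Rightarrow> 'a)"
  assumes local: "local_ring R" and noeth: "noetherian_ring R" and M: "module R M"
    and e: "e \<in> mod_hom R (free_mod R b0) M" "e ` carrier (free_mod R b0) = carrier M"
    and d: "d \<in> mod_hom R (free_mod R b1) (free_mod R b0)"
      "d ` carrier (free_mod R b1) = a_kernel (free_mod R b0) M e"
    and minimal: "\<And>x i. x \<in> carrier (free_mod R b1) \<Longrightarrow> i < b0 \<Longrightarrow> d x i \<in> max_ideal R"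
    and Z: "Z = a_kernel (free_mod R b1) (free_mod R b0) d"
    and \<phi>: "\<phi> \<in> mod_hom R (direct_sum M (free_mod R k)) (direct_sum ((free_mod R b1)\<lparr>carrier := Z\<rparr>) (free_mod R l))"
      "bij_betw \<phi> (carrier M \<times> carrier (free_mod R k)) (Z \<times> carrier (free_mod R l))"
    and n: "n = b0 + k" "n = b1 + l"
begin

abbreviation "F \<equiv> free_mod R"

text \<open>The resolution is spliced to itself. Vectors in \<open>R\<^sup>n\<close> are split as \<open>R\<^sup>b\<^sup>1 \<oplus> R\<^sup>l\<close> before and as
  \<open>R\<^sup>b\<^sup>0 \<oplus> R\<^sup>k\<close> after \<open>\<alpha>\<close>, and the other way round for \<open>\<beta>\<close>. Hence the cokernel of \<open>\<alpha>\<close> is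
  \<open>M \<oplus> R\<^sup>k\<close>, and \<open>\<beta>\<close> maps it isomorphically onto the kernel \<open>Z \<oplus> R\<^sup>l\<close> of \<open>\<alpha>\<close>.\<close>

definition \<alpha> :: "(nat \<Rightarrow> 'a) \<Rightarrow> nat \<Rightarrow> 'a"
  where "\<alpha> u = join_vec b0 k (d (take_vec b1 u)) \<zero>\<^bsub>F k\<^esub>"

definition \<beta> :: "(nat \<Rightarrow> 'a) \<Rightarrow> nat \<Rightarrow> 'a"
  where "\<beta> w = (let p = \<phi> (e (take_vec b0 w), drop_vec b0 k w) in join_vec b1 l (fst p) (snd p))"

lemma cring: "cring R"
  using local by (simp add: local_ring_def)

lemma F: "module R (F m)"
  by (rule module_free[OF cring])

lemma Z_iff: "x \<in> Z \<longleftrightarrow> x \<in> carrier (F b1) \<and> d x = \<zero>\<^bsub>F b0\<^esub>"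
  unfolding Z a_kernel_eq by simp

lemma Z_sub: "Z \<subseteq> carrier (F b1)"
  using Z_iff by blast

lemma submodule_Z: "submodule Z R (F b1)"
  using submodule_vimage[OF d(1) F F module.carrier_is_submodule[OF F] module.submodule_zero[OF F]]
  by (simp add: Z a_kernel_eq)

lemma ed: "x \<in> carrier (F b1) \<Longrightarrow> e (d x) = \<zero>\<^bsub>M\<^esub>"
  using d(2) unfolding a_kernel_eq by blast

lemma take0: "take_vec b0 \<in> mod_hom R (F n) (F b0)" unfolding n(1) by (rule take_vec_hom)
lemma take1: "take_vec b1 \<in> mod_hom R (F n) (F b1)" unfolding n(2) by (rule take_vec_hom)
lemma drop0: "drop_vec b0 k \<in> mod_hom R (F n) (F k)" unfolding n(1) by (rule drop_vec_hom)
lemma drop1: "drop_vec b1 l \<in> mod_hom R (F n) (F l)" unfolding n(2) by (rule drop_vec_hom)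

lemma zero_closed: "\<zero>\<^bsub>F m\<^esub> \<in> carrier (F m)"
proof -
  interpret F: module R "F m" by (rule F)
  show ?thesis by (rule F.M.zero_closed)
qed

lemma const_zero_hom: "module R X \<Longrightarrow> (\<lambda>x. \<zero>\<^bsub>F m\<^esub>) \<in> mod_hom R X (F m)"
proof -
  assume X: "module R X"
  interpret F: module R "F m" by (rule F)
  show ?thesis
    unfolding mod_hom_iff using F.M.zero_closed F.M.l_zero[OF F.M.zero_closed] by (simp del: free_mod_simps)
qed

lemma join0_hom: "module R X \<Longrightarrow> f \<in> mod_hom R X (F b0) \<Longrightarrow> (\<lambda>x. join_vec b0 k (f x) \<zero>\<^bsub>F k\<^esub>) \<in> mod_hom R X (F n)"
  unfolding n(1) by (rule join_vec_hom[OF _ const_zero_hom])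

lemma \<alpha>_hom: "\<alpha> \<in> mod_hom R (F n) (F n)"
  using join0_hom[OF F mod_hom_comp[OF take1 d(1)]] by (simp add: \<alpha>_def[abs_def])

lemma \<beta>_hom: "\<beta> \<in> mod_hom R (F n) (F n)"
proof -
  have p: "(\<lambda>w. \<phi> (e (take_vec b0 w), drop_vec b0 k w)) \<in> mod_hom R (F n) (direct_sum ((F b1)\<lparr>carrier := Z\<rparr>) (F l))"
    by (rule mod_hom_comp[OF pair_hom[OF mod_hom_comp[OF take0 e(1)] drop0] \<phi>(1)])
  have "(\<lambda>w. join_vec b1 l (fst (\<phi> (e (take_vec b0 w), drop_vec b0 k w))) (snd (\<phi> (e (take_vec b0 w), drop_vec b0 k w))))
      \<in> mod_hom R (F n) (F (b1 + l))"
    by (rule join_vec_hom[OF mod_hom_weaken_cod[OF fst_hom[OF p] Z_sub] snd_hom[OF p]])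
  then show ?thesis unfolding \<beta>_def[abs_def] Let_def n(2)[symmetric] .
qed

lemma \<phi>_closed:
  assumes "w \<in> carrier (F n)"
  shows "fst (\<phi> (e (take_vec b0 w), drop_vec b0 k w)) \<in> Z" "snd (\<phi> (e (take_vec b0 w), drop_vec b0 k w)) \<in> carrier (F l)"
proof -
  have "(e (take_vec b0 w), drop_vec b0 k w) \<in> carrier M \<times> carrier (F k)"
    using mod_homD(1)[OF take0 assms] mod_homD(1)[OF drop0 assms] mod_homD(1)[OF e(1)] by blast
  then have "\<phi> (e (take_vec b0 w), drop_vec b0 k w) \<in> Z \<times> carrier (F l)" using \<phi>(2) unfolding bij_betw_def by blast
  then show "fst (\<phi> (e (take_vec b0 w), drop_vec b0 k w)) \<in> Z" "snd (\<phi> (e (take_vec b0 w), drop_vec b0 k w)) \<in> carrier (F l)"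
    by (auto simp: mem_Times_iff)
qed

lemma \<phi>_zero: "\<phi> (\<zero>\<^bsub>M\<^esub>, \<zero>\<^bsub>F k\<^esub>) = (\<zero>\<^bsub>F b1\<^esub>, \<zero>\<^bsub>F l\<^esub>)"
  using mod_hom_zero[OF \<phi>(1) module_direct_sum[OF M F]
      module_direct_sum[OF submodule.submodule_is_module[OF submodule_Z F] F]] by simp

lemma \<alpha>\<beta>: "w \<in> carrier (F n) \<Longrightarrow> \<alpha> (\<beta> w) = \<zero>\<^bsub>F n\<^esub>"
proof -
  assume w: "w \<in> carrier (F n)"
  note p = \<phi>_closed[OF w]
  have "take_vec b1 (\<beta> w) = fst (\<phi> (e (take_vec b0 w), drop_vec b0 k w))"
    unfolding \<beta>_def Let_def using Z_sub p(1) by (intro take_join) blast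
  then have "d (take_vec b1 (\<beta> w)) = \<zero>\<^bsub>F b0\<^esub>" using p(1) Z_iff by simp
  then show "\<alpha> (\<beta> w) = \<zero>\<^bsub>F n\<^esub>" unfolding \<alpha>_def n(1) by (simp only: join_zero)
qed

lemma take0_\<alpha>: "u \<in> carrier (F n) \<Longrightarrow> take_vec b0 (\<alpha> u) = d (take_vec b1 u)"
  unfolding \<alpha>_def using mod_homD(1)[OF d(1) mod_homD(1)[OF take1]] by (rule take_join)

lemma drop0_\<alpha>: "drop_vec b0 k (\<alpha> u) = \<zero>\<^bsub>F k\<^esub>"
  unfolding \<alpha>_def by (rule drop_join[OF zero_closed])

lemma \<beta>\<alpha>:
  assumes u: "u \<in> carrier (F n)"
  shows "\<beta> (\<alpha> u) = \<zero>\<^bsub>F n\<^esub>"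
  unfolding \<beta>_def Let_def take0_\<alpha>[OF u] drop0_\<alpha> ed[OF mod_homD(1)[OF take1 u]] \<phi>_zero fst_conv snd_conv
  unfolding n(2) by (rule join_zero)

lemma ker_\<alpha>:
  assumes u: "u \<in> carrier (F n)" and z: "\<alpha> u = \<zero>\<^bsub>F n\<^esub>"
  shows "u \<in> \<beta> ` carrier (F n)"
proof -
  have "d (take_vec b1 u) = take_vec b0 \<zero>\<^bsub>F n\<^esub>" using take0_\<alpha>[OF u] z by simp
  also have "\<dots> = \<zero>\<^bsub>F b0\<^esub>" by (rule mod_hom_zero[OF take0 F F])
  finally have "take_vec b1 u \<in> Z" using mod_homD(1)[OF take1 u] Z_iff by blast
  then have "(take_vec b1 u, drop_vec b1 l u) \<in> Z \<times> carrier (F l)" using mod_homD(1)[OF drop1 u] by blast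
  then have "(take_vec b1 u, drop_vec b1 l u) \<in> \<phi> ` (carrier M \<times> carrier (F k))"
    using \<phi>(2) unfolding bij_betw_def by blast
  then obtain m y where my: "m \<in> carrier M" "y \<in> carrier (F k)" "(take_vec b1 u, drop_vec b1 l u) = \<phi> (m, y)" by blast
  have "m \<in> e ` carrier (F b0)" using my(1) e(2) by simp
  then obtain x where x: "x \<in> carrier (F b0)" "m = e x" by blast
  define w where "w = join_vec b0 k x y"
  have w: "w \<in> carrier (F n)" unfolding w_def n(1) by (rule join_vec_closed[OF x(1) my(2)])
  have "\<beta> w = join_vec b1 l (take_vec b1 u) (drop_vec b1 l u)"
    unfolding \<beta>_def w_def take_join[OF x(1)] drop_join[OF my(2)] x(2)[symmetric] my(3)[symmetric] by simp
  also have "\<dots> = u" using u unfolding n(2) by (rule join_take_drop)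
  finally show ?thesis using w by blast
qed

lemma ker_\<beta>':
  assumes w: "w \<in> carrier (F n)" and z: "e (take_vec b0 w) = \<zero>\<^bsub>M\<^esub>" "drop_vec b0 k w = \<zero>\<^bsub>F k\<^esub>"
  shows "w \<in> \<alpha> ` carrier (F n)"
proof -
  have "take_vec b0 w \<in> a_kernel (F b0) M e" using z(1) mod_homD(1)[OF take0 w] unfolding a_kernel_eq by simp
  then have "take_vec b0 w \<in> d ` carrier (F b1)" unfolding d(2) .
  then obtain x where x: "x \<in> carrier (F b1)" "take_vec b0 w = d x" by blast
  define u where "u = join_vec b1 l x \<zero>\<^bsub>F l\<^esub>"
  have u: "u \<in> carrier (F n)" unfolding u_def n(2) by (rule join_vec_closed[OF x(1) zero_closed])
  have "\<alpha> u = join_vec b0 k (take_vec b0 w) (drop_vec b0 k w)"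
    unfolding \<alpha>_def u_def take_join[OF x(1)] z(2) x(2) ..
  also have "\<dots> = w" using w unfolding n(1) by (rule join_take_drop)
  finally show ?thesis using u by blast
qed

lemma ker_\<beta>:
  assumes w: "w \<in> carrier (F n)" and z: "\<beta> w = \<zero>\<^bsub>F n\<^esub>"
  shows "w \<in> \<alpha> ` carrier (F n)"
proof (rule ker_\<beta>'[OF w])
  let ?p = "(e (take_vec b0 w), drop_vec b0 k w)"
  note p = \<phi>_closed[OF w]
  have "fst (\<phi> ?p) = take_vec b1 (\<beta> w)"
    unfolding \<beta>_def Let_def using Z_sub p(1) by (intro take_join[symmetric]) blast
  also have "\<dots> = \<zero>\<^bsub>F b1\<^esub>" unfolding z by (rule mod_hom_zero[OF take1 F F])
  finally have 1: "fst (\<phi> ?p) = \<zero>\<^bsub>F b1\<^esub>" .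
  have "snd (\<phi> ?p) = drop_vec b1 l (\<beta> w)" unfolding \<beta>_def Let_def by (rule drop_join[OF p(2), symmetric])
  also have "\<dots> = \<zero>\<^bsub>F l\<^esub>" unfolding z by (rule mod_hom_zero[OF drop1 F F])
  finally have "\<phi> ?p = \<phi> (\<zero>\<^bsub>M\<^esub>, \<zero>\<^bsub>F k\<^esub>)" using 1 unfolding \<phi>_zero by (simp only: prod_eq_iff fst_conv snd_conv)
  moreover have "?p \<in> carrier M \<times> carrier (F k)"
    using mod_homD(1)[OF take0 w] mod_homD(1)[OF drop0 w] mod_homD(1)[OF e(1)] by blast
  moreover have "(\<zero>\<^bsub>M\<^esub>, \<zero>\<^bsub>F k\<^esub>) \<in> carrier M \<times> carrier (F k)"
    using zero_closed module.submoduleD(3)[OF M module.carrier_is_submodule[OF M]] by blast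
  ultimately have "?p = (\<zero>\<^bsub>M\<^esub>, \<zero>\<^bsub>F k\<^esub>)" using \<phi>(2) unfolding bij_betw_def by (blast dest: inj_onD)
  then show "e (take_vec b0 w) = \<zero>\<^bsub>M\<^esub>" "drop_vec b0 k w = \<zero>\<^bsub>F k\<^esub>" by blast+
qed

definition A where "A = mat_of R n \<alpha>"
definition B where "B = mat_of R n \<beta>"

lemma A: "A \<in> mats R n" and B: "B \<in> mats R n"
  unfolding A_def B_def using mat_of(1)[OF cring] \<alpha>_hom \<beta>_hom by auto

abbreviation "act \<equiv> mat_act (regular_module R) n"

lemma act_A: "u \<in> carrier (F n) \<Longrightarrow> act A u = \<alpha> u" and act_B: "u \<in> carrier (F n) \<Longrightarrow> act B u = \<beta> u"
  unfolding A_def B_def using mat_of(2)[OF cring] \<alpha>_hom \<beta>_hom by auto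

lemma act_mult:
  "C \<in> mats R n \<Longrightarrow> D \<in> mats R n \<Longrightarrow> u \<in> carrier (F n) \<Longrightarrow> act (mat_mult R n C D) u = act C (act D u)"
  by (rule mat_act_assoc[OF cring module_regular[OF cring]]) auto

lemma act_hom: "C \<in> mats R n \<Longrightarrow> act C \<in> mod_hom R (F n) (F n)"
  using mat_act_hom[OF module_regular[OF cring], of C n] by (simp only: free_mod_eq_pow_mod)

lemma act_add:
  "C \<in> mats R n \<Longrightarrow> D \<in> mats R n \<Longrightarrow> u \<in> carrier (F n) \<Longrightarrow>
    act (C \<oplus>\<^bsub>pow_mod (F n) n\<^esub> D) u = act C u \<oplus>\<^bsub>F n\<^esub> act D u"
  using mod_homD(2)[OF mat_act_hom_left[OF module_regular[OF cring]], of u n C D]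
  unfolding free_mod_eq_pow_mod[of R n] by blast

lemma act_zero: "u \<in> carrier (F n) \<Longrightarrow> act \<zero>\<^bsub>pow_mod (F n) n\<^esub> u = \<zero>\<^bsub>F n\<^esub>"
  using mod_hom_zero[OF mat_act_hom_left[OF module_regular[OF cring], of u n] module_pow[OF F] module_pow[OF module_regular[OF cring]]]
  unfolding free_mod_eq_pow_mod[of R n] by blast

lemma mats_zero: "\<zero>\<^bsub>pow_mod (F n) n\<^esub> \<in> mats R n"
proof -
  interpret P: module R "pow_mod (F n) n" by (rule module_pow[OF F])
  show ?thesis by (rule P.M.zero_closed)
qed

lemma AB: "mat_mult R n A B = \<zero>\<^bsub>pow_mod (F n) n\<^esub>"
  by (rule mat_eqI[OF cring mat_mult_closed[OF cring A B] mats_zero])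
    (simp only: act_mult[OF A B] act_B act_A mod_homD(1)[OF \<beta>_hom] \<alpha>\<beta> act_zero)

lemma BA: "mat_mult R n B A = \<zero>\<^bsub>pow_mod (F n) n\<^esub>"
  by (rule mat_eqI[OF cring mat_mult_closed[OF cring B A] mats_zero])
    (simp only: act_mult[OF B A] act_B act_A mod_homD(1)[OF \<alpha>_hom] \<beta>\<alpha> act_zero)

lemma exact_A:
  assumes "z \<in> carrier (F n)" "act A z = \<zero>\<^bsub>F n\<^esub>"
  shows "\<exists>y\<in>carrier (F n). z = act B y"
proof -
  have "\<alpha> z = \<zero>\<^bsub>F n\<^esub>" using assms(2) unfolding act_A[OF assms(1)] .
  then obtain y where y: "y \<in> carrier (F n)" "z = \<beta> y" using ker_\<alpha>[OF assms(1)] by blast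
  have "z = act B y" unfolding act_B[OF y(1)] by (rule y(2))
  then show ?thesis using y(1) by blast
qed

lemma exact_B:
  assumes "z \<in> carrier (F n)" "act B z = \<zero>\<^bsub>F n\<^esub>"
  shows "\<exists>y\<in>carrier (F n). z = act A y"
proof -
  have "\<beta> z = \<zero>\<^bsub>F n\<^esub>" using assms(2) unfolding act_B[OF assms(1)] .
  then obtain y where y: "y \<in> carrier (F n)" "z = \<alpha> y" using ker_\<beta>[OF assms(1)] by blast
  have "z = act A y" unfolding act_A[OF y(1)] by (rule y(2))
  then show ?thesis using y(1) by blast
qed

text \<open>The elements of \<open>R\<close> that annihilate the stable endomorphism ring of \<open>M\<close>.\<close>

definition I :: "'a set"
  where "I = {a \<in> carrier R. \<exists>Y\<in>mats R n. \<exists>Z\<in>mats R n. a \<odot>\<^bsub>pow_mod (F n) n\<^esub> id_mat R n =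
      mat_mult R n Y B \<oplus>\<^bsub>pow_mod (F n) n\<^esub> mat_mult R n A Z}"

lemma ideal_I: "ideal I R"
proof -
  let ?P = "pow_mod (F n) n"
  have P: "module R ?P" by (rule module_pow[OF F])
  interpret P: module R ?P by (rule P)
  have N: "module R (regular_module R)" by (rule module_regular[OF cring])
  interpret N: module R "regular_module R" by (rule N)
  have f: "(\<lambda>a. a \<odot>\<^bsub>?P\<^esub> id_mat R n) \<in> mod_hom R (regular_module R) ?P"
    unfolding mod_hom_iff regular_module_simps
    using P.smult_l_distr P.smult_assoc1 P.smult_closed id_mat_closed[OF cring, of n] by blast
  let ?G = "(\<lambda>Y. mat_mult R n Y B) ` carrier ?P <+>\<^bsub>?P\<^esub> mat_mult R n A ` carrier ?P"
  have G: "submodule ?G R ?P"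
    by (intro P.submodule_set_add submodule_image[OF mat_act_hom_left[OF F B] P P]
        submodule_image[OF mat_act_hom[OF F A] P P] P.carrier_is_submodule)
  have "I = {a \<in> carrier (regular_module R). a \<odot>\<^bsub>?P\<^esub> id_mat R n \<in> ?G}"
    unfolding I_def P.mem_set_add regular_module_simps by blast
  then have "submodule I R (regular_module R)"
    using submodule_vimage[OF f N P N.carrier_is_submodule G] by simp
  then show ?thesis using submodule_regular_iff[OF cring] by blast
qed

text \<open>If \<open>a = YB + AZ\<close> then \<open>aA = AZA\<close>, so \<open>a - ZA\<close> has its columns in \<open>ker A = im B\<close>.\<close>

lemma homotopy_other_side:
  assumes "a \<in> I"
  shows "\<exists>Y\<in>mats R n. \<exists>Z\<in>mats R n. a \<odot>\<^bsub>pow_mod (F n) n\<^esub> id_mat R n =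
      mat_mult R n Y A \<oplus>\<^bsub>pow_mod (F n) n\<^esub> mat_mult R n B Z"
proof -
  let ?P = "pow_mod (F n) n"
  have P: "module R ?P" by (rule module_pow[OF F])
  interpret P: module R ?P by (rule P)
  let ?a = "a \<odot>\<^bsub>?P\<^esub> id_mat R n"
  have aR: "a \<in> carrier R" using assms by (simp add: I_def)
  have aP: "?a \<in> mats R n" by (rule P.smult_closed[OF aR id_mat_closed[OF cring]])
  obtain Y Z where YZ: "Y \<in> mats R n" "Z \<in> mats R n" "?a = mat_mult R n Y B \<oplus>\<^bsub>?P\<^esub> mat_mult R n A Z"
    using assms unfolding I_def by blast
  note mc = mat_mult_closed[OF cring]
  have ZA: "mat_mult R n Z A \<in> mats R n" by (rule mc[OF YZ(2) A])
  note hA = mat_act_hom[OF F A] and hl = mat_act_hom_left[OF F A]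
  have "mat_mult R n ?a A = mat_mult R n (mat_mult R n Y B) A \<oplus>\<^bsub>?P\<^esub> mat_mult R n (mat_mult R n A Z) A"
    unfolding YZ(3) by (rule mod_homD(2)[OF hl mc[OF YZ(1) B] mc[OF A YZ(2)]])
  also have "mat_mult R n (mat_mult R n Y B) A = \<zero>\<^bsub>?P\<^esub>"
    unfolding mat_act_assoc[OF cring F YZ(1) B A] BA by (rule mod_hom_zero[OF mat_act_hom[OF F YZ(1)] P P])
  also have "mat_mult R n (mat_mult R n A Z) A = mat_mult R n A (mat_mult R n Z A)"
    by (rule mat_act_assoc[OF cring F A YZ(2) A])
  also have "\<zero>\<^bsub>?P\<^esub> \<oplus>\<^bsub>?P\<^esub> mat_mult R n A (mat_mult R n Z A) = mat_mult R n A (mat_mult R n Z A)"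
    by (rule P.M.l_zero[OF mc[OF A ZA]])
  finally have 1: "mat_mult R n ?a A = mat_mult R n A (mat_mult R n Z A)" .
  have "mat_mult R n A ?a = a \<odot>\<^bsub>?P\<^esub> A"
    using mod_homD(3)[OF hA aR id_mat_closed[OF cring]] mat_mult_id_right[OF cring A] by simp
  also have "\<dots> = mat_mult R n ?a A"
    using mod_homD(3)[OF hl aR id_mat_closed[OF cring]] mat_act_id[OF F A] by simp
  finally have 2: "mat_mult R n A ?a = mat_mult R n A (mat_mult R n Z A)" using 1 by simp
  define D where "D = ?a \<ominus>\<^bsub>?P\<^esub> mat_mult R n Z A"
  have D: "D \<in> mats R n" unfolding D_def by (rule P.M.minus_closed[OF aP ZA])
  have "mat_mult R n A D = mat_mult R n A ?a \<ominus>\<^bsub>?P\<^esub> mat_mult R n A (mat_mult R n Z A)"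
    unfolding D_def by (rule mod_hom_minus[OF hA P P aP ZA])
  also have "\<dots> = \<zero>\<^bsub>?P\<^esub>" unfolding 2 a_minus_def by (rule P.M.r_neg[OF mc[OF A ZA]])
  finally have AD: "mat_mult R n A D = \<zero>\<^bsub>?P\<^esub>" .
  have "\<exists>V\<in>{..<n} \<rightarrow>\<^sub>E coord_subspace R n UNIV. D = mat_mult R n B V"
    using D AD by (intro exact_columns[OF cring B A exact_A]) (simp_all only: coord_subspace_UNIV pow_mod_simps)
  then obtain V where V: "V \<in> mats R n" "D = mat_mult R n B V" unfolding coord_subspace_UNIV pow_mod_simps by blast
  have "?a = D \<oplus>\<^bsub>?P\<^esub> mat_mult R n Z A" unfolding D_def by (rule P.M.add_minus_cancel(3)[OF aP ZA, symmetric])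
  also have "\<dots> = mat_mult R n Z A \<oplus>\<^bsub>?P\<^esub> mat_mult R n B V"
    unfolding V(2) by (rule P.M.a_comm[OF mc[OF B V(1)] ZA])
  finally show ?thesis using YZ(2) V(1) by blast
qed

lemma exact_periodic:
  assumes "maximal_mult_set R I S"
  shows "exact_periodic_complex R n A B I S"
proof (intro exact_periodic_complex.intro periodic_complex.intro exact_periodic_complex_axioms.intro)
  show "cring R" "noetherian_ring R" "A \<in> mats R n" "B \<in> mats R n" "ideal I R" "maximal_mult_set R I S"
    "mat_mult R n A B = \<zero>\<^bsub>pow_mod (F n) n\<^esub>" "mat_mult R n B A = \<zero>\<^bsub>pow_mod (F n) n\<^esub>"
    by (rule cring noeth A B ideal_I assms AB BA)+
  show "\<And>a. a \<in> I \<Longrightarrow> \<exists>Y\<in>mats R n. \<exists>Z\<in>mats R n. a \<odot>\<^bsub>pow_mod (F n) n\<^esub> id_mat R n =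
      mat_mult R n Y B \<oplus>\<^bsub>pow_mod (F n) n\<^esub> mat_mult R n A Z" unfolding I_def by blast
qed (fact homotopy_other_side exact_A exact_B)+

text \<open>If the identity is null-homotopic, \<open>im A = A(Z(im A))\<close>, while \<open>im A\<close> lies in \<open>m R\<^sup>n\<close> by minimality.
  By Nakayama's lemma \<open>A\<close> vanishes, so the first syzygy is zero.\<close>

lemma free_if_one_in_I:
  assumes "\<one>\<^bsub>R\<^esub> \<in> I"
  shows "is_free R M"
proof -
  let ?P = "pow_mod (F n) n"
  interpret P: module R ?P by (rule module_pow[OF F])
  interpret F: module R "F n" by (rule F)
  interpret F0: module R "F b0" by (rule F)
  interpret M: module R M by (rule M)
  interpret m: maximalideal "max_ideal R" R by (rule maximalideal_max_ideal[OF local])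
  obtain Y V where YV: "Y \<in> mats R n" "V \<in> mats R n" "\<one>\<^bsub>R\<^esub> \<odot>\<^bsub>?P\<^esub> id_mat R n = mat_mult R n Y B \<oplus>\<^bsub>?P\<^esub> mat_mult R n A V"
    using assms unfolding I_def by blast
  have id: "id_mat R n = mat_mult R n Y B \<oplus>\<^bsub>?P\<^esub> mat_mult R n A V"
    using YV(3) P.smult_one[OF id_mat_closed[OF cring]] by simp
  note mc = mat_mult_closed[OF cring]
  let ?\<gamma> = "\<lambda>x. \<alpha> (act V x)"
  have \<gamma>: "?\<gamma> \<in> mod_hom R (F n) (F n)" by (rule mod_hom_comp[OF act_hom[OF YV(2)] \<alpha>_hom])
  have fixed: "?\<gamma> (\<alpha> u) = \<alpha> u" if u: "u \<in> carrier (F n)" for u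
  proof -
    have au: "\<alpha> u \<in> carrier (F n)" by (rule mod_homD(1)[OF \<alpha>_hom u])
    have Va: "act V (\<alpha> u) \<in> carrier (F n)" by (rule mod_homD(1)[OF act_hom[OF YV(2)] au])
    have "\<alpha> u = act (id_mat R n) (\<alpha> u)"
      using mat_act_id[OF module_regular[OF cring], of "\<alpha> u" n] au by simp
    also have "\<dots> = act (mat_mult R n Y B) (\<alpha> u) \<oplus>\<^bsub>F n\<^esub> act (mat_mult R n A V) (\<alpha> u)"
      unfolding id by (rule act_add[OF mc[OF YV(1) B] mc[OF A YV(2)] au])
    also have "act (mat_mult R n Y B) (\<alpha> u) = act Y (act B (\<alpha> u))" by (rule act_mult[OF YV(1) B au])
    also have "act B (\<alpha> u) = \<zero>\<^bsub>F n\<^esub>" unfolding act_B[OF au] by (rule \<beta>\<alpha>[OF u])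
    also have "act Y \<zero>\<^bsub>F n\<^esub> = \<zero>\<^bsub>F n\<^esub>" by (rule mod_hom_zero[OF act_hom[OF YV(1)] F F])
    also have "act (mat_mult R n A V) (\<alpha> u) = act A (act V (\<alpha> u))" by (rule act_mult[OF A YV(2) au])
    also have "\<dots> = ?\<gamma> (\<alpha> u)" by (rule act_A[OF Va])
    also have "\<zero>\<^bsub>F n\<^esub> \<oplus>\<^bsub>F n\<^esub> ?\<gamma> (\<alpha> u) = ?\<gamma> (\<alpha> u)" by (rule F.M.l_zero[OF mod_homD(1)[OF \<gamma> au]])
    finally show ?thesis by (rule sym)
  qed
  let ?N = "\<alpha> ` carrier (F n)"
  have N: "submodule ?N R (F n)" by (rule submodule_image[OF \<alpha>_hom F F F.carrier_is_submodule])
  obtain G where G: "G \<subseteq> ?N" "finite G" "?N = module_span R (F n) G"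
    using noetherian_submodule_fg[OF noeth fg_free[OF cring] N] .
  have entries: "\<alpha> u i \<in> max_ideal R" if u: "u \<in> carrier (F n)" and i: "i < n" for u i
  proof -
    have "d (take_vec b1 u) i \<in> max_ideal R" if "i < b0" by (rule minimal[OF mod_homD(1)[OF take1 u] that])
    moreover have "\<zero>\<^bsub>R\<^esub> \<in> max_ideal R" by (rule m.zero_closed)
    ultimately show ?thesis using i n(1) by (auto simp: \<alpha>_def join_vec_def)
  qed
  have "module_span R (F n) G = {\<zero>\<^bsub>F n\<^esub>}"
  proof (rule nakayama[OF local noeth F G(2)])
    show "G \<subseteq> carrier (F n)" using G(1) F.submoduleD(1)[OF N] by blast
    fix H assume H: "submodule H R (F n)"
      and mH: "\<And>c y. c \<in> max_ideal R \<Longrightarrow> y \<in> module_span R (F n) G \<Longrightarrow> c \<odot>\<^bsub>F n\<^esub> y \<in> H"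
    have "\<alpha> u \<in> H" if u: "u \<in> carrier (F n)" for u
    proof -
      have au: "\<alpha> u \<in> carrier (F n)" by (rule mod_homD(1)[OF \<alpha>_hom u])
      have "\<alpha> u = lincomb (F n) n (\<alpha> u) (\<lambda>j\<in>{..<n}. ?\<gamma> (unit_vec R n j))"
        using hom_free_eq_lincomb[OF cring F \<gamma> au] fixed[OF u] by simp
      also have "\<dots> \<in> H"
        unfolding lincomb_def
      proof (rule F.submodule_finsum[OF H])
        fix j assume j: "j \<in> {..<n}"
        have "?\<gamma> (unit_vec R n j) \<in> ?N" using mod_homD(1)[OF act_hom[OF YV(2)] unit_vec_closed[OF cring]] by blast
        then have "\<alpha> u j \<odot>\<^bsub>F n\<^esub> ?\<gamma> (unit_vec R n j) \<in> H"
          using entries[OF u] j unfolding G(3) by (intro mH) auto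
        then show "\<alpha> u j \<odot>\<^bsub>F n\<^esub> (\<lambda>j\<in>{..<n}. ?\<gamma> (unit_vec R n j)) j \<in> H" using j by (simp del: free_mod_simps)
      qed simp
      finally show ?thesis .
    qed
    then show "module_span R (F n) G \<subseteq> H" unfolding G(3)[symmetric] by blast
  qed
  then have \<alpha>0: "\<alpha> u = \<zero>\<^bsub>F n\<^esub>" if "u \<in> carrier (F n)" for u using that G(3) by blast
  have d0: "d x = \<zero>\<^bsub>F b0\<^esub>" if x: "x \<in> carrier (F b1)" for x
  proof -
    have u: "join_vec b1 l x \<zero>\<^bsub>F l\<^esub> \<in> carrier (F n)" unfolding n(2) by (rule join_vec_closed[OF x zero_closed])
    have "d x = take_vec b0 (\<alpha> (join_vec b1 l x \<zero>\<^bsub>F l\<^esub>))"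
      unfolding take0_\<alpha>[OF u] take_join[OF x] ..
    also have "\<dots> = \<zero>\<^bsub>F b0\<^esub>" unfolding \<alpha>0[OF u] by (rule mod_hom_zero[OF take0 F F])
    finally show ?thesis .
  qed
  have "inj_on e (carrier (F b0))"
  proof (rule inj_onI)
    fix x y assume x: "x \<in> carrier (F b0)" and y: "y \<in> carrier (F b0)" and eq: "e x = e y"
    have xy: "x \<ominus>\<^bsub>F b0\<^esub> y \<in> carrier (F b0)" by (rule F0.M.minus_closed[OF x y])
    have "e (x \<ominus>\<^bsub>F b0\<^esub> y) = \<zero>\<^bsub>M\<^esub>"
      unfolding mod_hom_minus[OF e(1) F M x y] eq unfolding a_minus_def by (rule M.M.r_neg[OF mod_homD(1)[OF e(1) y]])
    with xy have "x \<ominus>\<^bsub>F b0\<^esub> y \<in> a_kernel (F b0) M e" unfolding a_kernel_eq by blast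
    then have "x \<ominus>\<^bsub>F b0\<^esub> y \<in> d ` carrier (F b1)" unfolding d(2) .
    then obtain w where w: "w \<in> carrier (F b1)" "x \<ominus>\<^bsub>F b0\<^esub> y = d w" by blast
    have "x \<ominus>\<^bsub>F b0\<^esub> y = \<zero>\<^bsub>F b0\<^esub>" unfolding w(2) by (rule d0[OF w(1)])
    then have "\<zero>\<^bsub>F b0\<^esub> \<oplus>\<^bsub>F b0\<^esub> y = x" using F0.M.add_minus_cancel(3)[OF x y] by metis
    then show "x = y" using F0.M.l_zero[OF y] by metis
  qed
  then have "mod_iso R (F b0) M" using e unfolding mod_iso_def bij_betw_def by blast
  then show ?thesis using mod_iso_sym[OF F] unfolding is_free_def by blast
qed

text \<open>A pair of matrices with \<open>AC = TB\<close> is a homomorphism from \<open>L = im A\<close> to \<open>coker A = M \<oplus> R\<^sup>k\<close>, lifted to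
  free modules. Its component with values in \<open>M\<close> extends to the free module that contains \<open>L\<close>, and its other
  component has a free target. Hence the homomorphism factors through a free module, which is the assertion in terms
  of matrices.\<close>

lemma lift_matrices:
  assumes ext: "hom_extends R M b0 e" and T: "T \<in> mats R n" and C: "C \<in> mats R n"
    and AC: "mat_mult R n A C = mat_mult R n T B"
  shows "\<exists>Y\<in>mats R n. \<exists>Z\<in>mats R n. C = mat_mult R n B Y \<oplus>\<^bsub>pow_mod (F n) n\<^esub> mat_mult R n Z B"
proof -
  interpret F: module R "F n" by (rule F)
  interpret F0: module R "F b0" by (rule F)
  interpret M: module R M by (rule M)
  let ?K = "a_kernel (F b0) M e"
  define \<tau> where "\<tau> = act T"
  define \<gamma> where "\<gamma> = act C"
  have \<tau>: "\<tau> \<in> mod_hom R (F n) (F n)" and \<gamma>: "\<gamma> \<in> mod_hom R (F n) (F n)"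
    unfolding \<tau>_def \<gamma>_def by (rule act_hom[OF T], rule act_hom[OF C])
  have \<alpha>\<gamma>: "\<alpha> (\<gamma> y) = \<tau> (\<beta> y)" if y: "y \<in> carrier (F n)" for y
  proof -
    have "\<alpha> (\<gamma> y) = act (mat_mult R n A C) y"
      unfolding act_mult[OF A C y] \<gamma>_def by (rule act_A[OF mod_homD(1)[OF act_hom[OF C] y], symmetric])
    also have "\<dots> = \<tau> (\<beta> y)" unfolding AC act_mult[OF T B y] act_B[OF y] \<tau>_def ..
    finally show ?thesis .
  qed
  let ?t = "\<lambda>u. e (take_vec b0 (\<tau> u))"
  have t: "?t \<in> mod_hom R (F n) M" by (rule mod_hom_comp[OF mod_hom_comp[OF \<tau> take0] e(1)])
  have t\<beta>: "?t (\<beta> y) = \<zero>\<^bsub>M\<^esub>" "drop_vec b0 k (\<tau> (\<beta> y)) = \<zero>\<^bsub>F k\<^esub>" if y: "y \<in> carrier (F n)" for y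
  proof -
    have gy: "\<gamma> y \<in> carrier (F n)" by (rule mod_homD(1)[OF \<gamma> y])
    show "?t (\<beta> y) = \<zero>\<^bsub>M\<^esub>"
      unfolding \<alpha>\<gamma>[OF y, symmetric] take0_\<alpha>[OF gy] by (rule ed[OF mod_homD(1)[OF take1 gy]])
    show "drop_vec b0 k (\<tau> (\<beta> y)) = \<zero>\<^bsub>F k\<^esub>" unfolding \<alpha>\<gamma>[OF y, symmetric] by (rule drop0_\<alpha>)
  qed
  have t_wd: "?t u = ?t v" if u: "u \<in> carrier (F n)" and v: "v \<in> carrier (F n)" and eq: "\<alpha> u = \<alpha> v" for u v
  proof -
    have uv: "u \<ominus>\<^bsub>F n\<^esub> v \<in> carrier (F n)" by (rule F.M.minus_closed[OF u v])
    have "\<alpha> (u \<ominus>\<^bsub>F n\<^esub> v) = \<zero>\<^bsub>F n\<^esub>"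
      unfolding mod_hom_minus[OF \<alpha>_hom F F u v] eq unfolding a_minus_def by (rule F.M.r_neg[OF mod_homD(1)[OF \<alpha>_hom v]])
    then obtain y where y: "y \<in> carrier (F n)" "u \<ominus>\<^bsub>F n\<^esub> v = \<beta> y" using ker_\<alpha>[OF uv] by blast
    have "?t ((u \<ominus>\<^bsub>F n\<^esub> v) \<oplus>\<^bsub>F n\<^esub> v) = ?t (u \<ominus>\<^bsub>F n\<^esub> v) \<oplus>\<^bsub>M\<^esub> ?t v" by (rule mod_homD(2)[OF t uv v])
    also have "?t (u \<ominus>\<^bsub>F n\<^esub> v) = \<zero>\<^bsub>M\<^esub>" unfolding y(2) by (rule t\<beta>(1)[OF y(1)])
    also have "\<zero>\<^bsub>M\<^esub> \<oplus>\<^bsub>M\<^esub> ?t v = ?t v" by (rule M.M.l_zero[OF mod_homD(1)[OF t v]])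
    finally show ?thesis unfolding F.M.add_minus_cancel(3)[OF u v] .
  qed
  define pre where "pre w = (SOME u. u \<in> carrier (F n) \<and> take_vec b0 (\<alpha> u) = w)" for w
  have pre: "pre w \<in> carrier (F n)" "take_vec b0 (\<alpha> (pre w)) = w" if w: "w \<in> ?K" for w
  proof -
    have "w \<in> d ` carrier (F b1)" unfolding d(2) by (rule w)
    then obtain x where x: "x \<in> carrier (F b1)" "w = d x" by blast
    have u: "join_vec b1 l x \<zero>\<^bsub>F l\<^esub> \<in> carrier (F n)" unfolding n(2) by (rule join_vec_closed[OF x(1) zero_closed])
    have "take_vec b0 (\<alpha> (join_vec b1 l x \<zero>\<^bsub>F l\<^esub>)) = w" unfolding take0_\<alpha>[OF u] take_join[OF x(1)] x(2) ..
    with u have "\<exists>u. u \<in> carrier (F n) \<and> take_vec b0 (\<alpha> u) = w" by blast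
    then have "pre w \<in> carrier (F n) \<and> take_vec b0 (\<alpha> (pre w)) = w" unfolding pre_def by (rule someI_ex)
    then show "pre w \<in> carrier (F n)" "take_vec b0 (\<alpha> (pre w)) = w" by auto
  qed
  have top_inj: "\<alpha> u = \<alpha> v" if "take_vec b0 (\<alpha> u) = take_vec b0 (\<alpha> v)" "u \<in> carrier (F n)" "v \<in> carrier (F n)" for u v
  proof -
    have c: "\<alpha> u \<in> carrier (F (b0 + k))" "\<alpha> v \<in> carrier (F (b0 + k))"
      unfolding n(1)[symmetric] by (rule mod_homD(1)[OF \<alpha>_hom that(2)], rule mod_homD(1)[OF \<alpha>_hom that(3)])
    have "\<alpha> u = join_vec b0 k (take_vec b0 (\<alpha> u)) (drop_vec b0 k (\<alpha> u))" by (rule join_take_drop[OF c(1), symmetric])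
    also have "\<dots> = join_vec b0 k (take_vec b0 (\<alpha> v)) (drop_vec b0 k (\<alpha> v))" unfolding that(1) drop0_\<alpha> ..
    also have "\<dots> = \<alpha> v" by (rule join_take_drop[OF c(2)])
    finally show ?thesis .
  qed
  \<comment> \<open>The component in \<open>M\<close>, as a homomorphism on the first syzygy of \<open>M\<close>.\<close>
  define \<psi> where "\<psi> w = ?t (pre w)" for w
  have \<psi>_eq: "\<psi> (take_vec b0 (\<alpha> u)) = ?t u" if u: "u \<in> carrier (F n)" for u
  proof -
    have "take_vec b0 (\<alpha> u) \<in> ?K"
      unfolding take0_\<alpha>[OF u] d(2)[symmetric] by (rule imageI[OF mod_homD(1)[OF take1 u]])
    note p = pre[OF this]
    show ?thesis unfolding \<psi>_def by (rule t_wd[OF p(1) u top_inj[OF p(2) p(1) u]])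
  qed
  have c0: "(\<lambda>u. take_vec b0 (\<alpha> u)) \<in> mod_hom R (F n) (F b0)" by (rule mod_hom_comp[OF \<alpha>_hom take0])
  have "\<psi> \<in> mod_hom R ((F b0)\<lparr>carrier := ?K\<rparr>) M"
    unfolding mod_hom_iff
  proof (intro conjI ballI)
    fix x y assume "x \<in> carrier ((F b0)\<lparr>carrier := ?K\<rparr>)" "y \<in> carrier ((F b0)\<lparr>carrier := ?K\<rparr>)"
    then have x: "x \<in> ?K" and y: "y \<in> ?K" by simp_all
    note px = pre[OF x] and py = pre[OF y]
    show "\<psi> y \<in> carrier M" unfolding \<psi>_def by (rule mod_homD(1)[OF t py(1)])
    have "\<psi> (x \<oplus>\<^bsub>F b0\<^esub> y) = \<psi> (take_vec b0 (\<alpha> (pre x \<oplus>\<^bsub>F n\<^esub> pre y)))"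
      using mod_homD(2)[OF c0 px(1) py(1)] px(2) py(2) by simp
    also have "\<dots> = ?t (pre x \<oplus>\<^bsub>F n\<^esub> pre y)" by (rule \<psi>_eq[OF F.M.a_closed[OF px(1) py(1)]])
    also have "\<dots> = \<psi> x \<oplus>\<^bsub>M\<^esub> \<psi> y" unfolding \<psi>_def by (rule mod_homD(2)[OF t px(1) py(1)])
    finally show "\<psi> (x \<oplus>\<^bsub>(F b0)\<lparr>carrier := ?K\<rparr>\<^esub> y) = \<psi> x \<oplus>\<^bsub>M\<^esub> \<psi> y" by simp
  next
    fix a x assume a: "a \<in> carrier R" and "x \<in> carrier ((F b0)\<lparr>carrier := ?K\<rparr>)"
    then have x: "x \<in> ?K" by simp
    note px = pre[OF x]
    have "\<psi> (a \<odot>\<^bsub>F b0\<^esub> x) = \<psi> (take_vec b0 (\<alpha> (a \<odot>\<^bsub>F n\<^esub> pre x)))"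
      using mod_homD(3)[OF c0 a px(1)] px(2) by simp
    also have "\<dots> = ?t (a \<odot>\<^bsub>F n\<^esub> pre x)" by (rule \<psi>_eq[OF F.smult_closed[OF a px(1)]])
    also have "\<dots> = a \<odot>\<^bsub>M\<^esub> \<psi> x" unfolding \<psi>_def by (rule mod_homD(3)[OF t a px(1)])
    finally show "\<psi> (a \<odot>\<^bsub>(F b0)\<lparr>carrier := ?K\<rparr>\<^esub> x) = a \<odot>\<^bsub>M\<^esub> \<psi> x" by simp
  qed
  from bspec[OF ext[unfolded hom_extends_def] this]
  obtain \<chi> where \<chi>: "\<chi> \<in> mod_hom R (F b0) M" "\<And>x. x \<in> ?K \<Longrightarrow> \<chi> x = \<psi> x" by blast
  have "\<chi> x \<in> e ` carrier (F b0)" if "x \<in> carrier (F b0)" for x unfolding e(2) by (rule mod_homD(1)[OF \<chi>(1) that])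
  then obtain g where g: "g \<in> mod_hom R (F b0) (F b0)" "\<And>x. x \<in> carrier (F b0) \<Longrightarrow> e (g x) = \<chi> x"
    using free_lift[OF cring F M e(1) \<chi>(1)] by blast
  \<comment> \<open>\<open>\<omega>\<close> lifts the factorization through a free module: it agrees with \<open>\<tau>\<close> modulo \<open>im \<alpha>\<close> and kills \<open>im \<beta>\<close>.\<close>
  define \<omega> where "\<omega> u = join_vec b0 k (g (take_vec b0 (\<alpha> u))) (drop_vec b0 k (\<tau> u))" for u
  have "(\<lambda>u. join_vec b0 k (g (take_vec b0 (\<alpha> u))) (drop_vec b0 k (\<tau> u))) \<in> mod_hom R (F n) (F (b0 + k))"
    by (rule join_vec_hom[OF mod_hom_comp[OF c0 g(1)] mod_hom_comp[OF \<tau> drop0]])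
  then have \<omega>: "\<omega> \<in> mod_hom R (F n) (F n)" unfolding \<omega>_def[abs_def] n(1)[symmetric] .
  have \<omega>\<beta>: "\<omega> (\<beta> y) = \<zero>\<^bsub>F n\<^esub>" if y: "y \<in> carrier (F n)" for y
    unfolding \<omega>_def \<alpha>\<beta>[OF y] t\<beta>(2)[OF y] mod_hom_zero[OF take0 F F] mod_hom_zero[OF g(1) F F]
    unfolding n(1) by (rule join_zero)
  define \<sigma>' where "\<sigma>' u = \<tau> u \<ominus>\<^bsub>F n\<^esub> \<omega> u" for u
  have \<sigma>': "\<sigma>' \<in> mod_hom R (F n) (F n)"
    unfolding \<sigma>'_def[abs_def] by (rule mod_hom_diff[OF \<tau> \<omega> F])
  have "\<sigma>' u \<in> \<alpha> ` carrier (F n)" if u: "u \<in> carrier (F n)" for u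
  proof (rule ker_\<beta>'[OF mod_homD(1)[OF \<sigma>' u]])
    note tu = mod_homD(1)[OF \<tau> u] and ou = mod_homD(1)[OF \<omega> u]
    have au: "take_vec b0 (\<alpha> u) \<in> carrier (F b0)" by (rule mod_homD(1)[OF c0 u])
    have auK: "take_vec b0 (\<alpha> u) \<in> ?K"
      unfolding take0_\<alpha>[OF u] d(2)[symmetric] by (rule imageI[OF mod_homD(1)[OF take1 u]])
    have "e (take_vec b0 (\<sigma>' u)) = ?t u \<ominus>\<^bsub>M\<^esub> e (take_vec b0 (\<omega> u))"
      unfolding \<sigma>'_def by (rule mod_hom_minus[OF mod_hom_comp[OF take0 e(1)] F M tu ou])
    also have "take_vec b0 (\<omega> u) = g (take_vec b0 (\<alpha> u))"
      unfolding \<omega>_def by (rule take_join[OF mod_homD(1)[OF g(1) au]])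
    also have "e (g (take_vec b0 (\<alpha> u))) = ?t u" unfolding g(2)[OF au] \<chi>(2)[OF auK] by (rule \<psi>_eq[OF u])
    also have "?t u \<ominus>\<^bsub>M\<^esub> ?t u = \<zero>\<^bsub>M\<^esub>" unfolding a_minus_def by (rule M.M.r_neg[OF mod_homD(1)[OF t u]])
    finally show "e (take_vec b0 (\<sigma>' u)) = \<zero>\<^bsub>M\<^esub>" .
    interpret Fk: module R "F k" by (rule F)
    have "drop_vec b0 k (\<sigma>' u) = drop_vec b0 k (\<tau> u) \<ominus>\<^bsub>F k\<^esub> drop_vec b0 k (\<omega> u)"
      unfolding \<sigma>'_def by (rule mod_hom_minus[OF drop0 F F tu ou])
    also have "drop_vec b0 k (\<omega> u) = drop_vec b0 k (\<tau> u)"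
      unfolding \<omega>_def by (rule drop_join[OF mod_homD(1)[OF drop0 tu]])
    also have "drop_vec b0 k (\<tau> u) \<ominus>\<^bsub>F k\<^esub> drop_vec b0 k (\<tau> u) = \<zero>\<^bsub>F k\<^esub>"
      unfolding a_minus_def by (rule Fk.M.r_neg[OF mod_homD(1)[OF drop0 tu]])
    finally show "drop_vec b0 k (\<sigma>' u) = \<zero>\<^bsub>F k\<^esub>" .
  qed
  then obtain \<sigma> where \<sigma>: "\<sigma> \<in> mod_hom R (F n) (F n)" "\<And>u. u \<in> carrier (F n) \<Longrightarrow> \<alpha> (\<sigma> u) = \<sigma>' u"
    using free_lift[OF cring F F \<alpha>_hom \<sigma>'] by blast
  have \<sigma>\<beta>: "(\<lambda>y. \<sigma> (\<beta> y)) \<in> mod_hom R (F n) (F n)" by (rule mod_hom_comp[OF \<beta>_hom \<sigma>(1)])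
  define \<eta>' where "\<eta>' y = \<gamma> y \<ominus>\<^bsub>F n\<^esub> \<sigma> (\<beta> y)" for y
  have \<eta>': "\<eta>' \<in> mod_hom R (F n) (F n)"
    unfolding \<eta>'_def[abs_def] by (rule mod_hom_diff[OF \<gamma> \<sigma>\<beta> F])
  have "\<eta>' y \<in> \<beta> ` carrier (F n)" if y: "y \<in> carrier (F n)" for y
  proof (rule ker_\<alpha>[OF mod_homD(1)[OF \<eta>' y]])
    have by': "\<beta> y \<in> carrier (F n)" by (rule mod_homD(1)[OF \<beta>_hom y])
    note tb = mod_homD(1)[OF \<tau> by']
    have "\<alpha> (\<eta>' y) = \<alpha> (\<gamma> y) \<ominus>\<^bsub>F n\<^esub> \<alpha> (\<sigma> (\<beta> y))"
      unfolding \<eta>'_def by (rule mod_hom_minus[OF \<alpha>_hom F F mod_homD(1)[OF \<gamma> y] mod_homD(1)[OF \<sigma>\<beta> y]])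
    also have "\<alpha> (\<sigma> (\<beta> y)) = \<tau> (\<beta> y) \<ominus>\<^bsub>F n\<^esub> \<zero>\<^bsub>F n\<^esub>"
      unfolding \<sigma>(2)[OF by'] \<sigma>'_def \<omega>\<beta>[OF y] ..
    also have "\<tau> (\<beta> y) \<ominus>\<^bsub>F n\<^esub> \<zero>\<^bsub>F n\<^esub> = \<tau> (\<beta> y)"
      using tb by (simp add: a_minus_def del: free_mod_simps)
    also have "\<alpha> (\<gamma> y) \<ominus>\<^bsub>F n\<^esub> \<tau> (\<beta> y) = \<zero>\<^bsub>F n\<^esub>"
      unfolding \<alpha>\<gamma>[OF y] a_minus_def by (rule F.M.r_neg[OF tb])
    finally show "\<alpha> (\<eta>' y) = \<zero>\<^bsub>F n\<^esub>" .
  qed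
  then obtain \<eta> where \<eta>: "\<eta> \<in> mod_hom R (F n) (F n)" "\<And>y. y \<in> carrier (F n) \<Longrightarrow> \<beta> (\<eta> y) = \<eta>' y"
    using free_lift[OF cring F F \<beta>_hom \<eta>'] by blast
  let ?Y = "mat_of R n \<eta>" and ?Z = "mat_of R n \<sigma>"
  have Y: "?Y \<in> mats R n" and Z: "?Z \<in> mats R n" using mat_of(1)[OF cring] \<eta>(1) \<sigma>(1) by auto
  note mc = mat_mult_closed[OF cring]
  interpret P: module R "pow_mod (F n) n" by (rule module_pow[OF F])
  have "C = mat_mult R n B ?Y \<oplus>\<^bsub>pow_mod (F n) n\<^esub> mat_mult R n ?Z B"
  proof (rule mat_eqI[OF cring C P.M.a_closed[OF mc[OF B Y] mc[OF Z B]]])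
    fix y assume y: "y \<in> carrier (F n)"
    have by': "\<beta> y \<in> carrier (F n)" by (rule mod_homD(1)[OF \<beta>_hom y])
    have "act (mat_mult R n B ?Y \<oplus>\<^bsub>pow_mod (F n) n\<^esub> mat_mult R n ?Z B) y =
        act B (act ?Y y) \<oplus>\<^bsub>F n\<^esub> act ?Z (act B y)"
      unfolding act_add[OF mc[OF B Y] mc[OF Z B] y] act_mult[OF B Y y] act_mult[OF Z B y] ..
    also have "\<dots> = \<eta>' y \<oplus>\<^bsub>F n\<^esub> \<sigma> (\<beta> y)"
      unfolding mat_of(2)[OF cring \<eta>(1) y] act_B[OF mod_homD(1)[OF \<eta>(1) y]] act_B[OF y] mat_of(2)[OF cring \<sigma>(1) by'] \<eta>(2)[OF y] ..
    also have "\<dots> = \<gamma> y"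
      unfolding \<eta>'_def by (rule F.M.add_minus_cancel(3)[OF mod_homD(1)[OF \<gamma> y] mod_homD(1)[OF \<sigma>\<beta> y]])
    finally show "act C y = act (mat_mult R n B ?Y \<oplus>\<^bsub>pow_mod (F n) n\<^esub> mat_mult R n ?Z B) y" unfolding \<gamma>_def by simp
  qed
  then show ?thesis using Y Z by blast
qed

end


section \<open>The dual module\<close>

context two_periodic_module
begin

abbreviation pairing :: "(nat \<Rightarrow> 'a) \<Rightarrow> (nat \<Rightarrow> 'a) \<Rightarrow> 'a"
  where "pairing x y \<equiv> lincomb (regular_module R) n x y"

lemma N: "module R (regular_module R)"
  by (rule module_regular[OF cring])

lemma pairing_hom_right: "x \<in> carrier (F n) \<Longrightarrow> pairing x \<in> mod_hom R (F n) (regular_module R)"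
  unfolding free_mod_eq_pow_mod[of R n]
  by (rule module.lincomb_hom_right[OF N]) (simp add: free_mod_eq_pow_mod)

lemma pairing_hom_left: "y \<in> carrier (F n) \<Longrightarrow> (\<lambda>x. pairing x y) \<in> mod_hom R (F n) (regular_module R)"
  by (rule module.lincomb_hom_left[OF N]) (simp add: free_mod_eq_pow_mod)

lemma row_ker_iff:
  assumes x: "x \<in> carrier (F n)"
  shows "row_act R n A x = \<zero>\<^bsub>F n\<^esub> \<longleftrightarrow> (\<forall>u\<in>carrier (F n). pairing x (\<alpha> u) = \<zero>\<^bsub>R\<^esub>)"
proof -
  let ?y = "row_act R n A x"
  have y: "?y \<in> carrier (F n)" by (rule mod_homD(1)[OF row_act_hom[OF cring A] x])
  have eq: "pairing x (\<alpha> u) = pairing ?y u" if u: "u \<in> carrier (F n)" for u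
  proof -
    have "pairing ?y u = pairing x (act A u)"
      unfolding row_act_def using u by (intro lincomb_assoc[OF cring N x A]) simp
    then show ?thesis unfolding act_A[OF u] by (rule sym)
  qed
  show ?thesis
  proof
    assume z: "?y = \<zero>\<^bsub>F n\<^esub>"
    show "\<forall>u\<in>carrier (F n). pairing x (\<alpha> u) = \<zero>\<^bsub>R\<^esub>"
    proof
      fix u assume u: "u \<in> carrier (F n)"
      show "pairing x (\<alpha> u) = \<zero>\<^bsub>R\<^esub>"
        unfolding eq[OF u] z using mod_hom_zero[OF pairing_hom_left[OF u] F N] by simp
    qed
  next
    assume z: "\<forall>u\<in>carrier (F n). pairing x (\<alpha> u) = \<zero>\<^bsub>R\<^esub>"
    have "?y j = \<zero>\<^bsub>F n\<^esub> j" if j: "j < n" for j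
    proof -
      have "?y j = pairing ?y (unit_vec R n j)" by (rule lincomb_regular_unit_vec[OF cring y j, symmetric])
      also have "\<dots> = \<zero>\<^bsub>R\<^esub>" using eq[OF unit_vec_closed[OF cring]] z unit_vec_closed[OF cring] by metis
      finally show ?thesis using j by simp
    qed
    then show "?y = \<zero>\<^bsub>F n\<^esub>"
      using y zero_closed[of n] unfolding free_mod_eq_pow_mod by (intro pow_mod_eqI)
  qed
qed

text \<open>The dual of \<open>M\<close> in coordinates; see \<open>dual_iso\<close>.\<close>

definition U :: "(nat \<Rightarrow> 'a) set"
  where "U = {x \<in> coord_subspace R n {..<b0}. row_act R n A x = \<zero>\<^bsub>F n\<^esub>}"

lemma submodule_U: "submodule U R (F n)"
  using submodule_vimage[OF row_act_hom[OF cring A] F F submodule_coord[OF cring] module.submodule_zero[OF F]]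
  by (simp add: U_def)

lemma U_iff: "x \<in> U \<longleftrightarrow> x \<in> carrier (F n) \<and> (\<forall>j<n. b0 \<le> j \<longrightarrow> x j = \<zero>\<^bsub>R\<^esub>) \<and>
    (\<forall>u\<in>carrier (F n). pairing x (\<alpha> u) = \<zero>\<^bsub>R\<^esub>)"
  unfolding U_def coord_subspace_def using row_ker_iff by (auto simp del: free_mod_simps)

definition pad :: "(nat \<Rightarrow> 'a) \<Rightarrow> nat \<Rightarrow> 'a"
  where "pad t = join_vec b0 k t \<zero>\<^bsub>F k\<^esub>"

lemma pad_hom: "pad \<in> mod_hom R (F b0) (F n)"
  using join0_hom[OF F mod_hom_id] by (simp only: pad_def[abs_def])

lemma pad_unit_vec: "j < b0 \<Longrightarrow> pad (unit_vec R b0 j) = unit_vec R n j"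
  using n(1) by (auto simp: pad_def join_vec_def single_def fun_eq_iff)

lemma \<alpha>_eq_pad: "\<alpha> u = pad (d (take_vec b1 u))"
  by (simp add: \<alpha>_def pad_def)

definition dual_map :: "(nat \<Rightarrow> 'a) \<Rightarrow> 'm \<Rightarrow> 'a"
  where "dual_map x = (\<lambda>m\<in>carrier M. pairing x (pad (SOME t. t \<in> carrier (F b0) \<and> e t = m)))"

lemma dual_map_e:
  assumes x: "x \<in> U" and t: "t \<in> carrier (F b0)"
  shows "dual_map x (e t) = pairing x (pad t)"
proof -
  interpret F0: module R "F b0" by (rule F)
  interpret M: module R M by (rule M)
  interpret N: module R "regular_module R" by (rule N)
  have xc: "x \<in> carrier (F n)" using x U_iff by blast
  have f: "(\<lambda>t. pairing x (pad t)) \<in> mod_hom R (F b0) (regular_module R)"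
    by (rule mod_hom_comp[OF pad_hom pairing_hom_right[OF xc]])
  define s where "s = (SOME s. s \<in> carrier (F b0) \<and> e s = e t)"
  have "s \<in> carrier (F b0) \<and> e s = e t"
    unfolding s_def by (rule someI[where P = "\<lambda>s. s \<in> carrier (F b0) \<and> e s = e t" and x = t]) (rule conjI[OF t refl])
  then have s: "s \<in> carrier (F b0)" "e s = e t" by auto
  have st: "s \<ominus>\<^bsub>F b0\<^esub> t \<in> carrier (F b0)" by (rule F0.M.minus_closed[OF s(1) t])
  have "e (s \<ominus>\<^bsub>F b0\<^esub> t) = \<zero>\<^bsub>M\<^esub>"
    unfolding mod_hom_minus[OF e(1) F M s(1) t] s(2) unfolding a_minus_def by (rule M.M.r_neg[OF mod_homD(1)[OF e(1) t]])
  with st have "s \<ominus>\<^bsub>F b0\<^esub> t \<in> a_kernel (F b0) M e" unfolding a_kernel_eq by blast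
  then have "s \<ominus>\<^bsub>F b0\<^esub> t \<in> d ` carrier (F b1)" unfolding d(2) .
  then obtain w where w: "w \<in> carrier (F b1)" "s \<ominus>\<^bsub>F b0\<^esub> t = d w" by blast
  have u: "join_vec b1 l w \<zero>\<^bsub>F l\<^esub> \<in> carrier (F n)" unfolding n(2) by (rule join_vec_closed[OF w(1) zero_closed])
  have "pairing x (\<alpha> (join_vec b1 l w \<zero>\<^bsub>F l\<^esub>)) = \<zero>\<^bsub>R\<^esub>" using x u U_iff by blast
  then have z: "pairing x (pad (s \<ominus>\<^bsub>F b0\<^esub> t)) = \<zero>\<^bsub>R\<^esub>" unfolding \<alpha>_eq_pad take_join[OF w(1)] w(2) .
  have "pairing x (pad ((s \<ominus>\<^bsub>F b0\<^esub> t) \<oplus>\<^bsub>F b0\<^esub> t)) = pairing x (pad (s \<ominus>\<^bsub>F b0\<^esub> t)) \<oplus>\<^bsub>R\<^esub> pairing x (pad t)"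
    using mod_homD(2)[OF f st t] by simp
  also have "\<dots> = pairing x (pad t)" unfolding z using mod_homD(1)[OF f t] by simp
  finally have "pairing x (pad s) = pairing x (pad t)" unfolding F0.M.add_minus_cancel(3)[OF s(1) t] .
  then show ?thesis unfolding dual_map_def s_def using mod_homD(1)[OF e(1) t] by simp
qed

lemma dual_simps:
  "carrier (dual_module R M) = mod_hom R M (regular_module R) \<inter> extensional (carrier M)"
  "f \<oplus>\<^bsub>dual_module R M\<^esub> g = (\<lambda>x\<in>carrier M. f x \<oplus>\<^bsub>R\<^esub> g x)"
  "a \<odot>\<^bsub>dual_module R M\<^esub> f = (\<lambda>x\<in>carrier M. a \<otimes>\<^bsub>R\<^esub> f x)"
  by (simp_all add: dual_module_def hom_module_def)

text \<open>A functional on \<open>M\<close> is determined by its values on the images of the unit vectors of \<open>R\<^sup>b\<^sup>0\<close>, and the vectors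
  of values that occur are those orthogonal to the relations of \<open>M\<close>.\<close>

lemma dual_iso: "mod_iso R ((F n)\<lparr>carrier := U\<rparr>) (dual_module R M)"
proof -
  interpret M: module R M by (rule M)
  interpret Fb: module R "F b0" by (rule F)
  interpret Fn: module R "F n" by (rule F)
  interpret N: module R "regular_module R" by (rule N)
  note U' = Fn.submoduleD[OF submodule_U]
  have lift: "\<exists>t\<in>carrier (F b0). m = e t" if "m \<in> carrier M" for m using that e(2) by blast
  have hom: "dual_map x \<in> mod_hom R M (regular_module R)" if x: "x \<in> U" for x
    unfolding mod_hom_iff
  proof (intro conjI ballI)
    have f: "(\<lambda>t. pairing x (pad t)) \<in> mod_hom R (F b0) (regular_module R)"
      by (rule mod_hom_comp[OF pad_hom pairing_hom_right[OF U'(2)[OF x]]])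
    fix m m' assume "m \<in> carrier M" "m' \<in> carrier M"
    then obtain t t' where t: "t \<in> carrier (F b0)" "m = e t" "t' \<in> carrier (F b0)" "m' = e t'" using lift by blast
    show "dual_map x m' \<in> carrier (regular_module R)"
      unfolding t(4) dual_map_e[OF x t(3)] by (rule mod_homD(1)[OF f t(3)])
    show "dual_map x (m \<oplus>\<^bsub>M\<^esub> m') = dual_map x m \<oplus>\<^bsub>regular_module R\<^esub> dual_map x m'"
      unfolding t(2,4) mod_homD(2)[OF e(1) t(1,3), symmetric]
        dual_map_e[OF x t(1)] dual_map_e[OF x t(3)] dual_map_e[OF x Fb.M.a_closed[OF t(1,3)]]
      by (rule mod_homD(2)[OF f t(1,3)])
  next
    have f: "(\<lambda>t. pairing x (pad t)) \<in> mod_hom R (F b0) (regular_module R)"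
      by (rule mod_hom_comp[OF pad_hom pairing_hom_right[OF U'(2)[OF x]]])
    fix a m assume a: "a \<in> carrier R" and "m \<in> carrier M"
    then obtain t where t: "t \<in> carrier (F b0)" "m = e t" using lift by blast
    show "dual_map x (a \<odot>\<^bsub>M\<^esub> m) = a \<odot>\<^bsub>regular_module R\<^esub> dual_map x m"
      unfolding t(2) mod_homD(3)[OF e(1) a t(1), symmetric] dual_map_e[OF x t(1)] dual_map_e[OF x Fb.smult_closed[OF a t(1)]]
      by (rule mod_homD(3)[OF f a t(1)])
  qed
  have closed: "dual_map x \<in> carrier (dual_module R M)" if "x \<in> U" for x
    using hom[OF that] by (simp add: dual_simps dual_map_def)
  have "dual_map \<in> mod_hom R ((F n)\<lparr>carrier := U\<rparr>) (dual_module R M)"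
    unfolding mod_hom_iff
  proof (intro conjI ballI)
    fix x y assume "x \<in> carrier ((F n)\<lparr>carrier := U\<rparr>)" "y \<in> carrier ((F n)\<lparr>carrier := U\<rparr>)"
    then have x: "x \<in> U" and y: "y \<in> U" by simp_all
    show "dual_map y \<in> carrier (dual_module R M)" by (rule closed[OF y])
    have "dual_map (x \<oplus>\<^bsub>F n\<^esub> y) m = dual_map x m \<oplus>\<^bsub>R\<^esub> dual_map y m" if "m \<in> carrier M" for m
    proof -
      obtain t where t: "t \<in> carrier (F b0)" "m = e t" using lift \<open>m \<in> carrier M\<close> by blast
      show ?thesis
        unfolding t(2) dual_map_e[OF x t(1)] dual_map_e[OF y t(1)] dual_map_e[OF U'(4)[OF x y] t(1)]
        using mod_homD(2)[OF pairing_hom_left[OF mod_homD(1)[OF pad_hom t(1)]] U'(2)[OF x] U'(2)[OF y]]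
        unfolding regular_module_simps .
    qed
    moreover have "dual_map (x \<oplus>\<^bsub>F n\<^esub> y) \<in> extensional (carrier M)" by (simp add: dual_map_def)
    ultimately have "dual_map (x \<oplus>\<^bsub>F n\<^esub> y) = dual_map x \<oplus>\<^bsub>dual_module R M\<^esub> dual_map y"
      unfolding dual_simps by (intro extensionalityI[of _ "carrier M"]) auto
    then show "dual_map (x \<oplus>\<^bsub>(F n)\<lparr>carrier := U\<rparr>\<^esub> y) = dual_map x \<oplus>\<^bsub>dual_module R M\<^esub> dual_map y"
      by (simp del: free_mod_simps)
  next
    fix a x assume a: "a \<in> carrier R" and "x \<in> carrier ((F n)\<lparr>carrier := U\<rparr>)"
    then have x: "x \<in> U" by simp
    have "dual_map (a \<odot>\<^bsub>F n\<^esub> x) m = a \<otimes>\<^bsub>R\<^esub> dual_map x m" if "m \<in> carrier M" for m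
    proof -
      obtain t where t: "t \<in> carrier (F b0)" "m = e t" using lift \<open>m \<in> carrier M\<close> by blast
      show ?thesis
        unfolding t(2) dual_map_e[OF x t(1)] dual_map_e[OF U'(6)[OF a x] t(1)]
        using mod_homD(3)[OF pairing_hom_left[OF mod_homD(1)[OF pad_hom t(1)]] a U'(2)[OF x]]
        unfolding regular_module_simps .
    qed
    moreover have "dual_map (a \<odot>\<^bsub>F n\<^esub> x) \<in> extensional (carrier M)" by (simp add: dual_map_def)
    ultimately have "dual_map (a \<odot>\<^bsub>F n\<^esub> x) = a \<odot>\<^bsub>dual_module R M\<^esub> dual_map x"
      unfolding dual_simps by (intro extensionalityI[of _ "carrier M"]) auto
    then show "dual_map (a \<odot>\<^bsub>(F n)\<lparr>carrier := U\<rparr>\<^esub> x) = a \<odot>\<^bsub>dual_module R M\<^esub> dual_map x"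
      by (simp del: free_mod_simps)
  qed
  moreover have "bij_betw dual_map U (carrier (dual_module R M))"
    unfolding bij_betw_def
  proof
    show "inj_on dual_map U"
    proof (rule inj_onI)
      fix x y assume x: "x \<in> U" and y: "y \<in> U" and eq: "dual_map x = dual_map y"
      have "x j = y j" if j: "j < n" for j
      proof (cases "j < b0")
        case True
        have z: "z j = dual_map z (e (unit_vec R b0 j))" if "z \<in> U" for z
          unfolding dual_map_e[OF that unit_vec_closed[OF cring]] pad_unit_vec[OF True]
          by (rule lincomb_regular_unit_vec[OF cring U'(2)[OF that] j, symmetric])
        show ?thesis unfolding z[OF x] z[OF y] eq ..
      next
        case False
        then show ?thesis using x y j U_iff by simp
      qed
      then show "x = y" using U'(2)[OF x] U'(2)[OF y] unfolding free_mod_eq_pow_mod by (intro pow_mod_eqI)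
    qed
    show "dual_map ` U = carrier (dual_module R M)"
    proof
      show "dual_map ` U \<subseteq> carrier (dual_module R M)" using closed by blast
      show "carrier (dual_module R M) \<subseteq> dual_map ` U"
      proof
        fix f assume "f \<in> carrier (dual_module R M)"
        then have f: "f \<in> mod_hom R M (regular_module R)" "f \<in> extensional (carrier M)" by (auto simp: dual_simps)
        note fe = mod_hom_comp[OF e(1) f(1)]
        define x where "x = (\<lambda>i\<in>{..<n}. if i < b0 then f (e (unit_vec R b0 i)) else \<zero>\<^bsub>R\<^esub>)"
        have fe_closed: "f (e (unit_vec R b0 i)) \<in> carrier R" for i
          using mod_homD(1)[OF fe unit_vec_closed[OF cring]] by simp
        have xc: "x \<in> carrier (F n)" using fe_closed by (auto simp: x_def)
        have g: "(\<lambda>t. pairing x (pad t)) \<in> mod_hom R (F b0) (regular_module R)"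
          by (rule mod_hom_comp[OF pad_hom pairing_hom_right[OF xc]])
        have "(\<lambda>i\<in>{..<b0}. pairing x (pad (unit_vec R b0 i))) = (\<lambda>i\<in>{..<b0}. f (e (unit_vec R b0 i)))"
        proof (rule restrict_ext)
          fix i assume "i \<in> {..<b0}"
          then have i: "i < b0" "i < n" using n(1) by auto
          show "pairing x (pad (unit_vec R b0 i)) = f (e (unit_vec R b0 i))"
            unfolding pad_unit_vec[OF i(1)] lincomb_regular_unit_vec[OF cring xc i(2)] using i by (simp add: x_def)
        qed
        then have agree: "pairing x (pad t) = f (e t)" if t: "t \<in> carrier (F b0)" for t
          using hom_free_eq_lincomb[OF cring N g t] hom_free_eq_lincomb[OF cring N fe t] by metis
        have "pairing x (\<alpha> u) = \<zero>\<^bsub>R\<^esub>" if u: "u \<in> carrier (F n)" for u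
        proof -
          note tu = mod_homD(1)[OF take1 u]
          have "pairing x (\<alpha> u) = f \<zero>\<^bsub>M\<^esub>"
            unfolding \<alpha>_eq_pad agree[OF mod_homD(1)[OF d(1) tu]] ed[OF tu] ..
          then show ?thesis using mod_hom_zero[OF f(1) M N] by simp
        qed
        then have xU: "x \<in> U" unfolding U_iff using xc by (simp add: x_def del: free_mod_simps)
        have "dual_map x m = f m" if m: "m \<in> carrier M" for m
        proof -
          obtain t where t: "t \<in> carrier (F b0)" "m = e t" using lift m by blast
          show ?thesis unfolding t(2) dual_map_e[OF xU t(1)] by (rule agree[OF t(1)])
        qed
        moreover have "dual_map x \<in> extensional (carrier M)" by (simp add: dual_map_def)
        ultimately have "dual_map x = f" using f(2) by (intro extensionalityI[of _ "carrier M"])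
        then show "f \<in> dual_map ` U" using xU by blast
      qed
    qed
  qed
  ultimately show ?thesis unfolding mod_iso_def by auto
qed

text \<open>The Herbrand difference is an additive function of the module and vanishes on \<open>R\<close>, so the hypothesis on the
  Grothendieck group applies to it.\<close>

lemma herbrand_U:
  assumes S: "maximal_mult_set R I S"
    and zero: "rational_reduced_groth_class R (dual_module R M) = \<one>\<^bsub>rational_reduced_groth_group R\<^esub>"
  shows "herbrand R S (F n) n A B U {\<zero>\<^bsub>F n\<^esub>} = 0"
proof -
  interpret c: exact_periodic_complex R n A B I S by (rule exact_periodic[OF S])
  let ?U = "(F n)\<lparr>carrier := U\<rparr>"
  let ?\<chi> = "\<lambda>X :: 'a fg_rep. herbrand R S X n A B (carrier X) {\<zero>\<^bsub>X\<^esub>}"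
  let ?X0 = "singleton_module ?U" and ?X1 = "singleton_module (F 1)"
  have Um: "module R ?U" by (rule submodule.submodule_is_module[OF submodule_U F])
  have Ufg: "fg_module R ?U" by (rule fg_submodule[OF noeth fg_free[OF cring] submodule_U])
  have X0: "module R ?X0" by (rule module_singleton[OF Um])
  have X1: "module R ?X1" by (rule module_singleton[OF F])
  interpret X0: module R ?X0 by (rule X0)
  interpret N: module R "regular_module R" by (rule N)
  have reg_free: "mod_iso R (regular_module R) (F 1)"
    unfolding mod_iso_def
  proof (rule bexI)
    show "(\<lambda>a. \<lambda>i\<in>{..<1}. a) \<in> mod_hom R (regular_module R) (F 1)" by (auto simp: mod_hom_iff fun_eq_iff)
    show "bij_betw (\<lambda>a. \<lambda>i\<in>{..<1::nat}. a) (carrier (regular_module R)) (carrier (F 1))"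
    proof (rule bij_betw_byWitness[of _ "\<lambda>x. x 0"])
      show "\<forall>x\<in>carrier (F 1). (\<lambda>i\<in>{..<1}. x 0) = x"
        by (auto simp: fun_eq_iff PiE_iff extensional_def)
    qed (auto split: if_splits)
  qed
  have regX1: "mod_iso R (regular_module R) ?X1" by (rule mod_iso_trans[OF reg_free mod_iso_singleton])
  have isoX0: "mod_iso R ?X0 (dual_module R M)"
    by (rule mod_iso_trans[OF mod_iso_sym[OF Um mod_iso_singleton] dual_iso])
  have "?\<chi> ?X0 = 0"
  proof (rule additive_function_vanishes[where \<chi> = ?\<chi> and R = R and D = "dual_module R M" and ?X1.0 = ?X1 and ?X0.0 = ?X0])
    fix X Y :: "'a fg_rep" assume "fg_module R X" "fg_module R Y" "mod_iso R X Y"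
    then show "?\<chi> X = ?\<chi> Y" using c.herbrand_iso[of X Y] by (simp add: fg_module_def)
  next
    fix X' X X'' :: "'a fg_rep" and f g
    assume "fg_module R X'" "fg_module R X" "fg_module R X''" "short_exact R X' f X g X''"
    then show "?\<chi> X = ?\<chi> X' + ?\<chi> X''" by (intro c.herbrand_short_exact) (auto simp: fg_module_def)
  next
    show "?\<chi> ?X1 = 0" using c.herbrand_iso[OF N X1 regX1] c.herbrand_regular by (simp del: singleton_module_simps)
    show "fg_module R ?X1" by (rule fg_singleton[OF fg_free[OF cring]])
    show "mod_iso R ?X1 (regular_module R)" by (rule mod_iso_sym[OF N regX1])
    show "mod_iso R (regular_module R) ?X1" by (rule regX1)
    show "fg_module R ?X0" by (rule fg_singleton[OF Ufg])
    show "mod_iso R ?X0 (dual_module R M)" by (rule isoX0)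
    show "mod_iso R (dual_module R M) ?X0" by (rule mod_iso_sym[OF X0 isoX0])
  qed (rule zero)
  moreover have "?\<chi> ?X0 = herbrand R S ?U n A B (carrier ?U) {\<zero>\<^bsub>?U\<^esub>}"
    by (rule c.herbrand_iso[OF Um X0 mod_iso_singleton])
  moreover have "herbrand R S (F n) n A B ((\<lambda>x. x) ` carrier ?U) ((\<lambda>x. x) ` {\<zero>\<^bsub>?U\<^esub>}) =
      herbrand R S ?U n A B (carrier ?U) {\<zero>\<^bsub>?U\<^esub>}"
  proof (rule c.herbrand_hom[OF Um F])
    show "(\<lambda>x. x) \<in> mod_hom R ?U (F n)"
      by (rule mod_hom_submodule_dom[OF mod_hom_id module.submoduleD(1)[OF F submodule_U]])
    show "submodule (carrier ?U) R ?U" by (rule module.carrier_is_submodule[OF Um])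
    show s: "submodule {\<zero>\<^bsub>?U\<^esub>} R ?U" by (rule module.submodule_zero[OF Um])
    show "{\<zero>\<^bsub>?U\<^esub>} \<subseteq> carrier ?U" by (rule module.submoduleD(1)[OF Um s])
  qed simp
  ultimately show ?thesis by simp
qed

text \<open>The left kernel of \<open>A\<close> is the dual of \<open>M\<close> plus the free module on the last \<open>k\<close> coordinates, since
  the last \<open>k\<close> rows of \<open>A\<close> vanish.\<close>

lemma herbrand_row_ker:
  assumes S: "maximal_mult_set R I S"
    and zero: "rational_reduced_groth_class R (dual_module R M) = \<one>\<^bsub>rational_reduced_groth_group R\<^esub>"
  shows "herbrand R S (F n) n A B {x \<in> carrier (F n). row_act R n A x = \<zero>\<^bsub>F n\<^esub>} {\<zero>\<^bsub>F n\<^esub>} = 0"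
proof -
  interpret c: exact_periodic_complex R n A B I S by (rule exact_periodic[OF S])
  interpret R: cring R by (rule cring)
  interpret Fn: module R "F n" by (rule F)
  interpret N: module R "regular_module R" by (rule N)
  let ?K = "{x \<in> carrier (F n). row_act R n A x = \<zero>\<^bsub>F n\<^esub>}"
  let ?W = "coord_subspace R n {b0..}"
  have K: "submodule ?K R (F n)"
    using submodule_vimage[OF row_act_hom[OF cring A] F F Fn.carrier_is_submodule Fn.submodule_zero] by simp
  have UK: "U \<subseteq> ?K" unfolding U_def coord_subspace_def by blast
  have zU: "{\<zero>\<^bsub>F n\<^esub>} \<subseteq> U" using Fn.submoduleD(3)[OF submodule_U] by blast
  define p where "p z = (\<lambda>i\<in>{..<n}. if b0 \<le> i then z i else \<zero>\<^bsub>R\<^esub>)" for z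
  have p: "p \<in> mod_hom R (F n) (F n)" by (auto simp: mod_hom_iff p_def fun_eq_iff PiE_iff)
  have pW: "p z \<in> ?W" if "z \<in> carrier (F n)" for z using that by (auto simp: p_def coord_subspace_def PiE_iff)
  have W: "z \<in> ?K \<and> p z = z" if z: "z \<in> ?W" for z
  proof
    have zc: "z \<in> carrier (F n)" and z0: "\<And>i. i < b0 \<Longrightarrow> z i = \<zero>\<^bsub>R\<^esub>"
      using z n(1) by (auto simp: coord_subspace_def)
    have "pairing z (\<alpha> u) = \<zero>\<^bsub>R\<^esub>" if u: "u \<in> carrier (F n)" for u
    proof -
      have au: "\<alpha> u \<in> carrier (F n)" by (rule mod_homD(1)[OF \<alpha>_hom u])
      have "pairing z (\<alpha> u) = (\<Oplus>\<^bsub>regular_module R\<^esub>j\<in>{..<n}. \<zero>\<^bsub>regular_module R\<^esub>)"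
        unfolding lincomb_def
      proof (rule N.M.finsum_cong')
        fix j assume j: "j \<in> {..<n}"
        have "z j \<in> carrier R" "\<alpha> u j \<in> carrier R" using zc au j by (auto simp: PiE_iff)
        moreover have "\<alpha> u j = \<zero>\<^bsub>R\<^esub>" if "b0 \<le> j"
        proof -
          have "j - b0 < k" using that j n(1) by auto
          then show ?thesis using that j n(1) by (simp add: \<alpha>_def join_vec_def)
        qed
        ultimately show "z j \<odot>\<^bsub>regular_module R\<^esub> \<alpha> u j = \<zero>\<^bsub>regular_module R\<^esub>" using z0[of j] by (cases "j < b0") auto
      qed auto
      also have "\<dots> = \<zero>\<^bsub>R\<^esub>" using N.M.finsum_zero unfolding regular_module_simps .
      finally show ?thesis .
    qed
    then show "z \<in> ?K" using row_ker_iff[OF zc] zc by blast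
    have "p z i = z i" if "i < n" for i using z0 that by (simp add: p_def)
    then show "p z = z" using mod_homD(1)[OF p zc] zc unfolding free_mod_eq_pow_mod by (intro pow_mod_eqI)
  qed
  have imK: "p ` ?K = ?W"
  proof
    show "p ` ?K \<subseteq> ?W" using pW by blast
    show "?W \<subseteq> p ` ?K"
    proof
      fix z assume "z \<in> ?W"
      then have "z \<in> ?K" "p z = z" using W by blast+
      then show "z \<in> p ` ?K" by (intro image_eqI[of _ _ z]) simp_all
    qed
  qed
  have pU: "p z = \<zero>\<^bsub>F n\<^esub>" if "z \<in> U" for z
    using that U_iff by (auto simp: p_def fun_eq_iff)
  have imU: "p ` U = {\<zero>\<^bsub>F n\<^esub>}"
  proof
    show "p ` U \<subseteq> {\<zero>\<^bsub>F n\<^esub>}" using pU by blast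
    have "\<zero>\<^bsub>F n\<^esub> \<in> U" using zU by blast
    then have "p \<zero>\<^bsub>F n\<^esub> \<in> p ` U" "p \<zero>\<^bsub>F n\<^esub> = \<zero>\<^bsub>F n\<^esub>" using pU by blast+
    then show "{\<zero>\<^bsub>F n\<^esub>} \<subseteq> p ` U" by simp
  qed
  have kerp: "z \<in> U" if z: "z \<in> ?K" "p z = \<zero>\<^bsub>F n\<^esub>" for z
  proof -
    have "z j = \<zero>\<^bsub>R\<^esub>" if "j < n" "j \<notin> {..<b0}" for j
      using fun_cong[OF z(2), of j] that by (simp add: p_def)
    then show ?thesis using z(1) unfolding U_def coord_subspace_def by blast
  qed
  have "herbrand R S (F n) n A B ?K U = herbrand R S (F n) n A B (p ` ?K) (p ` U)"
    by (rule c.herbrand_hom[OF F F p K submodule_U UK kerp, symmetric])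
  also have "\<dots> = 0" unfolding imK imU by (rule c.herbrand_coord)
  finally show ?thesis
    using c.herbrand_add[OF fg_free[OF cring] K submodule_U Fn.submodule_zero zU UK] herbrand_U[OF S zero] by simp
qed

text \<open>If the identity is not null-homotopic, lengths at a minimal prime over \<open>I\<close> give an element of \<open>I\<close> outside
  that prime.\<close>

theorem free_if_rigid:
  assumes ext: "hom_extends R M b0 e"
    and zero: "rational_reduced_groth_class R (dual_module R M) = \<one>\<^bsub>rational_reduced_groth_group R\<^esub>"
  shows "is_free R M"
proof (cases "\<one>\<^bsub>R\<^esub> \<in> I")
  case True
  then show ?thesis by (rule free_if_one_in_I)
next
  case False
  then obtain S where S: "maximal_mult_set R I S" using ex_maximal_mult_set[OF cring] by blast
  interpret c: exact_periodic_complex R n A B I S by (rule exact_periodic[OF S])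
  have "\<exists>s\<in>S. \<exists>Y\<in>mats R n. \<exists>Z\<in>mats R n. s \<odot>\<^bsub>pow_mod (F n) n\<^esub> id_mat R n =
      mat_mult R n Y B \<oplus>\<^bsub>pow_mod (F n) n\<^esub> mat_mult R n A Z"
    by (rule c.null_homotopic_unit[OF _ herbrand_row_ker[OF S zero]]) (rule lift_matrices[OF ext])
  then obtain s where "s \<in> S" "\<exists>Y\<in>mats R n. \<exists>Z\<in>mats R n. s \<odot>\<^bsub>pow_mod (F n) n\<^esub> id_mat R n =
      mat_mult R n Y B \<oplus>\<^bsub>pow_mod (F n) n\<^esub> mat_mult R n A Z" by blast
  then have "s \<in> S \<inter> I" using maximal_mult_setD(2)[OF S] unfolding I_def by blast
  then show ?thesis using maximal_mult_setD(4)[OF S] by blast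
qed

end

theorem proposition4p1:
  fixes R :: "('a, 'r) ring_scheme" and M :: "('a, 'm, 'c) module_scheme"
  assumes "local_ring R" and "noetherian_ring R"
    and "fg_module R M"
    and "rational_reduced_groth_class R (dual_module R M) = \<one>\<^bsub>rational_reduced_groth_group R\<^esub>"
    and "generically_free R M"
    and "periodic 2 R M" and "rigid R M"
  shows "is_free R M"
proof -
  have R: "cring R" using assms(1) by (simp add: local_ring_def)
  interpret R: cring R by (rule R)
  interpret m: maximalideal "max_ideal R" R by (rule maximalideal_max_ideal[OF assms(1)])
  have M: "module R M" using assms(3) by (simp add: fg_module_def)
  have one: "\<one>\<^bsub>R\<^esub> \<noteq> \<zero>\<^bsub>R\<^esub>" using m.one_imp_carrier m.I_notcarr m.zero_closed by auto
  obtain G k l where G: "minimal_free_resolution R M G"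
    and iso: "mod_iso R (direct_sum M (free_mod R k)) (direct_sum (syzygy R G 2) (free_mod R l))"
    using assms(6) unfolding periodic_def by blast
  define b0 b1 where "b0 = res_rank G 0" and "b1 = res_rank G 1"
  define e d where "e = res_aug G" and "d = res_diff G 1"
  define Z where "Z = a_kernel (free_mod R b1) (free_mod R b0) d"
  note defs = b0_def b1_def e_def d_def
  have e: "e \<in> mod_hom R (free_mod R b0) M" "e ` carrier (free_mod R b0) = carrier M"
    and d: "d \<in> mod_hom R (free_mod R b1) (free_mod R b0)"
      "d ` carrier (free_mod R b1) = a_kernel (free_mod R b0) M e"
    and im2: "res_diff G 2 ` carrier (res_mod R G 2) = Z"
    using G unfolding minimal_free_resolution_def free_resolution_def Z_def defs
    by (simp_all add: res_mod_def numeral_2_eq_2 del: free_mod_simps)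
  have min: "d x i \<in> max_ideal R" if "x \<in> carrier (free_mod R b1)" "i < b0" for x i
    using G that unfolding minimal_free_resolution_def defs by (simp add: res_mod_def del: free_mod_simps)
  have "syzygy R G 2 = (free_mod R b1)\<lparr>carrier := Z\<rparr>"
    unfolding syzygy_def im2 by (simp add: res_mod_def b1_def)
  then have iso': "mod_iso R (direct_sum M (free_mod R k)) (direct_sum ((free_mod R b1)\<lparr>carrier := Z\<rparr>) (free_mod R l))"
    using iso by simp
  have rank: "b0 + k = b1 + l" by (rule periodic_rank_eq[OF R assms(2) one M e d Z_def iso'])
  obtain \<phi> where \<phi>: "\<phi> \<in> mod_hom R (direct_sum M (free_mod R k)) (direct_sum ((free_mod R b1)\<lparr>carrier := Z\<rparr>) (free_mod R l))"
    "bij_betw \<phi> (carrier (direct_sum M (free_mod R k))) (carrier (direct_sum ((free_mod R b1)\<lparr>carrier := Z\<rparr>) (free_mod R l)))"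
    using iso' unfolding mod_iso_def by blast
  have \<phi>': "bij_betw \<phi> (carrier M \<times> carrier (free_mod R k)) (Z \<times> carrier (free_mod R l))"
    using \<phi>(2) by (simp del: free_mod_simps)
  interpret t: two_periodic_module R M e d b0 b1 k l "b0 + k" Z \<phi>
    by (rule two_periodic_module.intro[OF assms(1,2) M e d min Z_def \<phi>(1) \<phi>' refl rank])
  obtain m' e' where e': "e' \<in> mod_hom R (free_mod R m') M" "e' ` carrier (free_mod R m') = carrier M" "hom_extends R M m' e'"
    using rigid_hom_extends[OF R M assms(7)] .
  show ?thesis
    by (rule t.free_if_rigid[OF hom_extends_independent[OF R M e' e] assms(4)])
qed

end
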